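(* Fix $n\geq 2$. Let $M$ be a smooth hypersurface of the Heisenberg group $\mathbb{H}^n$ which is connected, orientable, compact, and without boundary. Suppose that $M$ is umbilic and that there is a constant $c\neq 0$ such that, at every non-characteristic point $\xi=(x,y,t)\in M$, the horizontal mean curvature of $M$ (with respect to the outward normal) satisfies $H_M(\xi)=c\sqrt{|x|^2+|y|^2}$. Then $c>0$ and there exists $t_0\in\mathbb{R}$ such that $M=\partial B_R(\xi_0)$ with $R=\sqrt{\frac{1}{c}\,\frac{2n+1}{2n-1}}$ and $\xi_0=(0,0,t_0)$.
   Context: The Heisenberg group $\mathbb{H}^n$ is $\mathbb{R}^n\times\mathbb{R}^n\times\mathbb{R}$ with points $\xi=(x,y,t)$ and group law $(x,y,t)\circ(x',y',t')=(x+x',y+y',t+t'+2\sum_{k=1}^n(x_ky'_k-y_kx'_k))$. Let $X_j=\partial_{x_j}-2y_j\partial_t$, $Y_j=\partial_{y_j}+2x_j\partial_t$ ($j=1,\dots,n$), $T=\partial_t$; let $\mathcal{H}_\xi=\mathrm{span}\{X_1,\dots,X_n,Y_1,\dots,Y_n\}$ at $\xi$ be the horizontal distribution, let $\langle\cdot,\cdot\rangle$ be the Riemannian metric making $\{X_1,\dots,X_n,Y_1,\dots,Y_n,T\}$ orthonormal, with norm $|\cdot|$ and Levi-Civita connection $\nabla$, and let $\mathcal{P}_H$ be the orthogonal projection onto $\mathcal{H}$. Let $J$ be the linear map on $\mathcal{H}$ with $J(X_i)=Y_i$, $J(Y_i)=-X_i$. The homogeneous gauge is $\rho(x,y,t)=((|x|^2+|y|^2)^2+t^2)^{1/4}$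 and the gauge balls are $B_R(\xi_0)=\{\xi : \rho(\xi_0^{-1}\circ\xi)<R\}$. A smooth hypersurface $M\subset\mathbb{H}^n$ is an (embedded) codimension-one submanifold of class $C^2$ that is $C^\infty$ away from its characteristic set. Let $\nu$ be the outward unit normal ($M$ compact without boundary). The characteristic set is $S_M=\{\xi\in M : T_\xi M=\mathcal{H}_\xi\}=\{\xi\in M:\mathcal{P}_H(\nu)=0\}$. On $M\smallsetminus S_M$ the horizontal normal is $\nu^H=\mathcal{P}_H(\nu)/|\mathcal{P}_H(\nu)|$, and $\eta=-J\nu^H\in\mathcal{H}\cap TM$. The horizontal mean curvature at $\xi\in M\smallsetminus S_M$ is $H_M(\xi)=\frac{1}{2n-1}\sum_{i=1}^{2n-1}\langle\nabla_{e_i}\nu^H,e_i\rangle$ for any orthonormal basis $\{e_i\}$ of $\mathcal{H}_\xi\cap T_\xi M$ (equivalently $\mathrm{div}(\nu^H)/(2n-1)$). The horizontal shape operator at $\xi\in M\smallsetminus S_M$ is the symmetric endomorphism of $\mathcal{H}_\xi\cap T_\xi M$ given by $A_M(Z)=\mathcal{P}_H(\nabla_Z\nu^H)-\frac{2\langle\nu,T\rangle}{|\mathcal{P}_H(\nu)|}\left(J(Z)-\langle\eta,Z\rangle\nu^H\right)$. For $n\ge 2$, $M$ is called umbilic if there are functions $k,l$ on $M\smallsetminus S_M$ such that $A_M(Z)=(l-k)\langle\eta,Z\rangle\eta+kZ$ for all $Z\in\mathcal{H}\cap TM$. *)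

theory Defs
  imports "HOL-Analysis.Analysis" "HOL-Library.Extended_Nat"
begin

section \<open>The Heisenberg group\<close>

text \<open>
  Points are triples (x, y, t). Tangent vectors at every point are written in the coordinate
  basis of the ambient vector space, so they have the same type as points.
\<close>

type_synonym 'n heis = "(real ^ 'n) \<times> (real ^ 'n) \<times> real"

definition heis_mult :: "'n::finite heis \<Rightarrow> 'n heis \<Rightarrow> 'n heis" where
  "heis_mult = (\<lambda>(x, y, t) (x', y', t').
     (x + x', y + y', t + t' + 2 * (\<Sum>k\<in>UNIV. x $ k * y' $ k - y $ k * x' $ k)))"

definition heis_inverse :: "'n::finite heis \<Rightarrow> 'n heis" where
  "heis_inverse = (\<lambda>(x, y, t). (- x, - y, - t))"

lemma heis_mult_inverse:
  "heis_mult (heis_inverse p) p = 0" "heis_mult p (heis_inverse p) = 0"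
  by (auto simp: heis_mult_def heis_inverse_def zero_prod_def split: prod.splits)

definition heis_gauge :: "'n::finite heis \<Rightarrow> real" where
  "heis_gauge = (\<lambda>(x, y, t). root 4 (((norm x)\<^sup>2 + (norm y)\<^sup>2)\<^sup>2 + t\<^sup>2))"

definition gauge_ball :: "'n::finite heis \<Rightarrow> real \<Rightarrow> 'n heis set" where
  "gauge_ball p R = {q. heis_gauge (heis_mult (heis_inverse p) q) < R}"

definition frame_X :: "'n::finite \<Rightarrow> 'n heis \<Rightarrow> 'n heis" where
  "frame_X j = (\<lambda>(x, y, t). (axis j 1, 0, - 2 * y $ j))"

definition frame_Y :: "'n::finite \<Rightarrow> 'n heis \<Rightarrow> 'n heis" where
  "frame_Y j = (\<lambda>(x, y, t). (0, axis j 1, 2 * x $ j))"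

definition frame_T :: "'n::finite heis \<Rightarrow> 'n heis" where
  "frame_T = (\<lambda>_. (0, 0, 1))"

definition horizontal_space :: "'n::finite heis \<Rightarrow> 'n heis set" where
  "horizontal_space p = span (range (\<lambda>j. frame_X j p) \<union> range (\<lambda>j. frame_Y j p))"

text \<open>
  The coefficients of a vector (a, b, s) at (x, y, t) in the frame X, Y, T are a, b and
  s + 2 (y \<bullet> a - x \<bullet> b).
\<close>

definition T_coeff :: "'n::finite heis \<Rightarrow> 'n heis \<Rightarrow> real" where
  "T_coeff = (\<lambda>(x, y, t) (a, b, s). s + 2 * (y \<bullet> a - x \<bullet> b))"

definition heis_metric :: "'n::finite heis \<Rightarrow> 'n heis \<Rightarrow> 'n heis \<Rightarrow> real" where
  "heis_metric p u v =
     fst u \<bullet> fst v + fst (snd u) \<bullet> fst (snd v) + T_coeff p u * T_coeff p v"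

lemma frame_decomposition:
  "v = (\<Sum>j\<in>UNIV. fst v $ j *\<^sub>R frame_X j p) + (\<Sum>j\<in>UNIV. fst (snd v) $ j *\<^sub>R frame_Y j p)
       + T_coeff p v *\<^sub>R frame_T p"
proof -
  obtain x y t a b s where pv: "p = (x, y, t)" "v = (a, b, s)"
    by (metis prod.exhaust)
  have *: "(\<Sum>j\<in>UNIV. c $ j *\<^sub>R axis j 1) = c" for c :: "real^'n"
    using basis_expansion[of c] by (simp add: scalar_mult_eq_scaleR)
  show ?thesis
    by (simp add: pv frame_X_def frame_Y_def frame_T_def T_coeff_def prod_eq_iff
        fst_sum snd_sum * inner_vec_def sum_distrib_left sum_negf algebra_simps)
qed

lemma frame_orthonormal:
  "heis_metric p (frame_X i p) (frame_X j p) = (if i = j then 1 else 0)"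
  "heis_metric p (frame_Y i p) (frame_Y j p) = (if i = j then 1 else 0)"
  "heis_metric p (frame_X i p) (frame_Y j p) = 0"
  "heis_metric p (frame_Y i p) (frame_X j p) = 0"
  "heis_metric p (frame_X i p) (frame_T p) = 0"
  "heis_metric p (frame_T p) (frame_X i p) = 0"
  "heis_metric p (frame_Y i p) (frame_T p) = 0"
  "heis_metric p (frame_T p) (frame_Y i p) = 0"
  "heis_metric p (frame_T p) (frame_T p) = 1"
proof -
  have axis: "axis k (1::real) $ l = (if k = l then 1 else 0)" for k l :: 'a
    by (auto simp: axis_def)
  show "heis_metric p (frame_X i p) (frame_X j p) = (if i = j then 1 else 0)"
    "heis_metric p (frame_Y i p) (frame_Y j p) = (if i = j then 1 else 0)"
    "heis_metric p (frame_X i p) (frame_Y j p) = 0"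
    "heis_metric p (frame_Y i p) (frame_X j p) = 0"
    "heis_metric p (frame_X i p) (frame_T p) = 0"
    "heis_metric p (frame_T p) (frame_X i p) = 0"
    "heis_metric p (frame_Y i p) (frame_T p) = 0"
    "heis_metric p (frame_T p) (frame_Y i p) = 0"
    "heis_metric p (frame_T p) (frame_T p) = 1"
    by (auto simp: heis_metric_def T_coeff_def frame_X_def frame_Y_def frame_T_def
        inner_axis axis split: prod.splits)
qed

lemma bilinear_heis_metric: "bilinear (heis_metric p)"
  by (auto simp: bilinear_def heis_metric_def T_coeff_def inner_simps algebra_simps
      intro!: linearI split: prod.splits)

definition heis_norm :: "'n::finite heis \<Rightarrow> 'n heis \<Rightarrow> real" where
  "heis_norm p v = sqrt (heis_metric p v v)"

definition horizontal_proj :: "'n::finite heis \<Rightarrow> 'n heis \<Rightarrow> 'n heis" where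
  "horizontal_proj p v = v - heis_metric p v (frame_T p) *\<^sub>R frame_T p"

text \<open>Only used on horizontal vectors; it is extended to all vectors by J(T) = 0.\<close>

definition heis_J :: "'n::finite heis \<Rightarrow> 'n heis \<Rightarrow> 'n heis" where
  "heis_J p v = (\<Sum>i\<in>UNIV. heis_metric p v (frame_X i p) *\<^sub>R frame_Y i p
                         - heis_metric p v (frame_Y i p) *\<^sub>R frame_X i p)"

lemma heis_J_frame:
  "heis_J p (frame_X i p) = frame_Y i p" "heis_J p (frame_Y i p) = - frame_X i p"
  by (simp_all add: heis_J_def frame_orthonormal sum_negf if_distrib[of "\<lambda>r. r *\<^sub>R _"] cong: if_cong)


section \<open>The Levi-Civita connection\<close>

text \<open>
  In the global coordinates a connection has the form D V W + G(V, W), where D is the flat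
  derivative and G is bilinear at each point. As constant coordinate fields commute, the
  connection is torsion-free iff G is symmetric, and it is metric iff the second condition
  below holds for all constant fields u, v.
\<close>

definition levi_civita_symbol_at :: "'n::finite heis \<Rightarrow> ('n heis \<Rightarrow> 'n heis \<Rightarrow> 'n heis) \<Rightarrow> bool" where
  "levi_civita_symbol_at p G \<longleftrightarrow> bilinear G \<and>
     (\<forall>u v. G u v = G v u) \<and>
     (\<forall>u v. ((\<lambda>q. heis_metric q u v) has_derivative
              (\<lambda>w. heis_metric p (G w u) v + heis_metric p u (G w v))) (at p))"

definition levi_civita_symbol :: "'n::finite heis \<Rightarrow> 'n heis \<Rightarrow> 'n heis \<Rightarrow> 'n heis" where
  "levi_civita_symbol p = (THE G. levi_civita_symbol_at p G)"

lemma T_coeff_has_derivative: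
  "((\<lambda>q. T_coeff q v) has_derivative
     (\<lambda>w. 2 * (fst (snd w) \<bullet> fst v - fst w \<bullet> fst (snd v)))) (at p)"
proof -
  have eq: "(\<lambda>q. T_coeff q v) =
        (\<lambda>q. snd (snd v) + 2 * (fst (snd q) \<bullet> fst v - fst q \<bullet> fst (snd v)))"
    by (auto simp: T_coeff_def fun_eq_iff split: prod.splits)
  show ?thesis
    unfolding eq by (auto intro!: derivative_eq_intros)
qed

lemma heis_metric_pos: "v \<noteq> 0 \<Longrightarrow> heis_metric p v v > 0"
proof -
  assume v: "v \<noteq> 0"
  have "heis_metric p v v = 0 \<Longrightarrow> v = 0"
  proof -
    assume "heis_metric p v v = 0"
    then have 0: "fst v \<bullet> fst v + fst (snd v) \<bullet> fst (snd v) + (T_coeff p v)\<^sup>2 = 0"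
      by (simp add: heis_metric_def power2_eq_square)
    have "fst v \<bullet> fst v \<ge> 0" "fst (snd v) \<bullet> fst (snd v) \<ge> 0" "(T_coeff p v)\<^sup>2 \<ge> 0"
      by auto
    with 0 have "fst v \<bullet> fst v = 0" "fst (snd v) \<bullet> fst (snd v) = 0" "(T_coeff p v)\<^sup>2 = 0"
      by linarith+
    then have "fst v = 0" "fst (snd v) = 0" "T_coeff p v = 0"
      by auto
    then show "v = 0"
      by (cases v, cases p) (auto simp: T_coeff_def zero_prod_def)
  qed
  moreover have "heis_metric p v v \<ge> 0"
    by (simp add: heis_metric_def)
  ultimately show ?thesis
    using v by fastforce
qed

lemma levi_civita_symbol_unique:
  assumes G: "levi_civita_symbol_at p G" and G': "levi_civita_symbol_at p G'"
  shows "G = G'"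
proof -
  define D where "D u v = G u v - G' u v" for u v
  have lin: "heis_metric p (a - b) c = heis_metric p a c - heis_metric p b c"
            "heis_metric p c (a - b) = heis_metric p c a - heis_metric p c b" for a b c
    using bilinear_heis_metric[of p] by (auto simp: bilinear_lsub bilinear_rsub)
  have sym: "D u v = D v u" for u v
    using G G' unfolding D_def levi_civita_symbol_at_def by metis
  have comm: "heis_metric p a b = heis_metric p b a" for a b
    by (simp add: heis_metric_def inner_commute mult.commute)
  have skew: "heis_metric p (D w u) v + heis_metric p u (D w v) = 0" for u v w
  proof -
    have "(\<lambda>w. heis_metric p (G w u) v + heis_metric p u (G w v)) =
          (\<lambda>w. heis_metric p (G' w u) v + heis_metric p u (G' w v))"
      using G G' has_derivative_unique unfolding levi_civita_symbol_at_def by blast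
    from fun_cong[OF this, of w] show ?thesis
      by (simp add: D_def lin)
  qed
  have "heis_metric p (D w u) v = 0" for u v w
  proof -
    have "heis_metric p (D w u) v = - heis_metric p (D w v) u" for u v w
      using skew[of w u v] comm[of u "D w v"] by linarith
    then show ?thesis
      using sym by (smt (verit))
  qed
  then have "D u v = 0" for u v
    using heis_metric_pos by (metis less_irrefl)
  then show ?thesis
    by (auto simp: D_def fun_eq_iff)
qed

lemma levi_civita_symbol_exists: "\<exists>G. levi_civita_symbol_at p G"
proof -
  define A where "A u v = 2 *\<^sub>R (T_coeff p u *\<^sub>R fst (snd v) + T_coeff p v *\<^sub>R fst (snd u))" for u v
  define B where "B u v = - 2 *\<^sub>R (T_coeff p u *\<^sub>R fst v + T_coeff p v *\<^sub>R fst u)" for u v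
  define G where "G u v = (A u v, B u v, 2 * (fst p \<bullet> B u v - fst (snd p) \<bullet> A u v))" for u v
  have T: "T_coeff p (u + v) = T_coeff p u + T_coeff p v" "T_coeff p (r *\<^sub>R u) = r * T_coeff p u" for u v r
    by (auto simp: T_coeff_def inner_simps algebra_simps split: prod.splits)
  have bil: "bilinear G"
    unfolding bilinear_def
    by (intro conjI allI linearI)
       (simp_all only: G_def A_def B_def T fst_add snd_add fst_scaleR snd_scaleR,
        simp_all add: inner_simps algebra_simps)
  have sym: "G u v = G v u" for u v
    by (simp add: G_def A_def B_def add.commute)
  have TG: "T_coeff p (G u v) = 0" for u v
    by (cases p) (simp add: G_def T_coeff_def)
  have "((\<lambda>q. heis_metric q u v) has_derivative
              (\<lambda>w. heis_metric p (G w u) v + heis_metric p u (G w v))) (at p)" for u v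
    unfolding heis_metric_def TG
    by (auto intro!: derivative_eq_intros T_coeff_has_derivative
        simp: fun_eq_iff G_def A_def B_def inner_simps inner_commute algebra_simps)
  with bil sym show ?thesis
    unfolding levi_civita_symbol_at_def by blast
qed

lemma levi_civita_symbol: "levi_civita_symbol_at p (levi_civita_symbol p)"
  unfolding levi_civita_symbol_def
  using levi_civita_symbol_exists levi_civita_symbol_unique by (metis theI)

text \<open>
  The covariant derivative at p, in direction Z tangent to M, of a field W given along M.
  The derivative within M is chosen by frechet_derivative, but its value on tangent
  directions of M does not depend on the choice.
\<close>

definition covariant_derivative ::
    "'n::finite heis set \<Rightarrow> ('n heis \<Rightarrow> 'n heis) \<Rightarrow> 'n heis \<Rightarrow> 'n heis \<Rightarrow> 'n heis" where
  "covariant_derivative M W p Z =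
     frechet_derivative W (at p within M) Z + levi_civita_symbol p Z (W p)"


section \<open>Hypersurfaces\<close>

text \<open>Class C^k; meant for open U only.\<close>

fun C_nat_on :: "nat \<Rightarrow> 'a::real_normed_vector set \<Rightarrow> ('a \<Rightarrow> real) \<Rightarrow> bool" where
  "C_nat_on 0 U f \<longleftrightarrow> continuous_on U f"
| "C_nat_on (Suc k) U f \<longleftrightarrow> (\<forall>x\<in>U. f differentiable (at x)) \<and>
     (\<forall>v. C_nat_on k U (\<lambda>x. frechet_derivative f (at x) v))"

definition C_on :: "enat \<Rightarrow> 'a::real_normed_vector set \<Rightarrow> ('a \<Rightarrow> real) \<Rightarrow> bool" where
  "C_on k U f \<longleftrightarrow> (\<forall>m. enat m \<le> k \<longrightarrow> C_nat_on m U f)"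

text \<open>Embedded hypersurfaces of class C^k, without boundary, as local regular level sets.\<close>

definition hypersurface :: "enat \<Rightarrow> 'n::finite heis set \<Rightarrow> bool" where
  "hypersurface k M \<longleftrightarrow> (\<forall>p\<in>M. \<exists>U F. open U \<and> p \<in> U \<and> C_on k U F \<and>
     (\<forall>q\<in>U. frechet_derivative F (at q) \<noteq> (\<lambda>_. 0)) \<and>
     M \<inter> U = {q\<in>U. F q = 0})"

definition tangent_space :: "'n::finite heis set \<Rightarrow> 'n heis \<Rightarrow> 'n heis set" where
  "tangent_space M p = {v. \<exists>\<gamma> \<epsilon>. \<epsilon> > 0 \<and> \<gamma> 0 = p \<and> (\<forall>s. \<bar>s\<bar> < \<epsilon> \<longrightarrow> \<gamma> s \<in> M) \<and>
     (\<gamma> has_vector_derivative v) (at (0::real))}"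

definition characteristic_set :: "'n::finite heis set \<Rightarrow> 'n heis set" where
  "characteristic_set M = {p\<in>M. tangent_space M p = horizontal_space p}"

definition smooth_hypersurface :: "'n::finite heis set \<Rightarrow> bool" where
  "smooth_hypersurface M \<longleftrightarrow> hypersurface 2 M \<and> hypersurface \<infinity> (M - characteristic_set M)"

definition unit_normal_field :: "'n::finite heis set \<Rightarrow> ('n heis \<Rightarrow> 'n heis) \<Rightarrow> bool" where
  "unit_normal_field M \<nu> \<longleftrightarrow> continuous_on M \<nu> \<and>
     (\<forall>p\<in>M. heis_norm p (\<nu> p) = 1 \<and> (\<forall>v\<in>tangent_space M p. heis_metric p (\<nu> p) v = 0))"

definition orientable_hypersurface :: "'n::finite heis set \<Rightarrow> bool" where
  "orientable_hypersurface M \<longleftrightarrow> (\<exists>\<nu>. unit_normal_field M \<nu>)"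

text \<open>
  Outward means pointing into the unbounded component of the complement, which is
  outside M when M is compact.
\<close>

definition outward_unit_normal :: "'n::finite heis set \<Rightarrow> ('n heis \<Rightarrow> 'n heis) \<Rightarrow> bool" where
  "outward_unit_normal M \<nu> \<longleftrightarrow> unit_normal_field M \<nu> \<and>
     (\<forall>p\<in>M. \<forall>\<^sub>F s in at_right 0. p + s *\<^sub>R \<nu> p \<in> outside M)"


section \<open>Horizontal curvature\<close>

definition horizontal_normal :: "('n::finite heis \<Rightarrow> 'n heis) \<Rightarrow> 'n heis \<Rightarrow> 'n heis" where
  "horizontal_normal \<nu> p =
     (1 / heis_norm p (horizontal_proj p (\<nu> p))) *\<^sub>R horizontal_proj p (\<nu> p)"

definition eta_field :: "('n::finite heis \<Rightarrow> 'n heis) \<Rightarrow> 'n heis \<Rightarrow> 'n heis" where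
  "eta_field \<nu> p = - heis_J p (horizontal_normal \<nu> p)"

definition orthonormal_basis_at ::
    "'n::finite heis \<Rightarrow> 'n heis set \<Rightarrow> 'n heis set \<Rightarrow> bool" where
  "orthonormal_basis_at p V B \<longleftrightarrow> B \<subseteq> V \<and> span B = V \<and>
     (\<forall>e\<in>B. \<forall>f\<in>B. heis_metric p e f = (if e = f then 1 else 0))"

definition horizontal_mean_curvature ::
    "'n::finite heis set \<Rightarrow> ('n heis \<Rightarrow> 'n heis) \<Rightarrow> 'n heis \<Rightarrow> real" where
  "horizontal_mean_curvature M \<nu> p =
     (THE h. \<forall>B. orthonormal_basis_at p (horizontal_space p \<inter> tangent_space M p) B \<longrightarrow>
        h = 1 / (2 * real CARD('n) - 1) *
          (\<Sum>e\<in>B. heis_metric p (covariant_derivative M (horizontal_normal \<nu>) p e) e))"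

definition horizontal_shape_operator ::
    "'n::finite heis set \<Rightarrow> ('n heis \<Rightarrow> 'n heis) \<Rightarrow> 'n heis \<Rightarrow> 'n heis \<Rightarrow> 'n heis" where
  "horizontal_shape_operator M \<nu> p Z =
     horizontal_proj p (covariant_derivative M (horizontal_normal \<nu>) p Z)
     - (2 * heis_metric p (\<nu> p) (frame_T p) / heis_norm p (horizontal_proj p (\<nu> p))) *\<^sub>R
       (heis_J p Z - heis_metric p (eta_field \<nu> p) Z *\<^sub>R horizontal_normal \<nu> p)"

definition umbilic :: "'n::finite heis set \<Rightarrow> ('n heis \<Rightarrow> 'n heis) \<Rightarrow> bool" where
  "umbilic M \<nu> \<longleftrightarrow> (\<exists>k l :: 'n heis \<Rightarrow> real.
     \<forall>p\<in>M - characteristic_set M. \<forall>Z\<in>horizontal_space p \<inter> tangent_space M p.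
       horizontal_shape_operator M \<nu> p Z =
         ((l p - k p) * heis_metric p (eta_field \<nu> p) Z) *\<^sub>R eta_field \<nu> p + k p *\<^sub>R Z)"

end

theory Submission
  imports Defs
begin

text \<open>
  Write the horizontal normal as a unit vector N in the coefficients z = (x, y) of the left-invariant
  frame and let E' be the orthogonal complement of N and J N. Umbilicity says that the derivative
  of N along w in E' is (k + \<alpha> J) w, and that it is l \<eta> along \<eta> = - J N. The Codazzi equations, obtained
  from commutators of vector fields tangent to M, show that l is constant along E'. As
  (2 n - 2) k + l is a multiple of |z|, they also force the component of z in E' to vanish, so
  z = a N + b J N, and a, b, s = |z| and t satisfy a closed system of ordinary differential
  equations along \<eta>. The function K = (a - C s^3) s^(2 n - 2) with C = c (2 n - 1) / (2 n + 1) is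
  locally constant. If K is not 0 then M avoids the axis z = 0, and the maximum on M of a function
  that is strictly monotone along \<eta> gives a contradiction. If K = 0 then t + b / (C s) is locally
  constant too, and M is locally a gauge sphere with center on the axis.
\<close>

section \<open>Continuously differentiable maps\<close>

text \<open>The equations hold only on M, and umbilicity supplies k and l as bare functions without
  regularity. Near a noncharacteristic point off the axis, M is therefore given by a smooth F whose
  horizontal gradient has length 1 on M. The gradient extends N to a neighbourhood, l is read off as
  an entry of its derivative, and k follows from the curvature equation. Identities known on M are
  differentiated in tangent directions only. The horizontal tangent directions miss one dimension of
  M. It is recovered from the bracket of w and J w with w in E', which is nonzero because n >= 2; so
  horizontal derivatives alone decide whether a function is locally constant on M. The local
  equations break down on the axis. Two limit arguments deal with it: the decomposition of z shows
  that the characteristic points are exactly the points of M on the axis, and |a| <= s makes K tend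
  to 0 there, so that a nonzero value of K cannot approach the axis. For K = 0 the poles of the
  sphere are added at the end, as limits of its other points.\<close>

abbreviation D :: "('a::real_normed_vector \<Rightarrow> 'b::real_normed_vector) \<Rightarrow> 'a \<Rightarrow> 'a \<Rightarrow> 'b" where
  "D f p \<equiv> frechet_derivative f (at p)"

text \<open>The predicate C_nat_on for vector-valued maps.\<close>

fun Cn :: "nat \<Rightarrow> 'a::real_normed_vector set \<Rightarrow> ('a \<Rightarrow> 'b::real_normed_vector) \<Rightarrow> bool" where
  "Cn 0 U f \<longleftrightarrow> continuous_on U f"
| "Cn (Suc k) U f \<longleftrightarrow> (\<forall>x\<in>U. f differentiable (at x)) \<and> (\<forall>v. Cn k U (\<lambda>x. D f x v))"

definition smooth :: "'a::real_normed_vector set \<Rightarrow> ('a \<Rightarrow> 'b::real_normed_vector) \<Rightarrow> bool" where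
  "smooth U f \<longleftrightarrow> (\<forall>k. Cn k U f)"

lemma D_eqI: "(f has_derivative f') (at p) \<Longrightarrow> D f p = f'"
  using frechet_derivative_at by metis

lemma D_works: "f differentiable (at p) \<Longrightarrow> (f has_derivative D f p) (at p)"
  using frechet_derivative_works by blast

lemma C_nat_on_iff_Cn: "C_nat_on k U f \<longleftrightarrow> Cn k U f"
  by (induction k arbitrary: f) auto

text \<open>No differentiability is assumed: \<open>frechet_derivative\<close> is a choice among all
  derivatives, and f and g have the same ones at p.\<close>

lemma D_cong_open:
  assumes "open U" "p \<in> U" "\<And>q. q \<in> U \<Longrightarrow> f q = g q"
  shows "D f p = D g p"
proof -
  have "(f has_derivative h) (at p) \<longleftrightarrow> (g has_derivative h) (at p)" for h
    using assms has_derivative_transform_within_open[of f h p UNIV U g]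
      has_derivative_transform_within_open[of g h p UNIV U f] by auto
  then show ?thesis by (simp add: frechet_derivative_def)
qed

lemma Cn_cong:
  assumes "open U" "\<And>q. q \<in> U \<Longrightarrow> f q = g q" "Cn k U f"
  shows "Cn k U g"
  using assms(2,3)
proof (induction k arbitrary: f g)
  case 0
  then show ?case by (simp cong: continuous_on_cong)
next
  case (Suc k)
  have "g differentiable (at x)" if "x \<in> U" for x
    using Suc.prems that assms(1)
    by (metis Cn.simps(2) differentiable_def has_derivative_transform_within_open)
  moreover have "Cn k U (\<lambda>x. D g x v)" for v
    using Suc.IH[of "\<lambda>x. D f x v" "\<lambda>x. D g x v"] Suc.prems assms(1) D_cong_open[of U _ f g]
    by auto
  ultimately show ?case by simp
qed

lemma Cn_subset: "Cn k U f \<Longrightarrow> V \<subseteq> U \<Longrightarrow> Cn k V f"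
  by (induction k arbitrary: f) (auto intro: continuous_on_subset)

lemma Cn_SucD: "Cn (Suc k) U f \<Longrightarrow> Cn k U f"
proof (induction k arbitrary: f)
  case 0
  then show ?case
    by (auto intro!: continuous_at_imp_continuous_on differentiable_imp_continuous_within)
next
  case (Suc k)
  then show ?case by (metis Cn.simps(2))
qed

lemma Cn_le: "Cn k U f \<Longrightarrow> m \<le> k \<Longrightarrow> Cn m U f"
  by (induction k arbitrary: m) (auto simp: le_Suc_eq dest: Cn_SucD simp del: Cn.simps(2))

lemma Cn_continuous: "Cn k U f \<Longrightarrow> continuous_on U f"
  using Cn_le[of k U f 0] by simp

lemma Cn_const: "Cn k U (\<lambda>x. c)"
  by (induction k arbitrary: c) auto

text \<open>Calculus rules supply a formula \<open>f'\<close> for the derivative; it may replace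
  \<open>D f\<close> in the recursion because it is right on an open set.\<close>

lemma Cn_SucI:
  assumes "open U" "\<And>x. x \<in> U \<Longrightarrow> (f has_derivative f' x) (at x)" "\<And>v. Cn k U (\<lambda>x. f' x v)"
  shows "Cn (Suc k) U f"
proof -
  have "Cn k U (\<lambda>x. D f x v)" for v
    by (rule Cn_cong[OF assms(1) _ assms(3)]) (simp add: D_eqI[OF assms(2)])
  then show ?thesis using assms(2) by (auto simp: differentiable_def)
qed

lemma Cn_compose_linear:
  assumes h: "bounded_linear h" and U: "open U" and "Cn k U f"
  shows "Cn k U (\<lambda>x. h (f x))"
  using assms(3)
proof (induction k arbitrary: f)
  case 0
  then show ?case by (simp add: bounded_linear.continuous_on[OF h])
next
  case (Suc k)
  show ?case by (rule Cn_SucI[OF U bounded_linear.has_derivative[OF h D_works]])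
       (use Suc in simp_all)
qed

lemma Cn_linear:
  assumes "bounded_linear h"
  shows "Cn k U h"
proof (cases k)
  case 0
  then show ?thesis by (simp add: assms linear_continuous_on)
next
  case (Suc m)
  then show ?thesis
    using bounded_linear_imp_has_derivative[OF assms] Cn_const
    by (auto simp: differentiable_def D_eqI[OF bounded_linear_imp_has_derivative[OF assms]])
qed

lemma Cn_add:
  assumes U: "open U" and "Cn k U f" "Cn k U g"
  shows "Cn k U (\<lambda>x. f x + g x)"
  using assms(2,3)
proof (induction k arbitrary: f g)
  case 0
  then show ?case by (simp add: continuous_on_add)
next
  case (Suc k)
  show ?case by (rule Cn_SucI[OF U has_derivative_add[OF D_works D_works]]) (use Suc in simp_all)
qed

text \<open>By the Leibniz rule the derivative is a sum of two terms of the same shape, so the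
  induction closes with f and g kept general.\<close>

lemma Cn_bilinear:
  assumes h: "bounded_bilinear h" and U: "open U" and "Cn k U f" "Cn k U g"
  shows "Cn k U (\<lambda>x. h (f x) (g x))"
  using assms(3,4)
proof (induction k arbitrary: f g)
  case 0
  then show ?case by (simp add: bounded_bilinear.continuous_on[OF h])
next
  case (Suc k)
  have "Cn k U f" "Cn k U g" using Suc.prems by (blast intro: Cn_SucD)+
  then show ?case
    by (intro Cn_SucI[OF U bounded_bilinear.FDERIV[OF h D_works D_works]] Cn_add U Suc.IH)
       (use Suc.prems in simp_all)
qed

lemmas Cn_scaleR = Cn_bilinear[OF bounded_bilinear_scaleR]
  and Cn_inner = Cn_bilinear[OF bounded_bilinear_inner]
  and Cn_mult = Cn_bilinear[OF bounded_bilinear_mult]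
  and Cn_minus = Cn_compose_linear[OF bounded_linear_minus[OF bounded_linear_ident]]

lemma Cn_diff:
  assumes "open U" "Cn k U f" "Cn k U g"
  shows "Cn k U (\<lambda>x. f x - g x)"
  using Cn_add[OF assms(1,2) Cn_minus[OF assms(1,3)]] by simp

lemma Cn_sum:
  assumes U: "open U" and "\<And>i. i \<in> I \<Longrightarrow> Cn k U (f i)"
  shows "Cn k U (\<lambda>x. \<Sum>i\<in>I. f i x)"
  using assms(2)
  by (induction I rule: infinite_finite_induct) (auto intro!: Cn_add Cn_const U)

text \<open>The derivative of 1 / f is built from 1 / f and the derivative of f, so the induction
  hypothesis applies to the same f at the lower order. The square root below works in the same
  way.\<close>

lemma Cn_inverse:
  fixes f :: "'a::real_normed_vector \<Rightarrow> real"
  assumes U: "open U" and "Cn k U f" "\<And>x. x \<in> U \<Longrightarrow> f x \<noteq> 0"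
  shows "Cn k U (\<lambda>x. inverse (f x))"
  using assms(2,3)
proof (induction k arbitrary: f)
  case 0
  then show ?case by (simp add: continuous_on_inverse)
next
  case (Suc k)
  have "Cn k U f" using Suc.prems(1) by (rule Cn_SucD)
  then show ?case
    by (intro Cn_SucI[OF U Deriv.has_derivative_inverse[OF _ D_works]] Cn_minus Cn_mult U Suc.IH)
       (use Suc.prems in simp_all)
qed

lemma Cn_divide:
  fixes f g :: "'a::real_normed_vector \<Rightarrow> real"
  assumes "open U" "Cn k U f" "Cn k U g" "\<And>x. x \<in> U \<Longrightarrow> g x \<noteq> 0"
  shows "Cn k U (\<lambda>x. f x / g x)"
  using Cn_mult[OF assms(1,2) Cn_inverse[OF assms(1,3,4)]] by (simp add: divide_inverse)

lemma Cn_sqrt: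
  fixes f :: "'a::real_normed_vector \<Rightarrow> real"
  assumes U: "open U" and "Cn k U f" "\<And>x. x \<in> U \<Longrightarrow> f x > 0"
  shows "Cn k U (\<lambda>x. sqrt (f x))"
  using assms(2,3)
proof (induction k arbitrary: f)
  case 0
  then show ?case by (simp add: continuous_on_real_sqrt)
next
  case (Suc k)
  have fk: "Cn k U f" using Suc.prems(1) by (rule Cn_SucD)
  show ?case
  proof (rule Cn_SucI[OF U])
    show "((\<lambda>x. sqrt (f x)) has_derivative (\<lambda>v. D f x v * (inverse (sqrt (f x)) / 2))) (at x)"
      if "x \<in> U" for x
    proof -
      have "f differentiable (at x)" using Suc.prems(1) that by simp
      from has_derivative_real_sqrt[OF Suc.prems(2)[OF that] D_works[OF this]] show ?thesis
        by (simp add: field_simps)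
    qed
    show "Cn k U (\<lambda>x. D f x v * (inverse (sqrt (f x)) / 2))" for v
      using Suc.prems(1) fk less_imp_neq[OF Suc.prems(2)]
      by (intro Cn_mult Cn_divide Cn_inverse Cn_const U Suc.IH Suc.prems(2)) auto
  qed
qed

lemma Cn_power:
  fixes f :: "'a::real_normed_vector \<Rightarrow> real"
  assumes "open U" "Cn k U f"
  shows "Cn k U (\<lambda>x. f x ^ m)"
  by (induction m) (auto intro!: Cn_mult Cn_const assms)

section \<open>Variable directions, symmetry of second derivatives, commutators\<close>

lemma D_linear: "f differentiable (at p) \<Longrightarrow> linear (D f p)"
  by (rule linear_frechet_derivative)

lemma D_basis_expansion:
  fixes f :: "'a::euclidean_space \<Rightarrow> 'b::real_normed_vector"
  assumes "f differentiable (at p)"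
  shows "D f p v = (\<Sum>b\<in>Basis. (v \<bullet> b) *\<^sub>R D f p b)"
proof -
  have "D f p v = D f p (\<Sum>b\<in>Basis. (v \<bullet> b) *\<^sub>R b)"
    by (simp add: euclidean_representation)
  also have "\<dots> = (\<Sum>b\<in>Basis. (v \<bullet> b) *\<^sub>R D f p b)"
    by (simp add: linear_sum[OF D_linear[OF assms]] linear_cmul[OF D_linear[OF assms]])
  finally show ?thesis .
qed

text \<open>\<open>Cn\<close> controls derivatives in constant directions only; expanding the
  direction in \<open>Basis\<close> gives a finite sum of those with coefficients of class
  C^k.\<close>

lemma Cn_directional:
  fixes f :: "'a::euclidean_space \<Rightarrow> 'b::real_normed_vector"
  assumes U: "open U" and "Cn (Suc k) U f" "Cn k U X"
  shows "Cn k U (\<lambda>p. D f p (X p))"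
proof (rule Cn_cong[OF U])
  show "Cn k U (\<lambda>p. \<Sum>b\<in>Basis. (X p \<bullet> b) *\<^sub>R D f p b)"
    using assms by (intro Cn_sum Cn_scaleR Cn_inner Cn_const U) auto
qed (use assms in \<open>simp add: D_basis_expansion[of f _ "X _", symmetric]\<close>)

lemma mvt_line:
  fixes f :: "'a::real_normed_vector \<Rightarrow> real"
  assumes "a < b" and d: "\<And>s. a \<le> s \<Longrightarrow> s \<le> b \<Longrightarrow> f differentiable (at (q + s *\<^sub>R v))"
  shows "\<exists>s. a < s \<and> s < b \<and> f (q + b *\<^sub>R v) - f (q + a *\<^sub>R v) = (b - a) * D f (q + s *\<^sub>R v) v"
proof (rule MVT2[OF assms(1)])
  fix s assume s: "a \<le> s" "s \<le> b"
  have "((\<lambda>s. f (q + s *\<^sub>R v)) has_derivative (\<lambda>r. D f (q + s *\<^sub>R v) (r *\<^sub>R v))) (at s)"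
    by (rule has_derivative_compose[where f = "\<lambda>s. q + s *\<^sub>R v", OF _ D_works[OF d[OF s]]])
       (auto intro!: derivative_eq_intros)
  then show "DERIV (\<lambda>s. f (q + s *\<^sub>R v)) s :> D f (q + s *\<^sub>R v) v"
    unfolding has_field_derivative_def
    by (rule has_derivative_eq_rhs) (simp add: fun_eq_iff linear_cmul[OF D_linear[OF d[OF s]]])
qed

text \<open>Schwarz's theorem. The second difference of f over a parallelogram with sides h v and h
  w is h^2 times either mixed derivative, each taken at some point near p; continuity of both gives
  equality at p.\<close>

lemma symmetric_second_derivative_real:
  fixes f :: "'a::euclidean_space \<Rightarrow> real"
  assumes "open U" "Cn 2 U f" "p \<in> U"
  shows "D (\<lambda>q. D f q v) p w = D (\<lambda>q. D f q w) p v"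
proof -
  define A where "A q = D (\<lambda>q. D f q v) q w" for q
  define B where "B q = D (\<lambda>q. D f q w) q v" for q
  have C2: "f differentiable (at x)" "(\<lambda>x. D f x u) differentiable (at x)" if "x \<in> U" for x u
    using assms(2) that by (auto simp: numeral_2_eq_2)
  have cont: "continuous_on U A" "continuous_on U B"
    using assms(2) by (auto simp: numeral_2_eq_2 A_def B_def)
  obtain e where e: "e > 0" "ball p e \<subseteq> U"
    using assms openE by blast
  have key: "\<exists>x\<in>ball p \<delta>. \<exists>y\<in>ball p \<delta>. A x = B y" if \<delta>: "0 < \<delta>" "\<delta> \<le> e" for \<delta>
  proof -
    \<comment> \<open>Small enough to keep the parallelogram in the ball of radius
      \<open>\<delta>\<close>; the 1 keeps the denominator positive when v and w are 0.\<close>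
    define h where "h = \<delta> / (1 + norm v + norm w)"
    have den: "1 + norm v + norm w > 0" by (simp add: add_pos_nonneg)
    have h: "h > 0" "h * (norm v + norm w) < \<delta>"
      using \<delta> den by (auto simp: h_def field_simps)
    have inb: "p + s *\<^sub>R v' + t *\<^sub>R w' \<in> ball p \<delta>"
      if "0 \<le> s" "s \<le> h" "0 \<le> t" "t \<le> h" "v' = v \<and> w' = w \<or> v' = w \<and> w' = v" for s t v' w'
    proof -
      have "norm (s *\<^sub>R v' + t *\<^sub>R w') \<le> s * norm v' + t * norm w'"
        using norm_triangle_ineq[of "s *\<^sub>R v'" "t *\<^sub>R w'"] that by simp
      also have "\<dots> \<le> h * norm v' + h * norm w'"
        using that by (intro add_mono mult_right_mono) auto
      also have "\<dots> < \<delta>" using h that(5) by (auto simp: algebra_simps)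
      finally have "dist p (p + (s *\<^sub>R v' + t *\<^sub>R w')) < \<delta>"
        by (metis add_diff_cancel_left' dist_commute dist_norm)
      then show ?thesis by (simp add: add.assoc)
    qed
    have step: "\<exists>x\<in>ball p \<delta>. f (p + h *\<^sub>R v' + h *\<^sub>R w') - f (p + h *\<^sub>R v') - f (p + h *\<^sub>R w') + f p
        = h * h * D (\<lambda>q. D f q v') x w'"
      if vw: "v' = v \<and> w' = w \<or> v' = w \<and> w' = v" for v' w'
    proof -
      have ball: "p + s *\<^sub>R v' + t *\<^sub>R w' \<in> U" if "0 \<le> s" "s \<le> h" "0 \<le> t" "t \<le> h" for s t
        using inb[OF that vw] e \<delta> by auto
      \<comment> \<open>The second difference is a first difference of \<open>H\<close> in direction
        \<open>v'\<close>. The mean value theorem is applied to it, and then in direction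
        \<open>w'\<close> to the derivative of f along \<open>v'\<close>.\<close>
      define H where "H x = f (x + h *\<^sub>R w') - f x" for x
      have H: "(H has_derivative (\<lambda>u. D f (x + h *\<^sub>R w') u - D f x u)) (at x)"
        if "x + h *\<^sub>R w' \<in> U" "x \<in> U" for x
        unfolding H_def
        by (intro has_derivative_diff D_works C2 that
            has_derivative_compose[where f = "\<lambda>x. x + h *\<^sub>R w'" and f' = "\<lambda>u. u" and g = f])
           (auto intro!: derivative_eq_intros)
      have "H differentiable (at (p + s *\<^sub>R v'))" "D H (p + s *\<^sub>R v') u
          = D f (p + s *\<^sub>R v' + h *\<^sub>R w') u - D f (p + s *\<^sub>R v') u" if "0 \<le> s" "s \<le> h" for s u
        using H[of "p + s *\<^sub>R v'"] ball[OF that, of h] ball[OF that, of 0] h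
        by (auto simp: differentiable_def D_eqI)
      then obtain s where s: "0 < s" "s < h"
        "H (p + h *\<^sub>R v') - H p = h * (D f (p + s *\<^sub>R v' + h *\<^sub>R w') v' - D f (p + s *\<^sub>R v') v')"
        using mvt_line[OF h(1), of H p v'] by auto
      obtain t where t: "0 < t" "t < h" "D f (p + s *\<^sub>R v' + h *\<^sub>R w') v' - D f (p + s *\<^sub>R v') v'
          = h * D (\<lambda>q. D f q v') (p + s *\<^sub>R v' + t *\<^sub>R w') w'"
        using mvt_line[OF h(1), of "\<lambda>q. D f q v'" "p + s *\<^sub>R v'" w'] C2(2) ball s by auto
      have "H (p + h *\<^sub>R v') - H p = h * h * D (\<lambda>q. D f q v') (p + s *\<^sub>R v' + t *\<^sub>R w') w'"
        using s(3) t(3) by simp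
      moreover have "p + s *\<^sub>R v' + t *\<^sub>R w' \<in> ball p \<delta>"
        using inb s t vw by simp
      ultimately show ?thesis by (intro bexI) (auto simp: H_def)
    qed
    obtain x y where "x \<in> ball p \<delta>" "y \<in> ball p \<delta>"
      and A: "f (p + h *\<^sub>R v + h *\<^sub>R w) - f (p + h *\<^sub>R v) - f (p + h *\<^sub>R w) + f p = h * h * A x"
      and B: "f (p + h *\<^sub>R w + h *\<^sub>R v) - f (p + h *\<^sub>R w) - f (p + h *\<^sub>R v) + f p = h * h * B y"
      using step[of v w] step[of w v] unfolding A_def B_def by blast
    have swap: "p + h *\<^sub>R w + h *\<^sub>R v = p + h *\<^sub>R v + h *\<^sub>R w"
      by (simp add: algebra_simps)
    have "h * h * A x = h * h * B y" using A B[unfolded swap] by linarith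
    with h(1) have "A x = B y" by simp
    then show ?thesis
      using \<open>x \<in> ball p \<delta>\<close> \<open>y \<in> ball p \<delta>\<close> by blast
  qed
  have "\<bar>A p - B p\<bar> \<le> \<epsilon>" if "\<epsilon> > 0" for \<epsilon>
  proof -
    have "continuous (at p) A" "continuous (at p) B"
      using cont assms(3) by (simp_all add: continuous_on_eq_continuous_at[OF assms(1)])
    moreover from \<open>\<epsilon> > 0\<close> have "\<epsilon> / 2 > 0"
      by simp
    ultimately obtain d1 d2 where d: "d1 > 0" "\<forall>x. dist x p < d1 \<longrightarrow> dist (A x) (A p) < \<epsilon> / 2"
      "d2 > 0" "\<forall>x. dist x p < d2 \<longrightarrow> dist (B x) (B p) < \<epsilon> / 2"
      unfolding continuous_at_eps_delta by metis
    obtain x y where "x \<in> ball p (min e (min d1 d2))" "y \<in> ball p (min e (min d1 d2))" "A x = B y"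
      using key[of "min e (min d1 d2)"] e d by auto
    then have "dist (A x) (A p) < \<epsilon> / 2" "dist (B y) (B p) < \<epsilon> / 2"
      using d by (auto simp: dist_commute)
    then show ?thesis
      unfolding dist_real_def using \<open>A x = B y\<close> by linarith
  qed
  then have "A p = B p" using field_le_epsilon[of "\<bar>A p - B p\<bar>" 0] by simp
  then show ?thesis by (simp add: A_def B_def)
qed

lemma D_inner_left:
  assumes "f differentiable (at p)"
  shows "D (\<lambda>q. f q \<bullet> b) p v = D f p v \<bullet> b"
  by (simp add: D_eqI[OF bounded_linear.has_derivative[OF bounded_linear_inner_left D_works[OF assms]]])

lemma symmetric_second_derivative:
  fixes f :: "'a::euclidean_space \<Rightarrow> 'b::euclidean_space"
  assumes "open U" "Cn 2 U f" "p \<in> U"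
  shows "D (\<lambda>q. D f q v) p w = D (\<lambda>q. D f q w) p v"
proof (rule euclidean_eqI)
  fix b :: 'b
  have C2: "f differentiable (at x)" "(\<lambda>x. D f x u) differentiable (at x)" if "x \<in> U" for x u
    using assms(2) that by (auto simp: numeral_2_eq_2)
  have C: "Cn 2 U (\<lambda>q. f q \<bullet> b)" by (intro Cn_inner Cn_const assms)
  have "D (\<lambda>q. D f q v) p w \<bullet> b = D (\<lambda>q. D (\<lambda>q. f q \<bullet> b) q v) p w" for v w
  proof -
    have "D (\<lambda>q. D (\<lambda>q. f q \<bullet> b) q v) p = D (\<lambda>q. D f q v \<bullet> b) p"
      by (rule D_cong_open[OF assms(1,3)]) (simp add: D_inner_left C2)
    then show ?thesis by (simp add: D_inner_left C2 assms)
  qed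
  then show "D (\<lambda>q. D f q v) p w \<bullet> b = D (\<lambda>q. D f q w) p v \<bullet> b"
    using symmetric_second_derivative_real[OF assms(1) C assms(3)] by simp
qed

lemma D_directional:
  fixes f :: "'a::euclidean_space \<Rightarrow> 'b::real_normed_vector"
  assumes "open U" "Cn 2 U f" "p \<in> U" "X differentiable (at p)"
  shows "((\<lambda>q. D f q (X q)) has_derivative (\<lambda>w. D (\<lambda>q. D f q (X p)) p w + D f p (D X p w))) (at p)"
proof -
  have C2: "f differentiable (at x)" "(\<lambda>x. D f x u) differentiable (at x)" if "x \<in> U" for x u
    using assms(2) that by (auto simp: numeral_2_eq_2)
  have 1: "((\<lambda>q. \<Sum>b\<in>Basis. (X q \<bullet> b) *\<^sub>R D f q b) has_derivative
      (\<lambda>w. \<Sum>b\<in>Basis. (X p \<bullet> b) *\<^sub>R D (\<lambda>q. D f q b) p w + (D X p w \<bullet> b) *\<^sub>R D f p b)) (at p)"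
    using C2 assms by (auto intro!: derivative_eq_intros D_works)
  have 2: "((\<lambda>q. \<Sum>b\<in>Basis. (X p \<bullet> b) *\<^sub>R D f q b) has_derivative
      (\<lambda>w. \<Sum>b\<in>Basis. (X p \<bullet> b) *\<^sub>R D (\<lambda>q. D f q b) p w)) (at p)"
    using C2 assms by (auto intro!: derivative_eq_intros D_works)
  have 3: "D (\<lambda>q. \<Sum>b\<in>Basis. (X p \<bullet> b) *\<^sub>R D f q b) p = D (\<lambda>q. D f q (X p)) p"
    by (rule D_cong_open[OF assms(1,3)]) (simp add: D_basis_expansion[OF C2(1), symmetric])
  have 4: "(\<lambda>w. \<Sum>b\<in>Basis. (X p \<bullet> b) *\<^sub>R D (\<lambda>q. D f q b) p w + (D X p w \<bullet> b) *\<^sub>R D f p b)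
      = (\<lambda>w. D (\<lambda>q. D f q (X p)) p w + D f p (D X p w))"
    using 3 D_eqI[OF 2]
    by (simp add: sum.distrib D_basis_expansion[OF C2(1)[OF assms(3)], of "D X p _"] fun_eq_iff)
  show ?thesis by (rule has_derivative_transform_within_open[OF 1[unfolded 4] assms(1,3)])
      (rule D_basis_expansion[OF C2(1), symmetric])
qed

text \<open>The second derivatives of f cancel by symmetry; what remains is f differentiated along
  the Lie bracket of X and Y.\<close>

lemma D_commutator:
  fixes f :: "'a::euclidean_space \<Rightarrow> 'b::euclidean_space"
  assumes "open U" "Cn 2 U f" "p \<in> U" "X differentiable (at p)" "Y differentiable (at p)"
  shows "D (\<lambda>q. D f q (Y q)) p (X p) - D (\<lambda>q. D f q (X q)) p (Y p)
    = D f p (D Y p (X p) - D X p (Y p))"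
proof -
  have "f differentiable (at p)" using assms(2,3) by (auto simp: numeral_2_eq_2)
  then have "D f p (D Y p (X p) - D X p (Y p)) = D f p (D Y p (X p)) - D f p (D X p (Y p))"
    by (intro linear_diff D_linear)
  moreover have "D (\<lambda>q. D f q (Y p)) p (X p) = D (\<lambda>q. D f q (X p)) p (Y p)"
    by (rule symmetric_second_derivative[OF assms(1,2,3)])
  ultimately show ?thesis
    by (simp add: D_eqI[OF D_directional[OF assms(1-3,4)]] D_eqI[OF D_directional[OF assms(1-3,5)]])
qed

section \<open>Infinitely differentiable maps\<close>

lemma smooth_Cn: "smooth U f \<Longrightarrow> Cn k U f"
  by (simp add: smooth_def)

lemma smooth_differentiable: "smooth U f \<Longrightarrow> p \<in> U \<Longrightarrow> f differentiable (at p)"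
  using smooth_Cn[of U f 1] by simp

lemma smooth_subset: "smooth U f \<Longrightarrow> V \<subseteq> U \<Longrightarrow> smooth V f"
  by (auto simp: smooth_def intro: Cn_subset)

lemma smooth_C_on: "C_on \<infinity> U f \<Longrightarrow> smooth U f"
  by (auto simp: smooth_def C_on_def C_nat_on_iff_Cn)

context
  fixes U :: "'a::real_normed_vector set"
  assumes "open U"
begin

lemma smooth_const: "smooth U (\<lambda>x. c)"
  by (simp add: smooth_def Cn_const)

lemma smooth_linear: "bounded_linear h \<Longrightarrow> smooth U h"
  by (simp add: smooth_def Cn_linear)

lemma smooth_compose_linear: "bounded_linear h \<Longrightarrow> smooth U f \<Longrightarrow> smooth U (\<lambda>x. h (f x))"
  using \<open>open U\<close> by (simp add: smooth_def Cn_compose_linear)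

lemma smooth_add: "smooth U f \<Longrightarrow> smooth U g \<Longrightarrow> smooth U (\<lambda>x. f x + g x)"
  using \<open>open U\<close> by (simp add: smooth_def Cn_add)

lemma smooth_diff: "smooth U f \<Longrightarrow> smooth U g \<Longrightarrow> smooth U (\<lambda>x. f x - g x)"
  using \<open>open U\<close> by (simp add: smooth_def Cn_diff)

lemma smooth_minus: "smooth U f \<Longrightarrow> smooth U (\<lambda>x. - f x)"
  using \<open>open U\<close> by (simp add: smooth_def Cn_minus)

lemma smooth_scaleR: "smooth U f \<Longrightarrow> smooth U g \<Longrightarrow> smooth U (\<lambda>x. f x *\<^sub>R g x)"
  using \<open>open U\<close> by (simp add: smooth_def Cn_scaleR)

lemma smooth_inner: "smooth U f \<Longrightarrow> smooth U g \<Longrightarrow> smooth U (\<lambda>x. f x \<bullet> g x)"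
  using \<open>open U\<close> by (simp add: smooth_def Cn_inner)

lemma smooth_mult:
  fixes f g :: "'a \<Rightarrow> real"
  shows "smooth U f \<Longrightarrow> smooth U g \<Longrightarrow> smooth U (\<lambda>x. f x * g x)"
  using \<open>open U\<close> by (simp add: smooth_def Cn_mult)

lemma smooth_power:
  fixes f :: "'a \<Rightarrow> real"
  shows "smooth U f \<Longrightarrow> smooth U (\<lambda>x. f x ^ m)"
  using \<open>open U\<close> by (simp add: smooth_def Cn_power)

lemma smooth_divide:
  fixes f g :: "'a \<Rightarrow> real"
  shows "smooth U f \<Longrightarrow> smooth U g \<Longrightarrow> (\<And>x. x \<in> U \<Longrightarrow> g x \<noteq> 0) \<Longrightarrow> smooth U (\<lambda>x. f x / g x)"
  using \<open>open U\<close> by (simp add: smooth_def Cn_divide)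

lemma smooth_sqrt:
  fixes f :: "'a \<Rightarrow> real"
  shows "smooth U f \<Longrightarrow> (\<And>x. x \<in> U \<Longrightarrow> f x > 0) \<Longrightarrow> smooth U (\<lambda>x. sqrt (f x))"
  using \<open>open U\<close> by (simp add: smooth_def Cn_sqrt)

lemma smooth_sum: "(\<And>i. i \<in> I \<Longrightarrow> smooth U (f i)) \<Longrightarrow> smooth U (\<lambda>x. \<Sum>i\<in>I. f i x)"
  using \<open>open U\<close> by (simp add: smooth_def Cn_sum)

end

lemma smooth_directional:
  fixes f :: "'a::euclidean_space \<Rightarrow> 'b::real_normed_vector"
  assumes "open U" "smooth U f" "smooth U X"
  shows "smooth U (\<lambda>p. D f p (X p))"
  using assms unfolding smooth_def by (metis Cn_directional)

section \<open>Regular level sets\<close>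

text \<open>
  With n the gradient of F at p and c = 1 / (n \<bullet> n), the map q \<mapsto> q - c (n \<bullet> (q - p)) n + c F(q) n
  has the identity as its derivative at p and turns F into a linear function; g is its inverse.
\<close>

lemma straightening:
  fixes F :: "'a::euclidean_space \<Rightarrow> real"
  assumes "open U" "Cn 1 U F" "p \<in> U" "F p = 0" "D F p \<noteq> (\<lambda>_. 0)"
  obtains W g e n where "open W" "p \<in> W" "W \<subseteq> U" "e > 0"
    "\<And>q. q \<in> W \<Longrightarrow> \<exists>y\<in>ball p e. g y = q"
    "\<And>y. y \<in> ball p e \<Longrightarrow> g y \<in> W \<and> F (g y) = n \<bullet> (y - p) \<and> g differentiable (at y)"
    "g p = p" "(g has_derivative (\<lambda>v. v)) (at p)" "\<And>v. D F p v = n \<bullet> v"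
proof -
  have C1: "F differentiable (at q)" "continuous_on U (\<lambda>q. D F q v)" if "q \<in> U" for q v
    using assms(2) that by auto
  define n where "n = (\<Sum>b\<in>Basis. D F p b *\<^sub>R b)"
  have n: "D F p v = n \<bullet> v" for v
    unfolding D_basis_expansion[OF C1(1)[OF assms(3)], of v]
    by (simp add: n_def inner_sum_left inner_commute[of v] mult.commute)
  have "n \<noteq> 0" using assms(5) n by (metis ext inner_zero_left)
  define c where "c = 1 / (n \<bullet> n)"
  have c: "c * (n \<bullet> n) = 1" using \<open>n \<noteq> 0\<close> by (simp add: c_def)
  define \<Phi> where "\<Phi> q = q - (c * (n \<bullet> (q - p))) *\<^sub>R n + (c * F q) *\<^sub>R n" for q
  define L where "L q v = v - (c * (n \<bullet> v)) *\<^sub>R n + (c * D F q v) *\<^sub>R n" for q v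
  have der: "(\<Phi> has_derivative L q) (at q)" if "q \<in> U" for q
    unfolding \<Phi>_def L_def using D_works[OF C1(1)[OF that]] by (auto intro!: derivative_eq_intros)
  have bl: "blinfun_apply (Blinfun (L q)) = L q" if "q \<in> U" for q
    using has_derivative_bounded_linear[OF der[OF that]] by (rule bounded_linear_Blinfun_apply)
  \<comment> \<open>The inverse function theorem needs continuity in the operator norm, while the
    C^1 hypothesis speaks of single directions; in finite dimension the matrix entries
    suffice.\<close>
  have cont: "continuous_on U (\<lambda>q. Blinfun (L q))"
  proof -
    have "continuous_on U (\<lambda>q. blinfun_of_matrix (\<lambda>i j. L q j \<bullet> i))"
      unfolding L_def using C1(2)
      by (intro continuous_on_blinfun_of_matrix continuous_intros) (auto simp: assms(3) intro: C1(2)[OF assms(3)])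
    then show ?thesis
      by (rule continuous_on_eq) (simp add: Blinfun_eq_matrix has_derivative_bounded_linear[OF der])
  qed
  have Lp: "L p = (\<lambda>v. v)" by (rule ext) (simp add: L_def n)
  have idp: "id_blinfun o\<^sub>L Blinfun (L p) = id_blinfun"
    by (rule blinfun_eqI) (simp add: Lp bl[OF assms(3), unfolded Lp])
  have der': "(\<Phi> has_derivative blinfun_apply (Blinfun (L q))) (at q)" if "q \<in> U" for q
    using der[OF that] by (simp add: bl that)
  obtain U' V g g' where UV: "open U'" "U' \<subseteq> U" "p \<in> U'" "open V" "\<Phi> p \<in> V" "homeomorphism U' V \<Phi> g"
    "\<And>y. y \<in> V \<Longrightarrow> (g has_derivative (g' y)) (at y)"
    "\<And>y. y \<in> V \<Longrightarrow> g' y = inv (blinfun_apply (Blinfun (L (g y))))"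
    by (rule inverse_function_theorem[OF \<open>open U\<close> der' cont \<open>p \<in> U\<close> idp]) blast+
  have \<Phi>p: "\<Phi> p = p" by (simp add: \<Phi>_def assms)
  obtain e where e: "e > 0" "ball p e \<subseteq> V"
    using UV openE \<Phi>p by metis
  define W where "W = U' \<inter> \<Phi> -` ball p e"
  have g: "g (\<Phi> q) = q" if "q \<in> U'" for q
    using UV(6) that by (auto simp: homeomorphism_def)
  have gp: "g p = p" using g[OF UV(3)] by (simp add: \<Phi>p)
  have F\<Phi>: "F q = n \<bullet> (\<Phi> q - p)" for q
  proof -
    have "n \<bullet> (\<Phi> q - p) = n \<bullet> (q - p) - (n \<bullet> (q - p)) * (c * (n \<bullet> n)) + F q * (c * (n \<bullet> n))"
      by (simp add: \<Phi>_def inner_simps algebra_simps)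
    then show ?thesis by (simp add: c)
  qed
  show thesis
  proof (rule that[of W e g n])
    show "open W"
      unfolding W_def using UV by (intro continuous_open_preimage) (auto simp: homeomorphism_def)
    show "W \<subseteq> U" "p \<in> W" "e > 0" using UV e \<Phi>p by (auto simp: W_def)
    show "\<exists>y\<in>ball p e. g y = q" if "q \<in> W" for q
      using that g by (intro bexI[of _ "\<Phi> q"]) (auto simp: W_def)
    show "g y \<in> W \<and> F (g y) = n \<bullet> (y - p) \<and> g differentiable (at y)" if "y \<in> ball p e" for y
    proof -
      have y: "y \<in> V" "g y \<in> U'" "\<Phi> (g y) = y"
        using UV(6) that e(2) by (auto simp: homeomorphism_def)
      then show ?thesis
        using that UV(7)[OF y(1)] by (auto simp: W_def F\<Phi>[of "g y"] differentiable_def)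
    qed
    show "(g has_derivative (\<lambda>v. v)) (at p)"
    proof -
      have "p \<in> V" using UV(5) \<Phi>p by simp
      moreover have "inv (\<lambda>v :: 'a. v) = (\<lambda>v. v)" using inv_id by (simp add: id_def)
      ultimately show ?thesis using UV(7,8)[of p] by (simp add: gp Lp bl[OF assms(3), unfolded Lp])
    qed
  qed (fact gp n)+
qed

text \<open>The curve is the image under g of the line through p in direction v. As
  \<open>n \<bullet> v = D F p v = 0\<close>, the line lies in the hyperplane that g carries into
  the level set, and the velocity is v because g has the identity as derivative at p.\<close>

lemma level_set_curve:
  fixes F :: "'a::euclidean_space \<Rightarrow> real"
  assumes "open U" "Cn 1 U F" "p \<in> U" "F p = 0" "D F p \<noteq> (\<lambda>_. 0)" "D F p v = 0"
  obtains \<gamma> \<epsilon> where "\<epsilon> > 0" "\<gamma> 0 = p" "\<And>s. \<bar>s\<bar> < \<epsilon> \<Longrightarrow> \<gamma> s \<in> U \<and> F (\<gamma> s) = 0"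
    "(\<gamma> has_vector_derivative v) (at (0::real))"
proof -
  obtain W g e n where W: "open W" "p \<in> W" "W \<subseteq> U" "e > 0"
    "\<And>q. q \<in> W \<Longrightarrow> \<exists>y\<in>ball p e. g y = q"
    "\<And>y. y \<in> ball p e \<Longrightarrow> g y \<in> W \<and> F (g y) = n \<bullet> (y - p) \<and> g differentiable (at y)"
    "g p = p" "(g has_derivative (\<lambda>v. v)) (at p)" "\<And>v. D F p v = n \<bullet> v"
    by (rule straightening[OF assms(1-5)]) blast
  define \<epsilon> where "\<epsilon> = e / (1 + norm v)"
  show thesis
  proof (rule that[of \<epsilon> "\<lambda>s. g (p + s *\<^sub>R v)"])
    show "\<epsilon> > 0" using W(4) by (simp add: \<epsilon>_def add_pos_nonneg)
    show "g (p + 0 *\<^sub>R v) = p" by (simp add: W)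
    show "((\<lambda>s. g (p + s *\<^sub>R v)) has_vector_derivative v) (at 0)"
      unfolding has_vector_derivative_def
      by (rule has_derivative_compose[where f = "\<lambda>s. p + s *\<^sub>R v" and g = g and g' = "\<lambda>v. v"])
         (auto intro!: derivative_eq_intros simp: W(8))
    fix s :: real assume "\<bar>s\<bar> < \<epsilon>"
    then have "\<bar>s\<bar> * (1 + norm v) < e"
      by (simp add: \<epsilon>_def add_pos_nonneg pos_less_divide_eq)
    then have "p + s *\<^sub>R v \<in> ball p e" by (simp add: dist_norm algebra_simps)
    then show "g (p + s *\<^sub>R v) \<in> U \<and> F (g (p + s *\<^sub>R v)) = 0"
      using W(3) W(6)[of "p + s *\<^sub>R v"] W(9)[of v] assms(6) by auto
  qed
qed

text \<open>In the straightened chart the level set is a hyperplane section of a ball, hence convex: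
  each of its points is joined to p by a segment along which the pull-back of f has derivative
  0.\<close>

lemma level_set_locally_constant:
  fixes F :: "'a::euclidean_space \<Rightarrow> real" and f :: "'a \<Rightarrow> real"
  assumes "open U" "Cn 1 U F" "p \<in> U" "F p = 0" "D F p \<noteq> (\<lambda>_. 0)"
    and f: "\<And>q. q \<in> U \<Longrightarrow> f differentiable (at q)"
    and zero: "\<And>q v. q \<in> U \<Longrightarrow> F q = 0 \<Longrightarrow> D F q v = 0 \<Longrightarrow> D f q v = 0"
  obtains W where "open W" "p \<in> W" "W \<subseteq> U" "\<And>q. q \<in> W \<Longrightarrow> F q = 0 \<Longrightarrow> f q = f p"
proof -
  obtain W g e n where W: "open W" "p \<in> W" "W \<subseteq> U" "e > 0"
    "\<And>q. q \<in> W \<Longrightarrow> \<exists>y\<in>ball p e. g y = q"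
    "\<And>y. y \<in> ball p e \<Longrightarrow> g y \<in> W \<and> F (g y) = n \<bullet> (y - p) \<and> g differentiable (at y)"
    "g p = p" "(g has_derivative (\<lambda>v. v)) (at p)" "\<And>v. D F p v = n \<bullet> v"
    by (rule straightening[OF assms(1-5)]) blast
  have "f q = f p" if q: "q \<in> W" "F q = 0" for q
  proof -
    obtain y where y: "y \<in> ball p e" "g y = q"
      using W(5)[OF q(1)] by blast
    define u where "u = y - p"
    have nu: "n \<bullet> u = 0" using W(6)[OF y(1)] y(2) q(2) by (simp add: u_def)
    have inb: "p + s *\<^sub>R u \<in> ball p e" if "s \<in> {0..1}" for s
      using convexD[OF convex_ball _ y(1), of p "1 - s" s] that W(4) by (simp add: u_def algebra_simps)
    have "((\<lambda>s. f (g (p + s *\<^sub>R u))) has_derivative (\<lambda>h. 0)) (at s within {0..1})"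
      if s: "s \<in> {0..1}" for s
    proof -
      let ?y = "p + s *\<^sub>R u"
      note gy = W(6)[OF inb[OF s]]
      have gU: "g ?y \<in> U" using gy W(3) by blast
      have dg: "((\<lambda>s. g (p + s *\<^sub>R u)) has_derivative (\<lambda>r. D g ?y (r *\<^sub>R u))) (at s)"
        by (rule has_derivative_compose[where f = "\<lambda>s. p + s *\<^sub>R u" and g = g])
           (auto intro!: derivative_eq_intros D_works simp: gy)
      \<comment> \<open>Differentiating \<open>F (g y) = n \<bullet> (y - p)\<close> shows that
        directions orthogonal to n are carried into the kernel of \<open>D F\<close>, where the
        hypothesis on f applies.\<close>
      have "D F (g ?y) (D g ?y w) = n \<bullet> w" for w
      proof -
        have "((\<lambda>y. F (g y)) has_derivative (\<lambda>w. D F (g ?y) (D g ?y w))) (at ?y)"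
          using gy gU assms(2) by (intro has_derivative_compose[where f = g and g = F] D_works) auto
        then have "((\<lambda>y. n \<bullet> (y - p)) has_derivative (\<lambda>w. D F (g ?y) (D g ?y w))) (at ?y)"
          by (rule has_derivative_transform_within_open[OF _ open_ball inb[OF s]]) (simp add: W(6))
        moreover have "((\<lambda>y. n \<bullet> (y - p)) has_derivative (\<lambda>w. n \<bullet> w)) (at ?y)"
          by (auto intro!: derivative_eq_intros)
        ultimately show ?thesis using has_derivative_unique by metis
      qed
      then have "D f (g ?y) (D g ?y (r *\<^sub>R u)) = 0" for r using zero[OF gU] gy nu by simp
      then show ?thesis
        using has_derivative_compose[OF dg D_works[OF f[OF gU]]]
        by (auto intro: has_derivative_at_withinI)
    qed
    from has_derivative_zero_unique[OF convex_real_interval(5) this, of 0 1] show ?thesis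
      by (simp add: u_def W(7) y(2))
  qed
  then show thesis
    using that[of W] W(1-3) by auto
qed

text \<open>Choose a direction v transversal to both level sets. Every line near p in direction v
  crosses the zero set of F, by the intermediate value theorem, and meets that of G at most once, as
  the derivative of G along it has no zero. The crossing point lies in both sets, so a zero of G on
  the line must be that point.\<close>

lemma level_set_eq_locally:
  fixes F G :: "'a::euclidean_space \<Rightarrow> real"
  assumes "open U" "p \<in> U" "Cn 1 U F" "Cn 1 U G" "F p = 0" "D F p \<noteq> (\<lambda>_. 0)" "D G p \<noteq> (\<lambda>_. 0)"
    and sub: "\<And>q. q \<in> U \<Longrightarrow> F q = 0 \<Longrightarrow> G q = 0"
  obtains W where "open W" "p \<in> W" "W \<subseteq> U" "\<And>q. q \<in> W \<Longrightarrow> G q = 0 \<Longrightarrow> F q = 0"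
proof -
  have C1: "H differentiable (at q)" "continuous_on U (\<lambda>q. D H q v)" if "q \<in> U" "Cn 1 U H" for q v
    and H :: "'a \<Rightarrow> real"
    using that by auto
  obtain v where v: "D F p v > 0" "D G p v \<noteq> 0"
  proof -
    obtain v1 v2 where "D F p v1 \<noteq> 0" "D G p v2 \<noteq> 0"
      using assms(6,7) by (auto simp: fun_eq_iff)
    moreover have "D F p (v1 + v2) = D F p v1 + D F p v2" "D G p (v1 + v2) = D G p v1 + D G p v2"
      using assms(2-4) by (simp_all add: linear_add[OF D_linear])
    \<comment> \<open>Two proper subspaces do not cover the space: one of \<open>v1\<close>,
      \<open>v2\<close>, \<open>v1 + v2\<close> lies outside both kernels.\<close>
    ultimately have "D F p v1 \<noteq> 0 \<and> D G p v1 \<noteq> 0 \<or> D F p v2 \<noteq> 0 \<and> D G p v2 \<noteq> 0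
      \<or> D F p (v1 + v2) \<noteq> 0 \<and> D G p (v1 + v2) \<noteq> 0"
      by auto
    then obtain v where "D F p v \<noteq> 0" "D G p v \<noteq> 0"
      by blast
    then show thesis
      using that[of v] that[of "- v"] assms(2-4)
      by (cases "D F p v > 0") (simp_all add: linear_neg[OF D_linear])
  qed
  have "open {q\<in>U. D F q v > 0}" "open {q\<in>U. D G q v \<noteq> 0}"
    using continuous_open_preimage[OF C1(2)[OF assms(2,3), of v] assms(1), of "{0<..}"]
      continuous_open_preimage[OF C1(2)[OF assms(2,4), of v] assms(1), of "- {0}"]
    by (auto simp: vimage_def Int_def)
  moreover define S where "S = {q\<in>U. D F q v > 0} \<inter> {q\<in>U. D G q v \<noteq> 0}"
  ultimately have "open S" by blast
  moreover have "p \<in> S" using v assms by (simp add: S_def)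
  ultimately obtain d where d': "d > 0" "ball p d \<subseteq> S"
    by (rule openE)
  have d: "d > 0" "ball p d \<subseteq> {q\<in>U. D F q v > 0} \<inter> {q\<in>U. D G q v \<noteq> 0}"
    using d' unfolding S_def by blast+
  have mvt: "\<exists>s. a < s \<and> s < b \<and> H (q + b *\<^sub>R v) - H (q + a *\<^sub>R v) = (b - a) * D H (q + s *\<^sub>R v) v"
    if "a < b" "\<And>s. a \<le> s \<Longrightarrow> s \<le> b \<Longrightarrow> q + s *\<^sub>R v \<in> U" "Cn 1 U H" for a b q and H :: "'a \<Rightarrow> real"
    using mvt_line[OF that(1)] C1(1) that(2,3) by blast
  define \<delta> where "\<delta> = d / (2 * (1 + norm v))"
  have \<delta>: "\<delta> > 0" "\<delta> * norm v < d / 2"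
    using d by (auto simp: \<delta>_def add_pos_nonneg field_simps)
  have inb: "q + s *\<^sub>R v \<in> ball p d" if "q \<in> ball p (d / 2)" "\<bar>s\<bar> \<le> \<delta>" for q s
  proof -
    have "norm (s *\<^sub>R v) \<le> \<delta> * norm v" using that by (simp add: mult_right_mono)
    moreover have "dist p (q + s *\<^sub>R v) \<le> dist p q + norm (s *\<^sub>R v)"
      using dist_triangle[of p "q + s *\<^sub>R v" q] by (simp add: dist_norm)
    ultimately show ?thesis using that \<delta> by simp
  qed
  have pb: "p \<in> ball p (d / 2)" using d by simp
  have inU: "q + s *\<^sub>R v \<in> U" "D F (q + s *\<^sub>R v) v > 0" "D G (q + s *\<^sub>R v) v \<noteq> 0"
    if "q \<in> ball p (d / 2)" "\<bar>s\<bar> \<le> \<delta>" for q s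
    using inb[OF that] d by auto
  have pos: "F (p + \<delta> *\<^sub>R v) > 0"
  proof -
    obtain s where "0 < s" "s < \<delta>" "F (p + \<delta> *\<^sub>R v) - F (p + 0 *\<^sub>R v) = (\<delta> - 0) * D F (p + s *\<^sub>R v) v"
      using mvt[of 0 \<delta> p F] inU(1)[OF pb] \<delta> assms(3) by auto
    then show ?thesis using inU(2)[OF pb, of s] assms(5) by simp
  qed
  have neg: "F (p + (- \<delta>) *\<^sub>R v) < 0"
  proof -
    obtain s where "- \<delta> < s" "s < 0" "F (p + 0 *\<^sub>R v) - F (p + (- \<delta>) *\<^sub>R v) = (0 - - \<delta>) * D F (p + s *\<^sub>R v) v"
      using mvt[of "- \<delta>" 0 p F] inU(1)[OF pb] \<delta> assms(3) by auto
    then show ?thesis using mult_pos_pos[OF \<delta>(1) inU(2)[OF pb, of s]] assms(5) by simp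
  qed
  have contF: "continuous_on U F" using assms(3) by (rule Cn_continuous)
  define W where "W = {q \<in> ball p (d / 2). F (q + \<delta> *\<^sub>R v) > 0 \<and> F (q + (- \<delta>) *\<^sub>R v) < 0}"
  have contS: "continuous_on (ball p (d / 2)) (\<lambda>q. F (q + s *\<^sub>R v))" if "\<bar>s\<bar> \<le> \<delta>" for s
    by (rule continuous_on_compose2[OF contF]) (use inU(1)[OF _ that] in \<open>auto intro!: continuous_intros\<close>)
  have "open W"
    using open_Int[OF continuous_open_preimage[OF contS[of \<delta>] open_ball, of "{0<..}"]
        continuous_open_preimage[OF contS[of "- \<delta>"] open_ball, of "{..<0}"]] \<delta>
    by (simp add: W_def vimage_def Int_def) (metis (mono_tags, lifting) Collect_cong)
  moreover have "p \<in> W" using pos neg d by (simp add: W_def)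
  moreover have "W \<subseteq> U" using inU(1)[of _ 0] \<delta> by (auto simp: W_def)
  moreover have "F q = 0" if q: "q \<in> W" "G q = 0" for q
  proof -
    have qb: "q \<in> ball p (d / 2)" using q by (simp add: W_def)
    have "continuous_on {- \<delta>..\<delta>} (\<lambda>s. F (q + s *\<^sub>R v))"
      by (rule continuous_on_compose2[OF contF]) (use inU(1)[OF qb] in \<open>auto intro!: continuous_intros\<close>)
    then obtain s where s: "- \<delta> \<le> s" "s \<le> \<delta>" "F (q + s *\<^sub>R v) = 0"
      using IVT'[of "\<lambda>s. F (q + s *\<^sub>R v)" "- \<delta>" 0 \<delta>] q \<delta> by (auto simp: W_def)
    then have G: "G (q + s *\<^sub>R v) = 0" using sub inU(1)[OF qb] by auto
    have "s = 0"
    proof (rule ccontr)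
      assume "s \<noteq> 0"
      then have "min s 0 < max s 0" by auto
      from mvt[OF this _ assms(4), of q] obtain r where r: "min s 0 < r" "r < max s 0"
        "G (q + max s 0 *\<^sub>R v) - G (q + min s 0 *\<^sub>R v) = (max s 0 - min s 0) * D G (q + r *\<^sub>R v) v"
        using inU(1)[OF qb] s by auto
      moreover have "G (q + max s 0 *\<^sub>R v) = 0" "G (q + min s 0 *\<^sub>R v) = 0"
        using G q by (auto simp: max_def min_def)
      ultimately have "D G (q + r *\<^sub>R v) v = 0" using \<open>min s 0 < max s 0\<close> by simp
      then show False
        using inU(3)[OF qb, of r] r s by auto
    qed
    then show ?thesis using s by simp
  qed
  ultimately show thesis
    using that[of W] by blast
qed

text \<open>Agreement along one curve with velocity v is enough, so an identity known only on a
  hypersurface can be differentiated in its tangent directions.\<close>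

lemma tangent_derivative_eq:
  fixes f g :: "'a::real_normed_vector \<Rightarrow> 'b::real_normed_vector"
  assumes "(\<gamma> has_vector_derivative v) (at (0::real))" "\<epsilon> > 0" "\<And>s. \<bar>s\<bar> < \<epsilon> \<Longrightarrow> f (\<gamma> s) = g (\<gamma> s)"
    and "f differentiable (at (\<gamma> 0))" "g differentiable (at (\<gamma> 0))"
  shows "D f (\<gamma> 0) v = D g (\<gamma> 0) v"
proof -
  have der: "((\<lambda>s. h (\<gamma> s)) has_derivative (\<lambda>r. D h (\<gamma> 0) (r *\<^sub>R v))) (at 0)"
    if "h differentiable (at (\<gamma> 0))" for h :: "'a \<Rightarrow> 'b"
    by (rule has_derivative_compose[where f = \<gamma>, OF _ D_works[OF that]])
       (use assms(1) in \<open>simp add: has_vector_derivative_def\<close>)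
  have "((\<lambda>s. g (\<gamma> s)) has_derivative (\<lambda>r. D f (\<gamma> 0) (r *\<^sub>R v))) (at 0)"
    by (rule has_derivative_transform_within_open[OF der[OF assms(4)], of "ball 0 \<epsilon>"])
       (use assms in auto)
  from has_derivative_unique[OF this der[OF assms(5)]] show ?thesis
    by (metis scaleR_one)
qed

section \<open>Horizontal vectors\<close>

text \<open>
  Horizontal vectors are handled through their coefficients (a, b) in the frame X, Y;
  the map lift sends coefficients to vectors.
\<close>

type_synonym 'n hor = "(real ^ 'n) \<times> (real ^ 'n)"

definition zpart :: "'n::finite heis \<Rightarrow> 'n hor" where
  "zpart p = (fst p, fst (snd p))"

definition hJ :: "'n::finite hor \<Rightarrow> 'n hor" where
  "hJ u = (- snd u, fst u)"

text \<open>The last coordinate is dictated by \<open>T_coeff p (lift p u) = 0\<close>.\<close>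

definition lift :: "'n::finite heis \<Rightarrow> 'n hor \<Rightarrow> 'n heis" where
  "lift p u = (fst u, snd u, - 2 * (zpart p \<bullet> hJ u))"

definition vert :: "'n::finite heis" where
  "vert = (0, 0, 1)"

lemma hJ_inner: "hJ u \<bullet> hJ v = u \<bullet> v" "hJ u \<bullet> v = - (u \<bullet> hJ v)" "hJ u \<bullet> u = 0" "u \<bullet> hJ u = 0"
  by (auto simp: hJ_def inner_prod_def inner_commute)

lemma hJ_simps: "hJ (hJ u) = - u" "hJ (u + v) = hJ u + hJ v" "hJ (u - v) = hJ u - hJ v"
  "hJ (- u) = - hJ u" "hJ (r *\<^sub>R u) = r *\<^sub>R hJ u" "hJ 0 = 0"
  by (auto simp: hJ_def prod_eq_iff)

lemma norm_hJ: "norm (hJ u) = norm u"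
  by (simp only: norm_eq_sqrt_inner hJ_inner(1))

lemma bounded_linear_hJ: "bounded_linear hJ"
  by (intro linear_conv_bounded_linear[THEN iffD1] linearI) (simp_all add: hJ_simps)

lemma zpart_simps: "zpart (p + q) = zpart p + zpart q" "zpart (p - q) = zpart p - zpart q"
  "zpart (r *\<^sub>R p) = r *\<^sub>R zpart p" "zpart 0 = 0" "zpart (lift p u) = u" "zpart vert = 0"
  "zpart (- p) = - zpart p"
  by (auto simp: zpart_def prod_eq_iff lift_def vert_def)

lemma bounded_linear_zpart: "bounded_linear zpart"
  by (intro linear_conv_bounded_linear[THEN iffD1] linearI) (simp_all add: zpart_simps)

lemma lift_simps: "lift p (u + v) = lift p u + lift p v" "lift p (u - v) = lift p u - lift p v"
  "lift p (r *\<^sub>R u) = r *\<^sub>R lift p u" "lift p (- u) = - lift p u" "lift p 0 = 0"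
  by (simp_all add: lift_def hJ_simps inner_simps algebra_simps) (simp add: zero_prod_def)

lemma T_coeff_simps:
  fixes p u' v' :: "'n::finite heis"
  shows "T_coeff p (lift p u) = 0" "T_coeff p vert = 1"
    "T_coeff p (u' + v') = T_coeff p u' + T_coeff p v'" "T_coeff p (r *\<^sub>R v') = r * T_coeff p v'"
    "T_coeff p (u' - v') = T_coeff p u' - T_coeff p v'" "T_coeff p 0 = 0" "T_coeff p (- v') = - T_coeff p v'"
  by (auto simp: T_coeff_def lift_def vert_def zpart_def hJ_def inner_simps algebra_simps zero_prod_def
      split: prod.splits)

lemma lift_decomposition: "v = lift p (zpart v) + T_coeff p v *\<^sub>R vert"
  by (cases p; cases v) (auto simp: T_coeff_def lift_def vert_def zpart_def hJ_def)

lemma heis_metric_eq: "heis_metric p u v = zpart u \<bullet> zpart v + T_coeff p u * T_coeff p v"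
  by (simp add: heis_metric_def zpart_def inner_prod_def)

lemma frame_T_eq: "frame_T p = vert"
  by (simp add: frame_T_def vert_def)

lemma metric_frame_T: "heis_metric p v (frame_T p) = T_coeff p v"
  by (simp add: heis_metric_eq frame_T_eq zpart_simps T_coeff_simps)

lemma horizontal_proj_eq: "horizontal_proj p v = lift p (zpart v)"
  using lift_decomposition[of v p]
  by (simp only: horizontal_proj_def metric_frame_T) (simp add: frame_T_eq algebra_simps)

lemma heis_metric_lift: "heis_metric p (lift p u) v = u \<bullet> zpart v" "heis_metric p v (lift p u) = zpart v \<bullet> u"
  by (simp_all add: heis_metric_eq zpart_simps T_coeff_simps)

lemma heis_norm_lift: "heis_norm p (lift p u) = norm u"
  by (simp add: heis_norm_def heis_metric_lift zpart_simps norm_eq_sqrt_inner)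

lemma heis_norm_square: "(heis_norm p v)\<^sup>2 = zpart v \<bullet> zpart v + (T_coeff p v)\<^sup>2"
  by (simp add: heis_norm_def heis_metric_eq power2_eq_square)

lemma frame_eq_lift: "frame_X j p = lift p (axis j 1, 0)" "frame_Y j p = lift p (0, axis j 1)"
  by (auto simp: frame_X_def frame_Y_def lift_def hJ_def zpart_def inner_axis split: prod.splits)

lemma hor_expansion:
  fixes u :: "'n::finite hor"
  shows "(\<Sum>j\<in>UNIV. fst u $ j *\<^sub>R (axis j 1, 0)) + (\<Sum>j\<in>UNIV. snd u $ j *\<^sub>R (0, axis j 1)) = u"
  using basis_expansion[of "fst u"] basis_expansion[of "snd u"]
  by (simp add: prod_eq_iff fst_sum snd_sum scalar_mult_eq_scaleR)

lemma lift_sum: "lift p (\<Sum>i\<in>I. f i) = (\<Sum>i\<in>I. lift p (f i))"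
  by (induction I rule: infinite_finite_induct) (auto simp: lift_simps)

lemma horizontal_space_eq: "horizontal_space p = range (lift p)"
proof
  have "subspace (range (lift p))"
    by (intro linear_subspace_image[of _ UNIV, simplified] linearI) (auto simp: lift_simps)
  then show "horizontal_space p \<subseteq> range (lift p)"
    unfolding horizontal_space_def by (intro span_minimal) (auto simp: frame_eq_lift)
  have "lift p u \<in> horizontal_space p" for u
  proof -
    have "lift p u = (\<Sum>j\<in>UNIV. fst u $ j *\<^sub>R frame_X j p) + (\<Sum>j\<in>UNIV. snd u $ j *\<^sub>R frame_Y j p)"
      unfolding frame_eq_lift lift_simps(3)[symmetric] lift_sum[symmetric] lift_simps(1)[symmetric]
        hor_expansion ..
    also have "\<dots> \<in> horizontal_space p"
      unfolding horizontal_space_def by (intro span_add span_sum span_scale span_base) auto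
    finally show ?thesis .
  qed
  then show "range (lift p) \<subseteq> horizontal_space p" by auto
qed

lemma heis_J_eq: "heis_J p v = lift p (hJ (zpart v))"
proof -
  have X: "heis_metric p v (frame_X j p) = fst (zpart v) $ j" for j
    by (simp add: frame_eq_lift heis_metric_lift inner_prod_def inner_axis)
  have Y: "heis_metric p v (frame_Y j p) = snd (zpart v) $ j" for j
    by (simp add: frame_eq_lift heis_metric_lift inner_prod_def inner_axis)
  have "hJ (zpart v) = (\<Sum>j\<in>UNIV. fst (zpart v) $ j *\<^sub>R (0, axis j 1) - snd (zpart v) $ j *\<^sub>R (axis j 1, 0))"
    using basis_expansion[of "fst (zpart v)"] basis_expansion[of "snd (zpart v)"]
    by (simp add: prod_eq_iff fst_sum snd_sum hJ_def sum_negf scalar_mult_eq_scaleR)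
  then show ?thesis
    unfolding heis_J_def X Y unfolding frame_eq_lift by (simp only: lift_sum lift_simps)
qed

text \<open>Koszul's argument: metric compatibility is written for three arrangements of u, v, w.
  The derivative of the metric comes from the T coefficients and is antisymmetric in the two
  horizontal vectors, so adding up leaves the symbol orthogonal to every w. Horizontal fields are
  thus differentiated in horizontal directions by the flat derivative.\<close>

lemma levi_civita_symbol_lift: "levi_civita_symbol p (lift p u) (lift p v) = 0"
proof -
  let ?G = "levi_civita_symbol p"
  have "levi_civita_symbol_at p ?G" by (rule levi_civita_symbol)
  then have sym: "\<And>u v. ?G u v = ?G v u" and der: "\<And>u v. ((\<lambda>q. heis_metric q u v) has_derivative
              (\<lambda>w. heis_metric p (?G w u) v + heis_metric p u (?G w v))) (at p)"
    unfolding levi_civita_symbol_at_def by auto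
  define t where "t w a = 2 * (fst (snd w) \<bullet> fst a - fst w \<bullet> fst (snd a))" for w a :: "'a heis"
  have met: "heis_metric p (?G w a) b + heis_metric p a (?G w b) = t w a * T_coeff p b + T_coeff p a * t w b"
    for w a b
  proof -
    have "((\<lambda>q. heis_metric q a b) has_derivative (\<lambda>w. t w a * T_coeff p b + T_coeff p a * t w b)) (at p)"
      unfolding heis_metric_def t_def
      by (auto intro!: derivative_eq_intros T_coeff_has_derivative simp: fun_eq_iff)
    from has_derivative_unique[OF this der[of a b]] show ?thesis
      by metis
  qed
  have tt: "t a b = - t b a" for a b by (simp add: t_def inner_commute)
  have comm: "heis_metric p a b = heis_metric p b a" for a b
    by (simp add: heis_metric_eq inner_commute mult.commute)
  let ?u = "lift p u" and ?v = "lift p v"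
  have "heis_metric p (?G ?u ?v) w = 0" for w
  proof -
    have "heis_metric p (?G ?u ?v) w + heis_metric p ?v (?G ?u w) = t ?u ?v * T_coeff p w"
      "heis_metric p (?G ?u ?v) w + heis_metric p ?u (?G ?v w) = t ?v ?u * T_coeff p w"
      "heis_metric p (?G ?u w) ?v + heis_metric p ?u (?G ?v w) = 0"
      using met[of ?u ?v w] met[of ?v ?u w] met[of w ?u ?v]
      by (simp_all add: T_coeff_simps sym[of ?v ?u] sym[of w])
    moreover have "t ?v ?u * T_coeff p w = - (t ?u ?v * T_coeff p w)" using tt[of ?v ?u] by simp
    ultimately show ?thesis using comm[of ?v "?G ?u w"] by linarith
  qed
  then show ?thesis using heis_metric_pos by (metis less_irrefl)
qed

section \<open>Horizontal differentiation\<close>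

definition hder :: "('n::finite heis \<Rightarrow> 'b::real_normed_vector) \<Rightarrow> 'n heis \<Rightarrow> 'n hor \<Rightarrow> 'b" where
  "hder f p u = D f p (lift p u)"

lemma D_decomposition:
  assumes "f differentiable (at p)"
  shows "D f p v = hder f p (zpart v) + T_coeff p v *\<^sub>R D f p vert"
  unfolding hder_def
  by (subst lift_decomposition[of v p])
     (simp only: linear_add[OF D_linear[OF assms]] linear_cmul[OF D_linear[OF assms]])

lemma hder_simps:
  assumes "f differentiable (at p)"
  shows "hder f p (u + v) = hder f p u + hder f p v" "hder f p (u - v) = hder f p u - hder f p v"
    "hder f p (r *\<^sub>R u) = r *\<^sub>R hder f p u" "hder f p (- u) = - hder f p u" "hder f p 0 = 0"
  using linear_add[OF D_linear[OF assms]] linear_diff[OF D_linear[OF assms]]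
    linear_cmul[OF D_linear[OF assms]] linear_neg[OF D_linear[OF assms]] linear_0[OF D_linear[OF assms]]
  by (auto simp: hder_def lift_simps)

text \<open>The vertical term is present even for constant u, because the frame turns with the
  point; it is the source of [X_j, Y_j] = 4 T.\<close>

lemma lift_has_derivative:
  assumes "(u has_derivative u') (at p)"
  shows "((\<lambda>q. lift q (u q)) has_derivative
    (\<lambda>w. lift p (u' w) + (- 2 * (zpart w \<bullet> hJ (u p))) *\<^sub>R vert)) (at p)"
proof -
  note [derivative_intros] = bounded_linear.has_derivative[OF bounded_linear_hJ]
    bounded_linear.has_derivative[OF bounded_linear_zpart]
  show ?thesis
    unfolding lift_def vert_def
    using assms by (auto intro!: derivative_eq_intros simp: fun_eq_iff algebra_simps)
qed

lemma smooth_lift: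
  fixes u :: "'n::finite heis \<Rightarrow> 'n hor"
  assumes "open U" "smooth U u"
  shows "smooth U (\<lambda>q. lift q (u q))"
proof -
  have eq: "(\<lambda>q. lift q (u q)) = (\<lambda>q. (\<lambda>v. (fst v, snd v, 0)) (u q) + (- 2 * (zpart q \<bullet> hJ (u q))) *\<^sub>R vert)"
    by (auto simp: lift_def vert_def)
  have "bounded_linear (\<lambda>v :: 'n hor. (fst v, snd v, 0 :: real))"
    by (intro linear_conv_bounded_linear[THEN iffD1] linearI) auto
  note 1 = smooth_compose_linear[OF assms(1) this assms(2)]
  have 2: "smooth U (\<lambda>q. (- 2 * (zpart q \<bullet> hJ (u q))) *\<^sub>R vert)"
    by (intro smooth_scaleR smooth_mult smooth_inner smooth_const assms(1)
        smooth_compose_linear[OF _ bounded_linear_hJ] smooth_linear bounded_linear_zpart assms(2))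
  show ?thesis using smooth_add[OF assms(1) 1 2] by (simp only: eq)
qed

lemma smooth_hder:
  assumes "open U" "smooth U f" "smooth U u"
  shows "smooth U (\<lambda>q. hder f q (u q))"
  unfolding hder_def using assms by (intro smooth_directional smooth_lift)

text \<open>The Lie bracket of the lifted fields is the lift of the bracket of their coefficients
  plus a multiple of T. The vertical derivative becomes accessible through horizontal ones whenever
  \<open>hJ u\<close> is not orthogonal to v.\<close>

lemma horizontal_commutator:
  fixes f :: "'n::finite heis \<Rightarrow> 'b::euclidean_space"
  assumes "open U" "Cn 2 U f" "p \<in> U" and u: "u differentiable (at p)" and v: "v differentiable (at p)"
  shows "hder (\<lambda>q. hder f q (v q)) p (u p) - hder (\<lambda>q. hder f q (u q)) p (v p)
    = hder f p (hder v p (u p) - hder u p (v p)) + (4 * (hJ (u p) \<bullet> v p)) *\<^sub>R D f p vert"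
proof -
  note du = lift_has_derivative[OF D_works[OF u]] and dv = lift_has_derivative[OF D_works[OF v]]
  have f: "f differentiable (at p)" using assms(2,3) by (auto simp: numeral_2_eq_2)
  have "hder (\<lambda>q. hder f q (v q)) p (u p) - hder (\<lambda>q. hder f q (u q)) p (v p)
      = D f p (D (\<lambda>q. lift q (v q)) p (lift p (u p)) - D (\<lambda>q. lift q (u q)) p (lift p (v p)))"
    unfolding hder_def
    by (rule D_commutator[OF assms(1-3)]) (use du dv in \<open>auto simp: differentiable_def\<close>)
  also have "D (\<lambda>q. lift q (v q)) p (lift p (u p)) - D (\<lambda>q. lift q (u q)) p (lift p (v p))
      = lift p (hder v p (u p) - hder u p (v p)) + (4 * (hJ (u p) \<bullet> v p)) *\<^sub>R vert"
  proof -
    have "4 * (hJ (u p) \<bullet> v p) = - 2 * (u p \<bullet> hJ (v p)) - - 2 * (v p \<bullet> hJ (u p))"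
      using hJ_inner(2)[of "u p" "v p"] inner_commute[of "v p" "hJ (u p)"] by simp
    then have "(4 * (hJ (u p) \<bullet> v p)) *\<^sub>R vert
        = (- 2 * (u p \<bullet> hJ (v p))) *\<^sub>R vert - (- 2 * (v p \<bullet> hJ (u p))) *\<^sub>R (vert :: 'n heis)"
      by (simp only: scaleR_left_diff_distrib)
    then show ?thesis
      unfolding D_eqI[OF du] D_eqI[OF dv] hder_def lift_simps(2) zpart_simps(5) by (simp only: add_diff_add)
  qed
  finally show ?thesis by (subst (asm) D_decomposition[OF f]) (simp add: zpart_simps T_coeff_simps)
qed

section \<open>Umbilic patches\<close>

definition hgrad :: "('n::finite heis \<Rightarrow> real) \<Rightarrow> 'n heis \<Rightarrow> 'n hor" where
  "hgrad F q = (\<Sum>b\<in>Basis. hder F q b *\<^sub>R b)"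

section \<open>Rules for horizontal derivatives\<close>

lemma hder_scaleR:
  fixes f :: "'n::finite heis \<Rightarrow> real" and g :: "'n heis \<Rightarrow> 'b::real_normed_vector"
  assumes "f differentiable (at p)" "g differentiable (at p)"
  shows "hder (\<lambda>q. f q *\<^sub>R g q) p u = f p *\<^sub>R hder g p u + hder f p u *\<^sub>R g p"
  unfolding hder_def by (simp add: D_eqI[OF has_derivative_scaleR[OF D_works[OF assms(1)] D_works[OF assms(2)]]])

lemma hder_inner:
  fixes f g :: "'n::finite heis \<Rightarrow> 'b::real_inner"
  assumes "f differentiable (at p)" "g differentiable (at p)"
  shows "hder (\<lambda>q. f q \<bullet> g q) p u = f p \<bullet> hder g p u + hder f p u \<bullet> g p"
  unfolding hder_def by (simp add: D_eqI[OF has_derivative_inner[OF D_works[OF assms(1)] D_works[OF assms(2)]]])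

lemma hder_mult:
  fixes f g :: "'n::finite heis \<Rightarrow> real"
  assumes "f differentiable (at p)" "g differentiable (at p)"
  shows "hder (\<lambda>q. f q * g q) p u = f p * hder g p u + hder f p u * g p"
  unfolding hder_def by (simp add: D_eqI[OF has_derivative_mult[OF D_works[OF assms(1)] D_works[OF assms(2)]]])

lemma hder_add:
  assumes "f differentiable (at p)" "g differentiable (at p)"
  shows "hder (\<lambda>q. f q + g q) p u = hder f p u + hder g p u"
  unfolding hder_def by (simp add: D_eqI[OF has_derivative_add[OF D_works[OF assms(1)] D_works[OF assms(2)]]])

lemma hder_diff:
  assumes "f differentiable (at p)" "g differentiable (at p)"
  shows "hder (\<lambda>q. f q - g q) p u = hder f p u - hder g p u"
  unfolding hder_def by (simp add: D_eqI[OF has_derivative_diff[OF D_works[OF assms(1)] D_works[OF assms(2)]]])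

lemma hder_minus:
  assumes "f differentiable (at p)"
  shows "hder (\<lambda>q. - f q) p u = - hder f p u"
  unfolding hder_def by (simp add: D_eqI[OF has_derivative_minus[OF D_works[OF assms(1)]]])

lemma hder_const: "hder (\<lambda>q. c) p u = 0"
  by (simp add: hder_def)

lemma hder_compose_linear:
  assumes "bounded_linear h" "f differentiable (at p)"
  shows "hder (\<lambda>q. h (f q)) p u = h (hder f p u)"
  unfolding hder_def by (simp add: D_eqI[OF bounded_linear.has_derivative[OF assms(1) D_works[OF assms(2)]]])

lemma hder_zpart: "hder zpart p u = u"
  by (simp add: hder_def D_eqI[OF bounded_linear_imp_has_derivative[OF bounded_linear_zpart]] zpart_simps)

lemma differentiable_zpart: "zpart differentiable (at p)"
  using bounded_linear_imp_has_derivative[OF bounded_linear_zpart] by (auto simp: differentiable_def)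

lemma differentiable_compose_linear:
  "bounded_linear h \<Longrightarrow> f differentiable (at p) \<Longrightarrow> (\<lambda>q. h (f q)) differentiable (at p)"
  using bounded_linear.has_derivative by (metis differentiable_def)

lemmas hder_rules = hder_scaleR hder_inner hder_mult hder_add hder_diff hder_minus hder_const
  hder_compose_linear[OF bounded_linear_hJ] hder_zpart

lemma differentiable_scaleR':
  fixes f :: "'n::finite heis \<Rightarrow> real" and g :: "'n heis \<Rightarrow> 'b::real_normed_vector"
  assumes "f differentiable (at p)" "g differentiable (at p)"
  shows "(\<lambda>q. f q *\<^sub>R g q) differentiable (at p)"
  using has_derivative_scaleR[OF D_works[OF assms(1)] D_works[OF assms(2)]] by (auto simp: differentiable_def)

lemmas diff_rules = differentiable_scaleR' differentiable_inner differentiable_mult differentiable_add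
  differentiable_diff differentiable_minus differentiable_const differentiable_zpart
  differentiable_compose_linear[OF bounded_linear_hJ]

lemma smooth_hgrad:
  assumes "open U" "smooth U F"
  shows "smooth U (hgrad F)"
  unfolding hgrad_def[abs_def] using assms by (intro smooth_sum smooth_scaleR smooth_hder smooth_const)

lemma hder_eq_hgrad:
  assumes "F differentiable (at q)"
  shows "hder F q u = hgrad F q \<bullet> u"
proof -
  have "hder F q u = hder F q (\<Sum>b\<in>Basis. (u \<bullet> b) *\<^sub>R b)"
    by (simp add: euclidean_representation)
  also have "\<dots> = (\<Sum>b\<in>Basis. (u \<bullet> b) * hder F q b)"
  proof -
    have "linear (hder F q)" using hder_simps[OF assms] by (intro linearI) auto
    then show ?thesis by (simp add: linear_sum linear_cmul)
  qed
  finally show ?thesis by (simp add: hgrad_def inner_sum_left inner_commute[of u] mult.commute)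
qed

text \<open>The coefficient space has dimension 2 n, at least 4, so two vectors do not span it.
  Applied to N and J N this makes E' nonzero.\<close>

lemma orthogonal_vector_exists:
  fixes u v :: "'n::finite hor"
  assumes "CARD('n) \<ge> 2"
  obtains w where "w \<noteq> 0" "w \<bullet> u = 0" "w \<bullet> v = 0"
proof -
  have "dim {u, v} \<le> card {u, v}" by (rule dim_le_card') simp
  also have "\<dots> \<le> 2" by (simp add: card_insert_if)
  also have "2 < DIM('n hor)" using assms by simp
  finally obtain w where "w \<noteq> 0" "\<And>y. y \<in> span {u, v} \<Longrightarrow> orthogonal w y"
    using orthogonal_to_subspace_exists by metis
  then show thesis
    using that[of w] by (auto simp: orthogonal_def span_base)
qed

text \<open>The local form of the hypotheses. F is an equation of M normalized so that
  \<open>hgrad F\<close> is the horizontal normal on M and \<open>2 * D F q vert\<close> is the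
  \<open>\<alpha>\<close> of the overview. \<open>shape\<close> combines umbilicity with the trace
  of the shape operator; like \<open>unit\<close> it speaks of the zero set of F only.\<close>

locale umbilic_patch =
  fixes U :: "'n::finite heis set" and F :: "'n heis \<Rightarrow> real" and c :: real
  assumes card: "CARD('n) \<ge> 2" and c0: "c \<noteq> 0"
    and open_U: "open U" and smooth_F: "smooth U F"
    and z_nonzero: "\<And>q. q \<in> U \<Longrightarrow> zpart q \<noteq> 0"
    and unit: "\<And>q. q \<in> U \<Longrightarrow> F q = 0 \<Longrightarrow> norm (hgrad F q) = 1"
    and shape: "\<And>q. q \<in> U \<Longrightarrow> F q = 0 \<Longrightarrow> \<exists>k l.
      (\<forall>w. w \<bullet> hgrad F q = 0 \<and> w \<bullet> hJ (hgrad F q) = 0 \<longrightarrow>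
        hder (hgrad F) q w = k *\<^sub>R w + (2 * D F q vert) *\<^sub>R hJ w) \<and>
      hder (hgrad F) q (- hJ (hgrad F q)) = l *\<^sub>R (- hJ (hgrad F q)) \<and>
      (2 * real CARD('n) - 2) * k + l = c * (2 * real CARD('n) - 1) * norm (zpart q)"
begin

abbreviation G :: "'n heis \<Rightarrow> 'n hor" where "G \<equiv> hgrad F"
definition \<alpha> :: "'n heis \<Rightarrow> real" where "\<alpha> q = 2 * D F q vert"
definition \<eta> :: "'n heis \<Rightarrow> 'n hor" where "\<eta> q = - hJ (G q)"
text \<open>Given by a formula and not by the witness in \<open>shape\<close>, so that it is smooth
  on all of U; the two agree where F = 0. Likewise \<open>k\<close> comes from solving the curvature
  equation, with \<open>\<gamma>\<close> the resulting factor of s.\<close>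

definition l :: "'n heis \<Rightarrow> real" where "l q = hder G q (\<eta> q) \<bullet> \<eta> q"
definition s :: "'n heis \<Rightarrow> real" where "s q = norm (zpart q)"
definition \<gamma> :: real where "\<gamma> = c * (2 * real CARD('n) - 1) / (2 * real CARD('n) - 2)"
definition k :: "'n heis \<Rightarrow> real" where "k q = \<gamma> * s q - l q / (2 * real CARD('n) - 2)"
definition E :: "'n heis \<Rightarrow> 'n hor \<Rightarrow> bool" where "E q w \<longleftrightarrow> w \<bullet> G q = 0 \<and> w \<bullet> hJ (G q) = 0"
text \<open>On M this projects a fixed w to E' at q: a smooth field in E' that takes the value w at
  any point where w already belongs to E'.\<close>

definition P :: "'n hor \<Rightarrow> 'n heis \<Rightarrow> 'n hor" where
  "P w q = w - (w \<bullet> G q) *\<^sub>R G q - (w \<bullet> hJ (G q)) *\<^sub>R hJ (G q)"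

lemma card_pos: "2 * real CARD('n) - 2 > 0"
  using card by linarith

lemma \<gamma>_nonzero: "\<gamma> \<noteq> 0"
  using card c0 by (simp add: \<gamma>_def)

lemma s_pos: "q \<in> U \<Longrightarrow> s q > 0"
  by (simp add: s_def z_nonzero)

lemma smooth_s: "smooth U s"
proof -
  have "smooth U (\<lambda>q. sqrt (zpart q \<bullet> zpart q))"
    using z_nonzero by (intro smooth_sqrt smooth_inner smooth_linear bounded_linear_zpart open_U) auto
  then show ?thesis by (simp add: s_def[abs_def] norm_eq_sqrt_inner)
qed

lemma smooth_G: "smooth U G"
  by (rule smooth_hgrad[OF open_U smooth_F])

lemma smooth_\<alpha>: "smooth U \<alpha>"
  unfolding \<alpha>_def[abs_def]
  by (intro smooth_mult smooth_const smooth_directional smooth_F open_U)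

lemma smooth_\<eta>: "smooth U \<eta>"
  unfolding \<eta>_def[abs_def]
  by (intro smooth_minus smooth_compose_linear[OF _ bounded_linear_hJ] smooth_G open_U)

lemma smooth_l: "smooth U l"
  unfolding l_def[abs_def] by (intro smooth_inner smooth_hder smooth_G smooth_\<eta> open_U)

lemma smooth_k: "smooth U k"
proof -
  have "smooth U (\<lambda>q. \<gamma> * s q - (1 / (2 * real CARD('n) - 2)) * l q)"
    by (intro smooth_diff smooth_mult smooth_const smooth_s smooth_l open_U)
  then show ?thesis by (simp add: k_def[abs_def])
qed

lemma smooth_P: "smooth U (P w)"
  unfolding P_def[abs_def]
  by (intro smooth_diff smooth_scaleR smooth_inner smooth_const smooth_G
      smooth_compose_linear[OF _ bounded_linear_hJ] open_U)

lemma diff: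
  assumes "q \<in> U"
  shows "F differentiable (at q)" "G differentiable (at q)" "\<alpha> differentiable (at q)"
    "\<eta> differentiable (at q)" "l differentiable (at q)" "s differentiable (at q)"
    "k differentiable (at q)" "P w differentiable (at q)"
  using smooth_F smooth_G smooth_\<alpha> smooth_\<eta> smooth_l smooth_s smooth_k smooth_P[of w] assms
  by (simp_all add: smooth_differentiable[of U])

lemma D_F_nonzero: "p \<in> U \<Longrightarrow> F p = 0 \<Longrightarrow> D F p \<noteq> (\<lambda>_. 0)"
  using hder_eq_hgrad[OF diff(1), of p "G p"] unit[of p] by (auto simp: hder_def)

lemma tangential_eq:
  fixes f g :: "'n heis \<Rightarrow> 'b::real_normed_vector"
  assumes p: "p \<in> U" "F p = 0" and v: "D F p v = 0"
    and fg: "\<And>q. q \<in> U \<Longrightarrow> F q = 0 \<Longrightarrow> f q = g q"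
    and d: "f differentiable (at p)" "g differentiable (at p)"
  shows "D f p v = D g p v"
proof -
  obtain c \<epsilon> where "\<epsilon> > 0" "c 0 = p" "\<And>s. \<bar>s\<bar> < \<epsilon> \<Longrightarrow> c s \<in> U \<and> F (c s) = 0"
    "(c has_vector_derivative v) (at 0)"
    using level_set_curve[OF open_U smooth_Cn[OF smooth_F] p D_F_nonzero[OF p] v] by metis
  then show ?thesis using tangent_derivative_eq[of c v \<epsilon> f g] fg d by metis
qed

lemma hder_tangential_eq:
  fixes f g :: "'n heis \<Rightarrow> 'b::real_normed_vector"
  assumes p: "p \<in> U" "F p = 0" and v: "v \<bullet> G p = 0"
    and fg: "\<And>q. q \<in> U \<Longrightarrow> F q = 0 \<Longrightarrow> f q = g q"
    and d: "f differentiable (at p)" "g differentiable (at p)"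
  shows "hder f p v = hder g p v"
  unfolding hder_def
  by (rule tangential_eq[OF p _ fg d])
     (use hder_eq_hgrad[OF diff(1)[OF p(1)], of v] v in \<open>simp_all add: hder_def inner_commute\<close>)

text \<open>Second derivatives of F in the frame fail to be symmetric by the bracket of the two
  constant fields, 4 <J u, v> T, applied to F; and \<open>\<alpha>\<close> is 2 T F.\<close>

lemma G_antisym:
  assumes q: "q \<in> U"
  shows "hder G q u \<bullet> v - hder G q v \<bullet> u = 2 * \<alpha> q * (hJ u \<bullet> v)"
proof -
  have h: "hder (\<lambda>q. hder F q v) q u = hder G q u \<bullet> v" for u v
  proof -
    have "hder (\<lambda>q. hder F q v) q u = hder (\<lambda>q. G q \<bullet> v) q u"
      unfolding hder_def[of _ q u]
      by (rule arg_cong[where f = "\<lambda>f. f (lift q u)"], rule D_cong_open[OF open_U q])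
         (simp add: hder_eq_hgrad diff)
    then show ?thesis by (simp add: hder_rules diff q)
  qed
  show ?thesis
    using horizontal_commutator[OF open_U smooth_Cn[OF smooth_F] q, of "\<lambda>_. u" "\<lambda>_. v"]
    by (simp add: h hder_const hder_simps diff q \<alpha>_def)
qed

text \<open>T commutes with left-invariant fields, so T of the gradient of F is the gradient of T F,
  which is half of \<open>\<alpha>\<close>.\<close>

lemma G_vertical:
  assumes q: "q \<in> U"
  shows "D G q vert \<bullet> u = hder \<alpha> q u / 2"
proof -
  have "D (\<lambda>q. lift q u) q vert = 0"
    using lift_has_derivative[OF has_derivative_const, of u q] D_eqI
    by (fastforce simp: zpart_simps lift_simps)
  moreover have "(\<lambda>q. lift q u) differentiable (at q)"
    using lift_has_derivative[OF has_derivative_const, of u q] by (auto simp: differentiable_def)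
  ultimately have "D (\<lambda>q. D F q vert) q (lift q u) = D (\<lambda>q. D F q (lift q u)) q vert"
    using D_commutator[OF open_U smooth_Cn[OF smooth_F] q, of "\<lambda>q. lift q u" "\<lambda>_. vert"]
      linear_0[OF D_linear[OF diff(1)[OF q]]] by simp
  moreover have "D (\<lambda>q. D F q (lift q u)) q = D (\<lambda>q. G q \<bullet> u) q"
    by (rule D_cong_open[OF open_U q]) (simp add: hder_eq_hgrad[symmetric] diff hder_def)
  moreover have "hder \<alpha> q u = 2 * D (\<lambda>q. D F q vert) q (lift q u)"
  proof -
    have "(\<lambda>q. D F q vert) differentiable (at q)"
      by (rule smooth_differentiable[OF smooth_directional[OF open_U smooth_F smooth_const[OF open_U]] q])
    then show ?thesis
      by (simp add: \<alpha>_def[abs_def] hder_rules diff_rules) (simp add: hder_def)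
  qed
  ultimately show ?thesis using D_inner_left[OF diff(2)[OF q], of u vert] by simp
qed

context
  fixes p assumes p: "p \<in> U" "F p = 0"
begin

lemma G_unit: "G p \<bullet> G p = 1" "hJ (G p) \<bullet> hJ (G p) = 1" "G p \<bullet> hJ (G p) = 0" "hJ (G p) \<bullet> G p = 0"
  using unit[OF p] by (auto simp: hJ_inner hJ_simps norm_eq_1)

lemma E_hJ: "E p w \<Longrightarrow> E p (hJ w)"
  by (simp add: E_def hJ_inner hJ_simps)

lemma E_inner:
  assumes "E p w"
  shows "w \<bullet> G p = 0" "w \<bullet> hJ (G p) = 0" "G p \<bullet> w = 0" "hJ (G p) \<bullet> w = 0" "w \<bullet> \<eta> p = 0" "\<eta> p \<bullet> w = 0"
    "hJ w \<bullet> G p = 0" "hJ w \<bullet> hJ (G p) = 0" "G p \<bullet> hJ w = 0" "hJ (G p) \<bullet> hJ w = 0" "hJ w \<bullet> \<eta> p = 0" "\<eta> p \<bullet> hJ w = 0"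
  using assms E_hJ[OF assms] by (auto simp: E_def \<eta>_def inner_commute)

lemma P_E: "E p (P w p)"
  by (simp add: E_def P_def inner_simps G_unit)

lemma P_eq: "E p w \<Longrightarrow> P w p = w"
  by (simp add: E_def P_def)

lemma E_nontrivial: "\<exists>w. w \<noteq> 0 \<and> E p w"
  using orthogonal_vector_exists[OF card, of "G p" "hJ (G p)"] unfolding E_def by metis

lemma G_eta: "hder G p (\<eta> p) = l p *\<^sub>R \<eta> p"
  and G_E: "E p w \<Longrightarrow> hder G p w = k p *\<^sub>R w + \<alpha> p *\<^sub>R hJ w"
proof -
  obtain k' l' where kl: "\<And>w. w \<bullet> G p = 0 \<and> w \<bullet> hJ (G p) = 0 \<Longrightarrow>
        hder G p w = k' *\<^sub>R w + (2 * D F p vert) *\<^sub>R hJ w"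
    "hder G p (\<eta> p) = l' *\<^sub>R \<eta> p"
    "(2 * real CARD('n) - 2) * k' + l' = c * (2 * real CARD('n) - 1) * norm (zpart p)"
    using shape[OF p] unfolding \<eta>_def by metis
  \<comment> \<open>The witness for l is unique because \<open>\<eta>\<close> is a unit vector; the
    one for k then follows on division by 2 n - 2, positive as n >= 2.\<close>
  have "l p = l'" by (simp add: l_def kl(2)) (simp add: \<eta>_def G_unit)
  moreover from this have "k p = k'"
  proof -
    have "k p = (c * (2 * real CARD('n) - 1) * norm (zpart p) - l p) / (2 * real CARD('n) - 2)"
      by (simp add: k_def \<gamma>_def s_def diff_divide_distrib)
    also have "\<dots> = k'" using kl(3)[symmetric] card_pos \<open>l p = l'\<close> by simp
    finally show ?thesis .
  qed
  ultimately show "hder G p (\<eta> p) = l p *\<^sub>R \<eta> p"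
    "E p w \<Longrightarrow> hder G p w = k p *\<^sub>R w + \<alpha> p *\<^sub>R hJ w"
    using kl by (auto simp: E_def \<alpha>_def)
qed

lemma hder_P: "E p w \<Longrightarrow> hder (P w) p v =
    - (w \<bullet> hder G p v) *\<^sub>R G p - (w \<bullet> hJ (hder G p v)) *\<^sub>R hJ (G p)"
  unfolding P_def[abs_def] by (simp add: hder_rules diff_rules diff p E_inner)

text \<open>The derivative of N along \<open>\<eta>\<close> is a multiple of \<open>\<eta>\<close>,
  and both \<open>\<eta>\<close> and J \<open>\<eta>\<close> = N are orthogonal to E'.\<close>

lemma hder_P_eta: "E p w \<Longrightarrow> hder (P w) p (\<eta> p) = 0"
  by (simp add: hder_P G_eta E_inner hJ_simps) (simp add: \<eta>_def hJ_simps E_inner)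

lemma hder_P_hJ:
  assumes w: "E p w"
  shows "hder (P (hJ w)) p w = (- \<alpha> p * (w \<bullet> w)) *\<^sub>R G p + (- k p * (w \<bullet> w)) *\<^sub>R hJ (G p)"
    "hder (P w) p (hJ w) = (\<alpha> p * (w \<bullet> w)) *\<^sub>R G p + (k p * (w \<bullet> w)) *\<^sub>R hJ (G p)"
  unfolding hder_P[OF w] hder_P[OF E_hJ[OF w]] G_E[OF w] G_E[OF E_hJ[OF w]]
  by (simp_all add: hJ_simps inner_simps hJ_inner)

lemma hder_eta: "E p w \<Longrightarrow> hder \<eta> p w = \<alpha> p *\<^sub>R w - k p *\<^sub>R hJ w"
  unfolding \<eta>_def[abs_def] by (simp add: hder_rules diff_rules diff p G_E hJ_simps)

end

section \<open>Codazzi equations\<close>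

lemma hder_G_P: "q \<in> U \<Longrightarrow> F q = 0 \<Longrightarrow> hder G q (P w q) = k q *\<^sub>R P w q + \<alpha> q *\<^sub>R hJ (P w q)"
  by (simp add: G_E P_E)

lemma diff_hder: "p \<in> U \<Longrightarrow> smooth U f \<Longrightarrow> smooth U u \<Longrightarrow> (\<lambda>q. hder f q (u q)) differentiable (at p)"
  using smooth_hder[OF open_U] smooth_differentiable by blast

text \<open>The bracket of \<open>P w\<close> and \<open>\<eta>\<close> has no vertical part,
  because J w is orthogonal to \<open>\<eta>\<close>; by the shape equation it is
  \<open>\<alpha>\<close> w - k J w. Applying the commutator to the normal and comparing the
  components along \<open>\<eta>\<close>, w and J w gives the three equations.\<close>

lemma codazzi_eta:
  assumes p: "p \<in> U" "F p = 0" and w: "E p w"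
  shows "hder l p w = 0"
    and "w \<noteq> 0 \<Longrightarrow> hder k p (\<eta> p) = (l p - 2 * k p) * \<alpha> p"
    and "w \<noteq> 0 \<Longrightarrow> hder \<alpha> p (\<eta> p) = (k p)\<^sup>2 - (\<alpha> p)\<^sup>2 - l p * k p"
proof -
  note d = diff[OF p(1)]
  have Pw: "P w p = w" by (rule P_eq[OF p w])
  have 1: "hder (\<lambda>q. hder G q (\<eta> q)) p w = hder (\<lambda>q. l q *\<^sub>R \<eta> q) p w"
    by (rule hder_tangential_eq[OF p])
       (auto simp: E_inner[OF p w] G_eta diff_rules d p intro!: diff_hder smooth_G smooth_\<eta>)
  have 2: "hder (\<lambda>q. hder G q (P w q)) p (\<eta> p) = hder (\<lambda>q. k q *\<^sub>R P w q + \<alpha> q *\<^sub>R hJ (P w q)) p (\<eta> p)"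
    by (rule hder_tangential_eq[OF p])
       (auto simp: \<eta>_def G_unit p hder_G_P diff_rules d intro!: diff_hder smooth_G smooth_P)
  have "l p *\<^sub>R (\<alpha> p *\<^sub>R w - k p *\<^sub>R hJ w) + hder l p w *\<^sub>R \<eta> p
      - (hder k p (\<eta> p) *\<^sub>R w + hder \<alpha> p (\<eta> p) *\<^sub>R hJ w)
    = \<alpha> p *\<^sub>R (k p *\<^sub>R w + \<alpha> p *\<^sub>R hJ w) - k p *\<^sub>R (k p *\<^sub>R hJ w - \<alpha> p *\<^sub>R w)"
    using horizontal_commutator[OF open_U smooth_Cn[OF smooth_G] p(1) d(8)[of w] d(4)] 1 2
    by (simp add: Pw hder_rules diff_rules d hder_P_eta[OF p w] hder_eta[OF p w] hJ_simps
        E_inner[OF p w] hder_simps(2,3) G_E[OF p w] G_E[OF p E_hJ[OF p w]])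
  then have eq: "(l p *\<^sub>R (\<alpha> p *\<^sub>R w - k p *\<^sub>R hJ w) + hder l p w *\<^sub>R \<eta> p
      - (hder k p (\<eta> p) *\<^sub>R w + hder \<alpha> p (\<eta> p) *\<^sub>R hJ w)) \<bullet> x
    = (\<alpha> p *\<^sub>R (k p *\<^sub>R w + \<alpha> p *\<^sub>R hJ w) - k p *\<^sub>R (k p *\<^sub>R hJ w - \<alpha> p *\<^sub>R w)) \<bullet> x" for x
    by simp
  have "\<eta> p \<bullet> \<eta> p = 1" using G_unit[OF p] by (simp add: \<eta>_def)
  then show "hder l p w = 0" using eq[of "\<eta> p"] by (simp add: inner_simps E_inner[OF p w])
  assume "w \<noteq> 0"
  then have ww: "w \<bullet> w \<noteq> 0" by simp
  have "(l p * \<alpha> p - hder k p (\<eta> p)) * (w \<bullet> w) = (2 * (k p * \<alpha> p)) * (w \<bullet> w)"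
    using eq[of w] by (simp add: inner_simps E_inner[OF p w] hJ_inner(3) algebra_simps)
  then have "l p * \<alpha> p - hder k p (\<eta> p) = 2 * (k p * \<alpha> p)"
    using ww mult_right_cancel by blast
  then show "hder k p (\<eta> p) = (l p - 2 * k p) * \<alpha> p" by (simp add: algebra_simps)
  have "(- l p * k p - hder \<alpha> p (\<eta> p)) * (w \<bullet> w) = ((\<alpha> p)\<^sup>2 - (k p)\<^sup>2) * (w \<bullet> w)"
    using eq[of "hJ w"] by (simp add: inner_simps E_inner[OF p w] hJ_inner(1,4) algebra_simps power2_eq_square)
  then have "- l p * k p - hder \<alpha> p (\<eta> p) = (\<alpha> p)\<^sup>2 - (k p)\<^sup>2"
    using ww mult_right_cancel by blast
  then show "hder \<alpha> p (\<eta> p) = (k p)\<^sup>2 - (\<alpha> p)\<^sup>2 - l p * k p" by simp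
qed

text \<open>Here the bracket has the vertical part 4 |w|^2 T, which contributes 2 |w|^2 times the
  derivative of \<open>\<alpha>\<close> by \<open>G_vertical\<close>. Only the component along w is
  compared, since there the unknown derivative of the normal in its own direction drops out.\<close>

lemma codazzi_J:
  assumes p: "p \<in> U" "F p = 0" and w: "E p w"
  shows "hder k p (hJ w) = - 3 * hder \<alpha> p w"
proof (cases "w = 0")
  case True
  then show ?thesis by (simp add: hder_simps diff p hJ_simps)
next
  case False
  note d = diff[OF p(1)]
  have w': "E p (hJ w)" by (rule E_hJ[OF p w])
  have Pw: "P w p = w" "P (hJ w) p = hJ w" by (rule P_eq[OF p w], rule P_eq[OF p w'])
  have 1: "hder (\<lambda>q. hder G q (P (hJ w) q)) p w
      = hder (\<lambda>q. k q *\<^sub>R P (hJ w) q + \<alpha> q *\<^sub>R hJ (P (hJ w) q)) p w"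
    by (rule hder_tangential_eq[OF p])
       (auto simp: E_inner[OF p w] p hder_G_P diff_rules d intro!: diff_hder smooth_G smooth_P)
  have 2: "hder (\<lambda>q. hder G q (P w q)) p (hJ w) = hder (\<lambda>q. k q *\<^sub>R P w q + \<alpha> q *\<^sub>R hJ (P w q)) p (hJ w)"
    by (rule hder_tangential_eq[OF p])
       (auto simp: E_inner[OF p w] p hder_G_P diff_rules d intro!: diff_hder smooth_G smooth_P)
  have GJ: "hder G p (hJ (G p)) = - (l p *\<^sub>R \<eta> p)"
    using G_eta[OF p] hder_simps(4)[OF d(2), of "\<eta> p"] by (simp add: \<eta>_def)
  \<comment> \<open>N is not tangent to M, so \<open>shape\<close> says nothing about this
    derivative; \<open>G_antisym\<close> relates its w component to the known derivative along
    w.\<close>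
  have GG: "hder G p (G p) \<bullet> w = 0"
    using G_antisym[OF p(1), of "G p" w] by (simp add: G_E[OF p w] inner_simps E_inner[OF p w])
  have "(k p *\<^sub>R hder (P (hJ w)) p w + hder k p w *\<^sub>R hJ w + (\<alpha> p *\<^sub>R hJ (hder (P (hJ w)) p w) + hder \<alpha> p w *\<^sub>R hJ (hJ w)))
     - (k p *\<^sub>R hder (P w) p (hJ w) + hder k p (hJ w) *\<^sub>R w + (\<alpha> p *\<^sub>R hJ (hder (P w) p (hJ w)) + hder \<alpha> p (hJ w) *\<^sub>R hJ w))
     = hder G p (hder (P (hJ w)) p w - hder (P w) p (hJ w)) + (4 * (hJ w \<bullet> hJ w)) *\<^sub>R D G p vert"
    (is "?L = ?R")
    using horizontal_commutator[OF open_U smooth_Cn[OF smooth_G] p(1) d(8)[of w] d(8)[of "hJ w"]] 1 2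
    by (simp add: Pw hder_rules diff_rules d)
  then have "?L \<bullet> w = ?R \<bullet> w" by (simp only:)
  then have "- hder \<alpha> p w * (w \<bullet> w) - hder k p (hJ w) * (w \<bullet> w) = 2 * (w \<bullet> w) * hder \<alpha> p w"
    unfolding hder_P_hJ[OF p w]
    by (simp add: hJ_simps inner_simps E_inner[OF p w] hder_simps d GJ GG G_vertical[OF p(1)] hJ_inner)
  then have "(hder k p (hJ w) + 3 * hder \<alpha> p w) * (w \<bullet> w) = 0"
    by (simp add: algebra_simps)
  then show ?thesis using False by simp
qed

lemma hder_s: "q \<in> U \<Longrightarrow> hder s q u = (zpart q \<bullet> u) / s q"
proof -
  assume q: "q \<in> U"
  have "(\<lambda>q. s q * s q) = (\<lambda>q. zpart q \<bullet> zpart q)"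
    by (simp add: s_def fun_eq_iff power2_norm_eq_inner[symmetric] power2_eq_square)
  then have "hder (\<lambda>q. s q * s q) q u = hder (\<lambda>q. zpart q \<bullet> zpart q) q u"
    by simp
  then have "2 * (s q * hder s q u) = 2 * (zpart q \<bullet> u)"
    by (simp add: hder_rules diff_rules diff q inner_commute mult.commute)
  then show ?thesis using s_pos[OF q] by (simp add: field_simps)
qed

lemma hder_k:
  assumes p: "p \<in> U" "F p = 0" and w: "E p w"
  shows "hder k p w = \<gamma> * (zpart p \<bullet> w) / s p"
proof -
  define r where "r = 1 / (2 * real CARD('n) - 2)"
  have "k = (\<lambda>q. \<gamma> * s q - r * l q)" by (simp add: k_def[abs_def] r_def)
  then have "hder k p w = hder (\<lambda>q. \<gamma> * s q - r * l q) p w" by simp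
  then show ?thesis by (simp add: hder_rules diff_rules diff p hder_s codazzi_eta(1)[OF p w])
qed

lemma hder_\<alpha>:
  assumes p: "p \<in> U" "F p = 0" and w: "E p w"
  shows "s p * hder \<alpha> p w = - (\<gamma> / 3) * (zpart p \<bullet> hJ w)" "hder \<alpha> p (hJ w) = hder k p w / 3"
proof -
  show "s p * hder \<alpha> p w = - (\<gamma> / 3) * (zpart p \<bullet> hJ w)"
    using codazzi_J[OF p w] hder_k[OF p E_hJ[OF p w]] s_pos[OF p(1)] by (simp add: field_simps)
  show "hder \<alpha> p (hJ w) = hder k p w / 3"
    using codazzi_J[OF p E_hJ[OF p w]] by (simp add: hJ_simps hder_simps diff p)
qed

section \<open>Vanishing of the component of z in E'\<close>

definition zE :: "'n heis \<Rightarrow> 'n hor" where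
  "zE q = zpart q - (zpart q \<bullet> G q) *\<^sub>R G q - (zpart q \<bullet> hJ (G q)) *\<^sub>R hJ (G q)"

text \<open>Take w to be the component itself. Then z is orthogonal to J w, so
  \<open>\<alpha>\<close> is stationary along w. Let k_w be the derivative of k along w. The
  commutator of the derivatives of \<open>\<alpha>\<close> along \<open>P w\<close> and
  \<open>\<eta>\<close>, evaluated with the Codazzi equations, reads (2 k - l) k_w = - k k_w / 3,
  and k_w = \<open>\<gamma>\<close> |w|^2 / s is not 0.\<close>

lemma zE_eq_0_or:
  assumes p: "p \<in> U" "F p = 0" and nz: "zE p \<noteq> 0"
  shows "l p = 7 / 3 * k p"
proof -
  note d = diff[OF p(1)]
  define w where "w = zE p"
  have w: "E p w" using P_E[OF p, of "zpart p"] by (simp add: w_def zE_def P_def)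
  have w0: "w \<noteq> 0" using nz by (simp add: w_def)
  have zw: "zpart p = w + (zpart p \<bullet> G p) *\<^sub>R G p + (zpart p \<bullet> hJ (G p)) *\<^sub>R hJ (G p)"
    by (simp add: w_def zE_def)
  have zJ: "zpart p \<bullet> hJ w = 0" "zpart p \<bullet> w = w \<bullet> w"
    using arg_cong[OF zw, of "\<lambda>x. x \<bullet> hJ w"] arg_cong[OF zw, of "\<lambda>x. x \<bullet> w"]
    by (simp_all only: inner_add_left inner_scaleR_left E_inner[OF p w] hJ_inner(4) mult_zero_right add_0_right)
  have Pw: "P w p = w" by (rule P_eq[OF p w])
  have \<alpha>w: "hder \<alpha> p w = 0"
    using hder_\<alpha>(1)[OF p w] s_pos[OF p(1)] by (simp add: zJ)
  have 1: "hder (\<lambda>q. hder \<alpha> q (\<eta> q)) p w = hder (\<lambda>q. k q * k q - \<alpha> q * \<alpha> q - l q * k q) p w"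
  proof (rule hder_tangential_eq[OF p])
    fix q assume q: "q \<in> U" "F q = 0"
    obtain w' where "w' \<noteq> 0" "E q w'"
      using E_nontrivial[OF q] by blast
    then show "hder \<alpha> q (\<eta> q) = k q * k q - \<alpha> q * \<alpha> q - l q * k q"
      using codazzi_eta(3)[OF q] by (simp add: power2_eq_square)
  qed (auto simp: E_inner[OF p w] p diff_rules d intro!: diff_hder smooth_\<alpha> smooth_\<eta>)
  have dd: "(\<lambda>q. hder \<alpha> q (P w q)) differentiable (at p)"
    by (intro diff_hder smooth_\<alpha> smooth_P p)
  define r where "r = - (\<gamma> / 3)"
  \<comment> \<open>The relation for the derivative of \<open>\<alpha>\<close> along
    \<open>P w\<close> is kept multiplied by s. Its right side is stationary along
    \<open>\<eta>\<close> at p, and the term with the derivative of s drops out because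
    \<open>\<alpha>\<close> is stationary along w.\<close>
  have 2: "hder (\<lambda>q. s q * hder \<alpha> q (P w q)) p (\<eta> p) = hder (\<lambda>q. r * (zpart q \<bullet> hJ (P w q))) p (\<eta> p)"
    by (rule hder_tangential_eq[OF p])
       (auto simp: \<eta>_def G_unit p hder_\<alpha> P_E diff_rules d dd r_def)
  have "hder (\<lambda>q. hder \<alpha> q (P w q)) p (\<eta> p) = 0"
    using 2 s_pos[OF p(1)]
    by (simp add: hder_rules diff_rules d dd Pw \<alpha>w hder_P_eta[OF p w] hJ_simps E_inner[OF p w])
  then have "2 * k p * hder k p w - l p * hder k p w = - k p * hder k p w / 3"
    using horizontal_commutator[OF open_U smooth_Cn[OF smooth_\<alpha>] p(1) d(8)[of w] d(4)] 1
    by (simp add: Pw hder_rules diff_rules d hder_P_eta[OF p w] hder_eta[OF p w] hder_simps(2,3)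
        E_inner[OF p w] codazzi_eta(1)[OF p w] \<alpha>w hder_\<alpha>(2)[OF p w])
  then have "(7 / 3 * k p - l p) * hder k p w = 0" by (simp add: algebra_simps)
  moreover have "hder k p w \<noteq> 0"
    using hder_k[OF p w] \<gamma>_nonzero s_pos[OF p(1)] w0 by (simp add: zJ)
  ultimately show ?thesis by simp
qed

text \<open>The product of 7 k - 3 l and |zE|^2 vanishes on the whole zero set of F, whichever
  factor is 0. At a point with zE not 0 its derivative along w = zE leaves only 7 k_w |w|^2, as l is
  constant along E' and the first factor is 0; but k_w, the derivative of k along w, is not
  0.\<close>

lemma zE_eq_0:
  assumes p: "p \<in> U" "F p = 0"
  shows "zE p = 0"
proof (rule ccontr)
  assume nz: "zE p \<noteq> 0"
  note d = diff[OF p(1)]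
  define w where "w = zE p"
  have w: "E p w" using P_E[OF p, of "zpart p"] by (simp add: w_def zE_def P_def)
  have dz: "zE differentiable (at p)"
    unfolding zE_def[abs_def] by (simp add: diff_rules d)
  have "hder (\<lambda>q. (7 * k q - 3 * l q) * (zE q \<bullet> zE q)) p w = hder (\<lambda>q. 0 :: real) p w"
  proof (rule hder_tangential_eq[OF p])
    fix q assume q: "q \<in> U" "F q = 0"
    show "(7 * k q - 3 * l q) * (zE q \<bullet> zE q) = 0"
      using zE_eq_0_or[OF q] by (cases "zE q = 0") simp_all
  qed (simp_all add: E_inner[OF p w] diff_rules d dz)
  then have "hder k p w * (w \<bullet> w) = 0"
    using zE_eq_0_or[OF p nz]
    by (simp add: hder_rules diff_rules d dz codazzi_eta(1)[OF p w] w_def[symmetric])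
  moreover have zw: "zpart p = w + (zpart p \<bullet> G p) *\<^sub>R G p + (zpart p \<bullet> hJ (G p)) *\<^sub>R hJ (G p)"
    by (simp add: w_def zE_def)
  have "zpart p \<bullet> w = w \<bullet> w"
    using arg_cong[OF zw, of "\<lambda>x. x \<bullet> w"]
    by (simp only: inner_add_left inner_scaleR_left E_inner[OF p w] mult_zero_right add_0_right)
  ultimately show False
    using hder_k[OF p w] \<gamma>_nonzero s_pos[OF p(1)] nz by (simp add: w_def)
qed

section \<open>The closed system of differential equations along eta\<close>

definition a :: "'n heis \<Rightarrow> real" where "a q = zpart q \<bullet> G q"
definition b :: "'n heis \<Rightarrow> real" where "b q = zpart q \<bullet> hJ (G q)"
definition t :: "'n heis \<Rightarrow> real" where "t q = snd (snd q)"

lemma smooth_ab: "smooth U a" "smooth U b"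
  unfolding a_def[abs_def] b_def[abs_def]
  by (intro smooth_inner smooth_linear bounded_linear_zpart smooth_G smooth_compose_linear[OF _ bounded_linear_hJ] open_U)+

lemma bounded_linear_t: "bounded_linear t"
  unfolding t_def[abs_def] by (intro bounded_linear_snd_comp bounded_linear_snd)

lemma smooth_t: "smooth U t"
  by (rule smooth_linear[OF open_U bounded_linear_t])

lemma diff_abt: 
  assumes "q \<in> U"
  shows "a differentiable (at q)" "b differentiable (at q)" "t differentiable (at q)"
  using smooth_ab smooth_t assms by (simp_all add: smooth_differentiable[of U])

lemma hder_t: "hder t q u = - 2 * (zpart q \<bullet> hJ u)"
  by (simp add: hder_def D_eqI[OF bounded_linear_imp_has_derivative[OF bounded_linear_t]] t_def lift_def)

context
  fixes p assumes p: "p \<in> U" "F p = 0"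
begin

lemma z_eq: "zpart p = a p *\<^sub>R G p + b p *\<^sub>R hJ (G p)"
  using zE_eq_0[OF p] by (simp add: zE_def a_def b_def algebra_simps)

lemma a_b_square: "(a p)\<^sup>2 + (b p)\<^sup>2 = (s p)\<^sup>2"
proof -
  have "zpart p \<bullet> zpart p = (a p *\<^sub>R G p + b p *\<^sub>R hJ (G p)) \<bullet> (a p *\<^sub>R G p + b p *\<^sub>R hJ (G p))"
    using z_eq by simp
  moreover have "(s p)\<^sup>2 = zpart p \<bullet> zpart p"
    by (simp add: s_def power2_norm_eq_inner)
  ultimately show ?thesis by (simp add: inner_simps G_unit[OF p] power2_eq_square)
qed

text \<open>Differentiating z = a N + b J N along w in E' gives w = (a + b J) (k +
  \<open>\<alpha>\<close> J) w modulo N and J N. With J as imaginary unit, k + i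
  \<open>\<alpha>\<close> is the reciprocal of a + i b, whose squared modulus is s^2.\<close>

lemma k_eq: "a p = (s p)\<^sup>2 * k p"
  and \<alpha>_eq: "b p = - (s p)\<^sup>2 * \<alpha> p"
proof -
  note d = diff[OF p(1)]
  obtain w where w0: "w \<noteq> 0" and w: "E p w"
    using E_nontrivial[OF p] by blast
  have "hder zpart p w = hder (\<lambda>q. a q *\<^sub>R G q + b q *\<^sub>R hJ (G q)) p w"
  proof (rule hder_tangential_eq[OF p])
    fix q assume "q \<in> U" "F q = 0"
    then show "zpart q = a q *\<^sub>R G q + b q *\<^sub>R hJ (G q)"
      using zE_eq_0[of q] by (simp add: zE_def a_def b_def algebra_simps)
  qed (simp_all add: E_inner[OF p w] diff_rules d diff_abt p)
  then have eq: "w \<bullet> x = (a p *\<^sub>R (k p *\<^sub>R w + \<alpha> p *\<^sub>R hJ w) + hder a p w *\<^sub>R G p +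
      (b p *\<^sub>R (k p *\<^sub>R hJ w - \<alpha> p *\<^sub>R w) + hder b p w *\<^sub>R hJ (G p))) \<bullet> x" for x
    by (simp add: hder_rules diff_rules d diff_abt p G_E[OF p w] hJ_simps)
  have ww: "w \<bullet> w \<noteq> 0" using w0 by simp
  have "1 * (w \<bullet> w) = (a p * k p - b p * \<alpha> p) * (w \<bullet> w)"
    using eq[of w] by (simp add: inner_simps E_inner[OF p w] hJ_inner(3) algebra_simps)
  then have 1: "1 = a p * k p - b p * \<alpha> p" using ww mult_right_cancel by blast
  have "0 * (w \<bullet> w) = (a p * \<alpha> p + b p * k p) * (w \<bullet> w)"
    using eq[of "hJ w"] by (simp add: inner_simps E_inner[OF p w] hJ_inner(1,4) algebra_simps)
  then have 2: "0 = a p * \<alpha> p + b p * k p" using ww mult_right_cancel by blast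
  have "a p * 1 = a p * (a p * k p - b p * \<alpha> p) + b p * (a p * \<alpha> p + b p * k p)"
    by (simp add: 1[symmetric] 2[symmetric])
  then show "a p = (s p)\<^sup>2 * k p"
    unfolding a_b_square[symmetric] by (simp add: algebra_simps power2_eq_square)
  have "b p * 1 = b p * (a p * k p - b p * \<alpha> p) - a p * (a p * \<alpha> p + b p * k p)"
    by (simp add: 1[symmetric] 2[symmetric])
  then show "b p = - (s p)\<^sup>2 * \<alpha> p"
    unfolding a_b_square[symmetric] by (simp add: algebra_simps power2_eq_square)
qed

lemma l_eq: "l p = c * (2 * real CARD('n) - 1) * s p - (2 * real CARD('n) - 2) * a p / (s p)\<^sup>2"
proof -
  have "(2 * real CARD('n) - 2) * k p = c * (2 * real CARD('n) - 1) * s p - l p"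
    using card_pos by (simp add: k_def \<gamma>_def right_diff_distrib)
  moreover have "a p / (s p)\<^sup>2 = k p" using k_eq s_pos[OF p(1)] by simp
  ultimately show ?thesis by (metis add_diff_cancel_left' diff_add_cancel times_divide_eq_right)
qed

lemma hder_E:
  assumes w: "E p w"
  shows "hder a p w = 0" "hder b p w = 0" "hder s p w = 0" "hder t p w = 0"
proof -
  note d = diff[OF p(1)]
  have z: "zpart p \<bullet> w = 0" "zpart p \<bullet> hJ w = 0"
    using arg_cong[OF z_eq, of "\<lambda>x. x \<bullet> w"] arg_cong[OF z_eq, of "\<lambda>x. x \<bullet> hJ w"]
    by (simp_all add: inner_simps E_inner[OF p w])
  show "hder a p w = 0" "hder b p w = 0"
    unfolding a_def[abs_def] b_def[abs_def]
    by (simp_all add: hder_rules diff_rules d G_E[OF p w] E_inner[OF p w] inner_simps z hJ_simps)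
  show "hder s p w = 0" "hder t p w = 0" by (simp_all add: hder_s hder_t p z)
qed

text \<open>By \<open>l_eq\<close> the right-hand sides depend on a, b and s alone, which makes the
  system closed.\<close>

lemma hder_eta_ab:
  "hder a p (\<eta> p) = - l p * b p" "hder b p (\<eta> p) = l p * a p - 1"
  "hder s p (\<eta> p) = - b p / s p" "hder t p (\<eta> p) = - 2 * a p"
proof -
  note d = diff[OF p(1)]
  have z: "zpart p \<bullet> \<eta> p = - b p" by (simp add: \<eta>_def b_def)
  have z': "zpart p \<bullet> hJ (\<eta> p) = a p" by (simp add: \<eta>_def a_def hJ_simps)
  have e: "\<eta> p \<bullet> G p = 0" "\<eta> p \<bullet> hJ (G p) = -1"
    by (simp_all add: \<eta>_def G_unit[OF p])
  show "hder a p (\<eta> p) = - l p * b p" "hder b p (\<eta> p) = l p * a p - 1"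
    unfolding a_def[abs_def] b_def[abs_def]
    by (simp_all add: hder_rules diff_rules d G_eta[OF p] inner_simps z z' e hJ_simps)
       (simp_all add: a_def b_def)
  show "hder s p (\<eta> p) = - b p / s p" "hder t p (\<eta> p) = - 2 * a p"
    by (simp_all add: hder_s hder_t p z z')
qed

end

text \<open>E' and \<open>\<eta>\<close> span the horizontal tangent directions. The missing one is
  reached through the bracket of \<open>P w\<close> and \<open>P (hJ w)\<close>: as f is constant
  along both, it yields \<open>\<alpha>\<close> N f = 2 T f, and every tangent vector is a
  horizontal tangent vector plus a multiple of \<open>\<alpha>\<close> N - 2 T.\<close>

lemma tangential_derivative_zero:
  fixes f :: "'n heis \<Rightarrow> real"
  assumes f: "smooth U f"
    and fE: "\<And>q w. q \<in> U \<Longrightarrow> F q = 0 \<Longrightarrow> E q w \<Longrightarrow> hder f q w = 0"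
    and f\<eta>: "\<And>q. q \<in> U \<Longrightarrow> F q = 0 \<Longrightarrow> hder f q (\<eta> q) = 0"
    and p: "p \<in> U" "F p = 0" and v: "D F p v = 0"
  shows "D f p v = 0"
proof -
  note d = diff[OF p(1)]
  have df: "f differentiable (at p)" using f p smooth_differentiable by blast
  obtain w where w0: "w \<noteq> 0" and w: "E p w"
    using E_nontrivial[OF p] by blast
  have w': "E p (hJ w)" by (rule E_hJ[OF p w])
  have Pw: "P w p = w" "P (hJ w) p = hJ w" by (rule P_eq[OF p w], rule P_eq[OF p w'])
  have 0: "hder (\<lambda>q. hder f q (P u q)) p u' = hder (\<lambda>q. 0 :: real) p u'" if "E p u'" for u u'
    by (rule hder_tangential_eq[OF p])
       (use that in \<open>simp_all add: E_def fE[OF _ _ P_E] diff_hder f smooth_P p\<close>)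
  have fJ: "hder f p (hJ (G p)) = 0"
    using f\<eta>[OF p] hder_simps(4)[OF df, of "\<eta> p"] by (simp add: \<eta>_def)
  have "0 = hder f p (hder (P (hJ w)) p w - hder (P w) p (hJ w)) + (4 * (hJ w \<bullet> hJ w)) *\<^sub>R D f p vert"
    using horizontal_commutator[OF open_U smooth_Cn[OF f] p(1) d(8)[of w] d(8)[of "hJ w"]] 0[OF w] 0[OF w']
    by (simp add: Pw hder_const)
  then have "(2 * (w \<bullet> w)) * (\<alpha> p * hder f p (G p)) = (2 * (w \<bullet> w)) * (2 * D f p vert)"
    unfolding hder_P_hJ[OF p w] by (simp add: hder_simps df fJ hJ_inner(1) algebra_simps)
  then have T: "\<alpha> p * hder f p (G p) = 2 * D f p vert" using w0 by simp
  define u where "u = zpart v"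
  have "u = P u p + (u \<bullet> G p) *\<^sub>R G p + (u \<bullet> hJ (G p)) *\<^sub>R hJ (G p)"
    by (simp add: P_def)
  then have "hder f p u = hder f p (P u p + (u \<bullet> G p) *\<^sub>R G p + (u \<bullet> hJ (G p)) *\<^sub>R hJ (G p))"
    by simp
  then have fu: "hder f p u = (u \<bullet> G p) * hder f p (G p)"
    by (simp add: hder_simps df fJ fE p P_E)
  have "2 * (u \<bullet> G p) + T_coeff p v * \<alpha> p = 2 * D F p v"
    unfolding D_decomposition[OF d(1), of v]
    by (simp add: hder_eq_hgrad d u_def \<alpha>_def inner_commute)
  then have "2 * (u \<bullet> G p) = - T_coeff p v * \<alpha> p" using v by simp
  moreover have "2 * D f p v = 2 * (u \<bullet> G p) * hder f p (G p) + T_coeff p v * (2 * D f p vert)"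
    unfolding D_decomposition[OF df, of v] u_def[symmetric] fu by simp
  ultimately show ?thesis by (simp add: T[symmetric])
qed

lemma locally_constant:
  fixes f :: "'n heis \<Rightarrow> real"
  assumes f: "smooth U f"
    and fE: "\<And>q w. q \<in> U \<Longrightarrow> F q = 0 \<Longrightarrow> E q w \<Longrightarrow> hder f q w = 0"
    and f\<eta>: "\<And>q. q \<in> U \<Longrightarrow> F q = 0 \<Longrightarrow> hder f q (\<eta> q) = 0"
    and p: "p \<in> U" "F p = 0"
  obtains W where "open W" "p \<in> W" "W \<subseteq> U" "\<And>q. q \<in> W \<Longrightarrow> F q = 0 \<Longrightarrow> f q = f p"
  by (rule level_set_locally_constant[OF open_U smooth_Cn[OF smooth_F] p D_F_nonzero[OF p]])
    (use that tangential_derivative_zero[OF f fE f\<eta>] smooth_differentiable[OF f] in blast)+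

end

lemma hder_compose_real:
  fixes f :: "'n::finite heis \<Rightarrow> real"
  assumes "(h has_field_derivative h') (at (f p))" "f differentiable (at p)"
  shows "hder (\<lambda>q. h (f q)) p u = h' * hder f p u"
    and "(\<lambda>q. h (f q)) differentiable (at p)"
proof -
  have "((\<lambda>q. h (f q)) has_derivative (\<lambda>v. h' * D f p v)) (at p)"
    using has_derivative_compose[OF D_works[OF assms(2)], of h "\<lambda>r. h' * r"] assms(1)
    by (simp add: has_field_derivative_def)
  then show "hder (\<lambda>q. h (f q)) p u = h' * hder f p u"
    "(\<lambda>q. h (f q)) differentiable (at p)"
    by (auto simp: hder_def D_eqI differentiable_def)
qed

section \<open>First integrals of the system and the height function\<close>

context umbilic_patch
begin

definition C :: real where "C = c * (2 * real CARD('n) - 1) / (2 * real CARD('n) + 1)"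

text \<open>Along \<open>\<eta>\<close> the equations a' = - l b and s' = - b / s give da/ds = l s =
  (2 n + 1) C s^2 - (2 n - 2) a / s. This linear equation has the integrating factor s^(2 n - 2),
  and K is its constant of integration.\<close>

definition K :: "'n heis \<Rightarrow> real" where
  "K q = (a q - C * (s q)^3) * (s q)^(2 * CARD('n) - 2)"

lemma C_nonzero: "C \<noteq> 0"
  using c0 card by (simp add: C_def)

lemma smooth_K: "smooth U K"
  unfolding K_def[abs_def]
  by (intro smooth_mult smooth_diff smooth_power smooth_const smooth_ab smooth_s open_U)

lemma hder_K:
  assumes p: "p \<in> U" "F p = 0"
  shows "hder K p u = ((hder a p u - 3 * C * (s p)\<^sup>2 * hder s p u) * s p
    + (2 * real CARD('n) - 2) * (a p - C * (s p)^3) * hder s p u) * (s p)^(2 * CARD('n) - 3)"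
proof -
  note d = diff[OF p(1)] diff_abt[OF p(1)]
  have pow: "hder (\<lambda>q. (s q)^m) p u = (real m * (s p)^(m - 1)) * hder s p u"
    "(\<lambda>q. (s q)^m) differentiable (at p)" for m
    using hder_compose_real[where h = "\<lambda>x. x^m" and f = s and p = p and h' = "real m * (s p)^(m - 1)"] d
    by (auto intro!: derivative_eq_intros)
  \<comment> \<open>Writing the exponent 2 n - 2 as \<open>Suc j\<close> keeps subtraction of
    natural numbers out of the power rule; n >= 2 makes this exact.\<close>
  define j where "j = 2 * CARD('n) - 3"
  have e: "2 * CARD('n) - 2 = Suc j" "2 * real CARD('n) - 2 = real (Suc j)"
    using card by (auto simp: j_def of_nat_diff)
  show ?thesis
    unfolding K_def[abs_def] e j_def[symmetric]
    by (simp add: hder_rules diff_rules d pow del: power_Suc of_nat_Suc) (simp add: algebra_simps power2_eq_square)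
qed

lemma K_locally_constant:
  assumes p: "p \<in> U" "F p = 0"
  obtains W where "open W" "p \<in> W" "W \<subseteq> U" "\<And>q. q \<in> W \<Longrightarrow> F q = 0 \<Longrightarrow> K q = K p"
proof (rule locally_constant[OF smooth_K _ _ p])
  fix q assume q: "q \<in> U" "F q = 0"
  show "hder K q w = 0" if "E q w" for w by (simp add: hder_K q hder_E that)
  have sp: "s q > 0" by (rule s_pos[OF q(1)])
  have "c * (2 * real CARD('n) - 1) = (2 * real CARD('n) + 1) * C" by (simp add: C_def)
  then have "(- l q * b q - 3 * C * (s q)\<^sup>2 * (- b q / s q)) * s q
      + (2 * real CARD('n) - 2) * (a q - C * (s q)^3) * (- b q / s q) = 0"
    using sp unfolding l_eq[OF q] by (simp add: field_simps power2_eq_square power3_eq_cube)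
  then show "hder K q (\<eta> q) = 0"
    unfolding hder_K[OF q] hder_eta_ab[OF q] by simp
qed (use that in blast)

lemma smooth_b_s: "smooth U (\<lambda>q. b q / s q)"
  using s_pos less_imp_neq[OF s_pos] by (intro smooth_divide smooth_ab smooth_s open_U) auto

lemma hder_b_s:
  assumes p: "p \<in> U" "F p = 0"
  shows "hder (\<lambda>q. b q / s q) p u = hder b p u / s p - b p * hder s p u / (s p)\<^sup>2"
    "hder (\<lambda>q. b q / s q) p (\<eta> p)
      = a p * ((2 * real CARD('n) + 1) * C * s p - (2 * real CARD('n) - 1) * a p / (s p)\<^sup>2) / s p"
proof -
  note d = diff[OF p(1)] diff_abt[OF p(1)]
  have sp: "s p > 0" by (rule s_pos[OF p(1)])
  have inv: "((\<lambda>x. inverse x) has_field_derivative - (inverse (s p) ^ 2)) (at (s p))"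
    using sp by (auto intro!: derivative_eq_intros simp: power2_eq_square)
  show eq: "hder (\<lambda>q. b q / s q) p u = hder b p u / s p - b p * hder s p u / (s p)\<^sup>2" for u
    unfolding divide_inverse
    by (simp add: hder_mult d hder_compose_real[where f = s, OF inv]) (simp add: field_simps power2_eq_square)
  \<comment> \<open>Eliminating b^2 cancels the terms 1 / s, after which a can be factored
    out.\<close>
  have bb: "(b p)\<^sup>2 = (s p)\<^sup>2 - (a p)\<^sup>2" using a_b_square[OF p] by simp
  have "hder (\<lambda>q. b q / s q) p (\<eta> p) = (l p * a p - 1) / s p + (b p)\<^sup>2 / (s p)^3"
    unfolding eq hder_eta_ab[OF p] by (simp add: power2_eq_square power3_eq_cube)
  also have "c * (2 * real CARD('n) - 1) = (2 * real CARD('n) + 1) * C" by (simp add: C_def)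
  then have "(l p * a p - 1) / s p + (b p)\<^sup>2 / (s p)^3
      = a p * ((2 * real CARD('n) + 1) * C * s p - (2 * real CARD('n) - 1) * a p / (s p)\<^sup>2) / s p"
    unfolding l_eq[OF p] bb using sp by (simp add: field_simps power2_eq_square power3_eq_cube)
  finally show "hder (\<lambda>q. b q / s q) p (\<eta> p)
      = a p * ((2 * real CARD('n) + 1) * C * s p - (2 * real CARD('n) - 1) * a p / (s p)\<^sup>2) / s p" .
qed

text \<open>K = 0 means a = C s^3. Then b / s has derivative 2 C a along \<open>\<eta>\<close>,
  which after division by C cancels the derivative - 2 a of t.\<close>

lemma center_locally_constant:
  assumes K: "\<And>q. q \<in> U \<Longrightarrow> F q = 0 \<Longrightarrow> K q = 0" and p: "p \<in> U" "F p = 0"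
  obtains W where "open W" "p \<in> W" "W \<subseteq> U"
    "\<And>q. q \<in> W \<Longrightarrow> F q = 0 \<Longrightarrow> t q + inverse C * (b q / s q) = t p + inverse C * (b p / s p)"
proof (rule locally_constant[where f = "\<lambda>q. t q + inverse C * (b q / s q)", OF _ _ _ p])
  show "smooth U (\<lambda>q. t q + inverse C * (b q / s q))"
    by (intro smooth_add smooth_mult smooth_const smooth_t smooth_b_s open_U)
  fix q assume q: "q \<in> U" "F q = 0"
  have der: "hder (\<lambda>q. t q + inverse C * (b q / s q)) q u = hder t q u + inverse C * hder (\<lambda>q. b q / s q) q u" for u
    by (simp only: hder_add hder_mult hder_const diff_rules diff_abt[OF q(1)]
        smooth_differentiable[OF smooth_b_s q(1)] mult_zero_left add_0_right)
  show "hder (\<lambda>q. t q + inverse C * (b q / s q)) q w = 0" if "E q w" for w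
    unfolding der hder_b_s(1)[OF q] by (simp add: q hder_E that)
  have sp: "s q > 0" by (rule s_pos[OF q(1)])
  have "a q / (s q)\<^sup>2 = C * s q"
    using K[OF q] sp by (simp add: K_def power2_eq_square power3_eq_cube)
  then have "hder (\<lambda>q. b q / s q) q (\<eta> q) = a q * (2 * C * s q) / s q"
    unfolding hder_b_s(2)[OF q] times_divide_eq_right[symmetric] by (simp add: algebra_simps)
  then show "hder (\<lambda>q. t q + inverse C * (b q / s q)) q (\<eta> q) = 0"
    unfolding der hder_eta_ab(4)[OF q] using C_nonzero sp by simp
qed (use that in blast)

lemma tangential_max:
  fixes f :: "'n heis \<Rightarrow> real"
  assumes p: "p \<in> U" "F p = 0" and v: "v \<bullet> G p = 0" and d: "f differentiable (at p)"
    and max: "\<And>q. q \<in> U \<Longrightarrow> F q = 0 \<Longrightarrow> f q \<le> f p"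
  shows "hder f p v = 0"
proof -
  have "D F p (lift p v) = 0"
    using hder_eq_hgrad[OF diff(1)[OF p(1)], of v] v by (simp add: hder_def inner_commute)
  then obtain g \<epsilon> where g: "\<epsilon> > 0" "g 0 = p" "\<And>s. \<bar>s\<bar> < \<epsilon> \<Longrightarrow> g s \<in> U \<and> F (g s) = 0"
    "(g has_vector_derivative lift p v) (at 0)"
    using level_set_curve[OF open_U smooth_Cn[OF smooth_F] p D_F_nonzero[OF p]] by metis
  have "((\<lambda>s. f (g s)) has_derivative (\<lambda>r. D f p (r *\<^sub>R lift p v))) (at 0)"
    by (rule has_derivative_compose[where f = g and g = f])
       (use g d in \<open>auto simp: has_vector_derivative_def intro: D_works\<close>)
  then have "DERIV (\<lambda>s. f (g s)) 0 :> hder f p v"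
    unfolding has_field_derivative_def hder_def
    by (rule has_derivative_eq_rhs) (simp add: fun_eq_iff linear_cmul[OF D_linear[OF d]])
  then show ?thesis by (rule DERIV_local_max[OF _ g(1)]) (use g max in auto)
qed

text \<open>
  With \<mu> = 2 / ((2 n + 1) C) the derivative of t + \<mu> b / s along \<eta> is - (2 n - 1) \<mu> a^2 / s^3.
  A small multiple of b, whose derivative is l a - 1, makes it nonzero also where a = 0.
\<close>

definition height :: "real \<Rightarrow> 'n heis \<Rightarrow> real" where
  "height \<epsilon> q = t q + 2 / ((2 * real CARD('n) + 1) * C) * (b q / s q) + sgn C * \<epsilon> * b q"

text \<open>At a maximum the derivative along \<open>\<eta>\<close> vanishes, that is
  (\<open>\<mu>\<close> / L^2) (l a - 1) = X a^2 / s^3 with the X of the proof. Since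
  \<open>\<mu>\<close> bounds X / s^3 from below and L bounds |l|, the number x = L |a| satisfies
  x^2 <= x - 1, which is impossible. This \<open>\<mu>\<close> is not the coefficient of that name
  in the description of \<open>height\<close>.\<close>

lemma no_height_maximum:
  assumes p: "p \<in> U" "F p = 0" and s01: "0 < s\<^sub>0" "s\<^sub>0 \<le> s p" "s p \<le> s\<^sub>1"
    and \<mu>_def: "\<mu> = 2 * (2 * real CARD('n) - 1) / ((2 * real CARD('n) + 1) * \<bar>C\<bar>) / s\<^sub>1^3"
    and L_def: "L = 1 + \<bar>c\<bar> * (2 * real CARD('n) - 1) * s\<^sub>1 + (2 * real CARD('n) - 2) / s\<^sub>0"
    and max: "\<And>q. q \<in> U \<Longrightarrow> F q = 0 \<Longrightarrow> height (\<mu> / L\<^sup>2) q \<le> height (\<mu> / L\<^sup>2) p"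
  shows False
proof -
  define N where "N = real CARD('n)"
  have N: "N \<ge> 2" using card by (simp add: N_def)
  have sp: "s p > 0" "s\<^sub>1 > 0" using s01 by linarith+
  have L: "L \<ge> 1" using N s01 sp by (simp add: L_def N_def[symmetric])
  have \<mu>: "\<mu> > 0" using N sp C_nonzero by (simp add: \<mu>_def N_def[symmetric])
  define X where "X = 2 * (2 * N - 1) / ((2 * N + 1) * \<bar>C\<bar>)"
  have X: "X > 0" using N C_nonzero by (simp add: X_def)
  note d = diff_abt[OF p(1)] smooth_differentiable[OF smooth_b_s p(1)]
  have h0: "hder (height (\<mu> / L\<^sup>2)) p (\<eta> p) = 0"
  proof (rule tangential_max[where f = "height (\<mu> / L\<^sup>2)", OF p _ _ max])
    show "height (\<mu> / L\<^sup>2) differentiable (at p)"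
      unfolding height_def[abs_def] by (intro diff_rules d)
  qed (simp add: \<eta>_def G_unit[OF p])
  have h1: "hder (height (\<mu> / L\<^sup>2)) p (\<eta> p) = - 2 * a p
      + 2 / ((2 * N + 1) * C) * (a p * ((2 * N + 1) * C * s p - (2 * N - 1) * a p / (s p)\<^sup>2) / s p)
      + sgn C * (\<mu> / L\<^sup>2) * (l p * a p - 1)"
    by (simp only: height_def[abs_def] hder_add hder_mult hder_const diff_rules d hder_b_s(2)[OF p]
        hder_eta_ab[OF p] N_def mult_zero_left add_0_right)
  have h2: "2 / ((2 * N + 1) * C) * (a p * ((2 * N + 1) * C * s p - (2 * N - 1) * a p / (s p)\<^sup>2) / s p)
      = 2 * a p - sgn C * (X / (s p)^3 * (a p)\<^sup>2)"
  proof -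
    have "sgn C * X = 2 * (2 * N - 1) / ((2 * N + 1) * C)"
    proof -
      have "sgn C * (y / \<bar>C\<bar>) = y / C" for y by (simp add: sgn_if)
      from this[of "2 * (2 * N - 1) / (2 * N + 1)"] show ?thesis
        by (simp add: X_def)
    qed
    moreover have "2 / d * (a p * (d * s p - m * a p / (s p)\<^sup>2) / s p) = 2 * a p - 2 * m / d * ((a p)\<^sup>2 / (s p)^3)"
      if "d \<noteq> 0" for d m
      using sp that by (simp add: field_simps power2_eq_square power3_eq_cube)
    from this[of "(2 * N + 1) * C" "2 * N - 1"] have "2 / ((2 * N + 1) * C) *
        (a p * ((2 * N + 1) * C * s p - (2 * N - 1) * a p / (s p)\<^sup>2) / s p)
      = 2 * a p - 2 * (2 * N - 1) / ((2 * N + 1) * C) * ((a p)\<^sup>2 / (s p)^3)"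
      using N C_nonzero by simp
    ultimately show ?thesis by (simp add: mult.assoc[symmetric])
  qed
  have "sgn C * (\<mu> / L\<^sup>2 * (l p * a p - 1) - X / (s p)^3 * (a p)\<^sup>2) = 0"
    using h0[unfolded h1, unfolded h2] by (simp only: right_diff_distrib[of "sgn C"] mult.assoc)
  then have "\<mu> / L\<^sup>2 * (l p * a p - 1) = X / (s p)^3 * (a p)\<^sup>2"
    using C_nonzero by (simp add: sgn_if split: if_splits)
  moreover have "\<mu> * (a p)\<^sup>2 \<le> X / (s p)^3 * (a p)\<^sup>2"
  proof (rule mult_right_mono)
    have "\<mu> = X / s\<^sub>1^3" by (simp add: \<mu>_def X_def N_def)
    then show "\<mu> \<le> X / (s p)^3" using X sp s01 by (simp add: divide_left_mono power_mono)
  qed simp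
  ultimately have 1: "\<mu> * (a p)\<^sup>2 \<le> \<mu> * ((l p * a p - 1) / L\<^sup>2)" by simp
  have "(a p)\<^sup>2 \<le> (s p)\<^sup>2"
    using a_b_square[OF p] zero_le_power2[of "b p"] by linarith
  then have as: "\<bar>a p\<bar> \<le> s p" using sp by (simp add: abs_le_square_iff[symmetric])
  have lL: "\<bar>l p\<bar> \<le> L"
  proof -
    have "\<bar>l p\<bar> \<le> \<bar>c * (2 * N - 1) * s p\<bar> + \<bar>(2 * N - 2) * a p / (s p)\<^sup>2\<bar>"
      unfolding l_eq[OF p] N_def by (rule abs_triangle_ineq4)
    also have "\<bar>c * (2 * N - 1) * s p\<bar> \<le> \<bar>c\<bar> * (2 * N - 1) * s\<^sub>1"
      using N s01 sp by (simp add: abs_mult mult_left_mono)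
    also have "\<bar>(2 * N - 2) * a p / (s p)\<^sup>2\<bar> \<le> (2 * N - 2) * s p / (s p)\<^sup>2"
      using N as by (simp add: abs_mult divide_right_mono mult_left_mono)
    also have "(2 * N - 2) * s p / (s p)\<^sup>2 \<le> (2 * N - 2) / s\<^sub>0"
      using N s01 sp by (simp add: power2_eq_square divide_left_mono)
    finally show ?thesis by (simp add: L_def N_def)
  qed
  have "l p * a p \<le> L * \<bar>a p\<bar>"
    using mult_right_mono[OF lL abs_ge_zero[of "a p"]] abs_ge_self[of "l p * a p"] by (simp add: abs_mult)
  then have "(l p * a p - 1) / L\<^sup>2 \<le> (L * \<bar>a p\<bar> - 1) / L\<^sup>2"
    by (intro divide_right_mono) auto
  moreover have "(a p)\<^sup>2 \<le> (l p * a p - 1) / L\<^sup>2"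
    using 1 \<mu> by (simp only: mult_le_cancel_left_pos)
  ultimately have "\<bar>a p\<bar>\<^sup>2 \<le> (L * \<bar>a p\<bar> - 1) / L\<^sup>2" by simp
  then have "(L * \<bar>a p\<bar>)\<^sup>2 \<le> L * \<bar>a p\<bar> - 1"
    using L by (simp add: field_simps power_mult_distrib)
  moreover have "(L * \<bar>a p\<bar> - 1 / 2)\<^sup>2 \<ge> 0" by simp
  ultimately show False
    by (simp add: power2_diff power_divide)
qed

end

section \<open>Geometry of hypersurfaces\<close>

lemma D_hgrad:
  assumes "F differentiable (at p)"
  shows "D F p v = hgrad F p \<bullet> zpart v + T_coeff p v * D F p vert"
  using D_decomposition[OF assms, of v] hder_eq_hgrad[OF assms] by simp

text \<open>Composition with a curve in M turns derivatives within M into ordinary ones at 0. Hence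
  \<open>covariant_derivative\<close> on tangent vectors does not depend on the choice hidden in
  \<open>frechet_derivative\<close>.\<close>

lemma derivative_within_tangent_unique:
  fixes f :: "'n::finite heis \<Rightarrow> 'b::real_normed_vector"
  assumes v: "v \<in> tangent_space M p" and A: "(f has_derivative A) (at p within M)"
    and B: "(f has_derivative B) (at p within M)"
  shows "A v = B v"
proof -
  obtain g \<epsilon> where g: "\<epsilon> > 0" "g 0 = p" "\<And>s. \<bar>s\<bar> < \<epsilon> \<Longrightarrow> g s \<in> M" "(g has_vector_derivative v) (at (0::real))"
    using v unfolding tangent_space_def by blast
  have im: "g ` ball 0 \<epsilon> \<subseteq> M" using g by auto
  have der: "((\<lambda>s. f (g s)) has_derivative (\<lambda>r. L (r *\<^sub>R v))) (at 0)"
    if "(f has_derivative L) (at p within M)" for L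
  proof -
    have "(g has_derivative (\<lambda>r. r *\<^sub>R v)) (at 0 within ball 0 \<epsilon>)"
      using g(4) by (auto simp: has_vector_derivative_def intro: has_derivative_at_withinI)
    moreover have "(f has_derivative L) (at (g 0) within g ` ball 0 \<epsilon>)"
      using has_derivative_subset[OF that im] g(2) by simp
    ultimately have "((\<lambda>s. f (g s)) has_derivative (\<lambda>r. L (r *\<^sub>R v))) (at 0 within ball 0 \<epsilon>)"
      by (rule has_derivative_in_compose)
    then show ?thesis using g(1) by (simp add: at_within_open[of _ "ball 0 \<epsilon>"])
  qed
  show ?thesis using has_derivative_unique[OF der[OF A] der[OF B]] by (metis scaleR_one)
qed

context
  fixes M U :: "'n::finite heis set" and F :: "'n heis \<Rightarrow> real" and p :: "'n heis"
  assumes U: "open U" "p \<in> U" "Cn 1 U F" and M: "M \<inter> U = {q\<in>U. F q = 0}" and p: "p \<in> M"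
    and nz: "D F p \<noteq> (\<lambda>_. 0)"
begin

lemma level_set_differentiable: "F differentiable (at p)"
  using U by simp

lemma tangent_space_level_set: "tangent_space M p = {v. D F p v = 0}"
proof
  note dF = level_set_differentiable
  have Fp: "F p = 0" using M U p by blast
  \<comment> \<open>F vanishes on M near p, so both \<open>D F p\<close> and 0 are derivatives of
    the zero function within M; on tangent vectors they must agree.\<close>
  have "((\<lambda>q. 0) has_derivative D F p) (at p within M)"
  proof -
    obtain e where e: "e > 0" "ball p e \<subseteq> U"
      using U openE by blast
    show ?thesis
    proof (rule has_derivative_transform_within[OF has_derivative_at_withinI[OF D_works[OF dF]] e(1) p])
      fix q assume "q \<in> M" "dist q p < e"
      then have "q \<in> M \<inter> U" using e by (auto simp: dist_commute)
      then show "F q = 0" using M by blast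
    qed
  qed
  from derivative_within_tangent_unique[OF _ this has_derivative_const]
  show "tangent_space M p \<subseteq> {v. D F p v = 0}" by blast
  show "{v. D F p v = 0} \<subseteq> tangent_space M p"
  proof
    fix v assume "v \<in> {v. D F p v = 0}"
    then obtain g \<epsilon> where g: "\<epsilon> > 0" "g 0 = p" "\<And>s. \<bar>s\<bar> < \<epsilon> \<Longrightarrow> g s \<in> U \<and> F (g s) = 0"
      "(g has_vector_derivative v) (at (0::real))"
      using level_set_curve[OF U(1,3,2) Fp nz, of v] by blast
    then have "\<forall>s. \<bar>s\<bar> < \<epsilon> \<longrightarrow> g s \<in> M"
      using M by blast
    then show "v \<in> tangent_space M p"
      unfolding tangent_space_def using g by blast
  qed
qed

lemma characteristic_level_set: "p \<in> characteristic_set M \<longleftrightarrow> hgrad F p = 0"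
proof -
  note dF = level_set_differentiable
  note ts = tangent_space_level_set
  show ?thesis
  proof
    assume "p \<in> characteristic_set M"
    then have "D F p (lift p (hgrad F p)) = 0"
      using ts by (auto simp: characteristic_set_def horizontal_space_eq)
    then show "hgrad F p = 0"
      using D_hgrad[OF dF, of "lift p (hgrad F p)"] by (simp add: zpart_simps T_coeff_simps)
  next
    assume h: "hgrad F p = 0"
    then have V: "D F p v = T_coeff p v * D F p vert" for v using D_hgrad[OF dF, of v] by simp
    have "D F p vert \<noteq> 0"
    proof
      assume "D F p vert = 0"
      then have "D F p v = 0" for v using V[of v] by simp
      then show False
        using nz by blast
    qed
    then have "D F p v = 0 \<longleftrightarrow> T_coeff p v = 0" for v using V[of v] by simp
    moreover have "T_coeff p v = 0 \<longleftrightarrow> v \<in> range (lift p)" for v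
      using lift_decomposition[of v p] by (auto simp: T_coeff_simps)
    ultimately show "p \<in> characteristic_set M"
      using ts p by (auto simp: characteristic_set_def horizontal_space_eq)
  qed
qed

lemma unit_normal_level_set:
  assumes \<nu>: "unit_normal_field M \<nu>"
  obtains r where "r \<noteq> 0" "zpart (\<nu> p) = r *\<^sub>R hgrad F p" "T_coeff p (\<nu> p) = r * D F p vert"
proof -
  note dF = level_set_differentiable
  define h V nh n0 where "h = hgrad F p" and "V = D F p vert" and "nh = zpart (\<nu> p)" and "n0 = T_coeff p (\<nu> p)"
  have DF: "D F p v = h \<bullet> zpart v + T_coeff p v * V" for v
    unfolding h_def V_def by (rule D_hgrad[OF dF])
  have orth: "nh \<bullet> zpart v + n0 * T_coeff p v = 0" if "h \<bullet> zpart v + T_coeff p v * V = 0" for v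
    using \<nu> p tangent_space_level_set that
    by (auto simp: unit_normal_field_def heis_metric_eq nh_def n0_def DF)
  have "h \<bullet> h + V * V \<noteq> 0"
  proof
    assume "h \<bullet> h + V * V = 0"
    then have "h \<bullet> h = 0" "V * V = 0"
      using inner_ge_zero[of h] zero_le_square[of V] by linarith+
    then show False
      using nz DF by auto
  qed
  \<comment> \<open>The coefficient of the orthogonal projection of the normal to the Riemannian
    gradient (h, V). The remainder (w, v0) is orthogonal to the gradient, hence tangent, hence
    orthogonal to the normal too, and so to itself.\<close>
  define r where "r = (nh \<bullet> h + n0 * V) / (h \<bullet> h + V * V)"
  have r: "r * (h \<bullet> h + V * V) = nh \<bullet> h + n0 * V"
    using \<open>_ \<noteq> 0\<close> by (simp add: r_def)
  define w v0 where "w = nh - r *\<^sub>R h" and "v0 = n0 - r * V"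
  have t: "h \<bullet> w + v0 * V = 0"
    using r by (simp add: w_def v0_def inner_simps inner_commute algebra_simps)
  have "nh \<bullet> w + n0 * v0 = 0"
    using orth[of "lift p w + v0 *\<^sub>R vert"] t by (simp add: zpart_simps T_coeff_simps)
  moreover have "nh \<bullet> w + n0 * v0 = w \<bullet> w + v0 * v0 + r * (h \<bullet> w + v0 * V)"
    by (simp add: w_def v0_def inner_simps inner_commute algebra_simps)
  ultimately have "w \<bullet> w + v0 * v0 = 0" using t by simp
  then have "w \<bullet> w = 0" "v0 * v0 = 0"
    using inner_ge_zero[of w] zero_le_square[of v0] by linarith+
  then have eq: "nh = r *\<^sub>R h" "n0 = r * V" by (simp_all add: w_def v0_def)
  have "r \<noteq> 0"
  proof
    assume "r = 0"
    then have "heis_metric p (\<nu> p) (\<nu> p) = 0"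
      using eq by (simp add: heis_metric_eq nh_def n0_def)
    then show False
      using \<nu> p by (auto simp: unit_normal_field_def heis_norm_def)
  qed
  then show thesis
    using that eq by (simp add: nh_def n0_def h_def V_def)
qed

end

section \<open>Horizontal curvature in frame coefficients\<close>

definition hnormal :: "('n::finite heis \<Rightarrow> 'n heis) \<Rightarrow> 'n heis \<Rightarrow> 'n hor" where
  "hnormal \<nu> q = (1 / norm (zpart (\<nu> q))) *\<^sub>R zpart (\<nu> q)"

lemma horizontal_normal_eq: "horizontal_normal \<nu> q = lift q (hnormal \<nu> q)"
  by (simp add: horizontal_normal_def horizontal_proj_eq heis_norm_lift hnormal_def lift_simps)

lemma eta_field_eq: "eta_field \<nu> q = lift q (- hJ (hnormal \<nu> q))"
  by (simp add: eta_field_def horizontal_normal_eq heis_J_eq zpart_simps lift_simps)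

lemma covariant_derivative_horizontal_normal:
  assumes U: "open U" "q \<in> U" "G differentiable (at q)"
    and G: "\<And>q'. q' \<in> M \<inter> U \<Longrightarrow> hnormal \<nu> q' = G q'"
    and q: "q \<in> M" and w: "lift q w \<in> tangent_space M q"
  shows "zpart (covariant_derivative M (horizontal_normal \<nu>) q (lift q w)) = hder G q w"
proof -
  let ?W = "horizontal_normal \<nu>"
  note B = lift_has_derivative[OF D_works[OF U(3)]]
  have BM: "(?W has_derivative (\<lambda>v. lift q (D G q v) + (- 2 * (zpart v \<bullet> hJ (G q))) *\<^sub>R vert)) (at q within M)"
  proof -
    obtain e where e: "e > 0" "ball q e \<subseteq> U"
      using U openE by blast
    show ?thesis
    proof (rule has_derivative_transform_within[OF has_derivative_at_withinI[OF B] e(1) q])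
      fix q' assume "q' \<in> M" "dist q' q < e"
      then have "q' \<in> M \<inter> U" using e by (auto simp: dist_commute)
      then show "lift q' (G q') = ?W q'" using G by (simp add: horizontal_normal_eq)
    qed
  qed
  then have "(?W has_derivative frechet_derivative ?W (at q within M)) (at q within M)"
    using frechet_derivative_works unfolding differentiable_def by blast
  from derivative_within_tangent_unique[OF w this BM]
  have "frechet_derivative ?W (at q within M) (lift q w)
      = lift q (D G q (lift q w)) + (- 2 * (zpart (lift q w) \<bullet> hJ (G q))) *\<^sub>R vert" .
  moreover have "levi_civita_symbol q (lift q w) (?W q) = 0"
    by (simp add: horizontal_normal_eq levi_civita_symbol_lift)
  ultimately show ?thesis by (simp add: covariant_derivative_def zpart_simps hder_def)
qed

text \<open>In frame coefficients B is an orthonormal basis of the hyperplane orthogonal to N. The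
  sum of squares is Parseval's identity; together with the cardinality it evaluates the trace in the
  mean curvature.\<close>

lemma orthonormal_basis_at_hyperplane:
  fixes N :: "'n::finite hor"
  assumes N: "norm N = 1" and V: "V = lift q ` {w. N \<bullet> w = 0}"
    and B: "orthonormal_basis_at q V B" and \<eta>: "N \<bullet> \<eta> = 0" "norm \<eta> = 1"
  shows "card B = 2 * CARD('n) - 1" "(\<Sum>e\<in>B. (\<eta> \<bullet> zpart e)\<^sup>2) = 1" "\<And>e. e \<in> B \<Longrightarrow> norm (zpart e) = 1"
proof -
  have BV: "B \<subseteq> V" and span: "span B = V"
    and orth: "\<And>e f. e \<in> B \<Longrightarrow> f \<in> B \<Longrightarrow> heis_metric q e f = (if e = f then 1 else 0)"
    using B by (auto simp: orthonormal_basis_at_def)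
  have lz: "lift q (zpart e) = e" if "e \<in> B" for e using that BV V by (auto simp: zpart_simps)
  have on: "zpart e \<bullet> zpart f = (if e = f then 1 else 0)" if "e \<in> B" "f \<in> B" for e f
    using orth[OF that] lz that by (metis heis_metric_lift(1))
  have inj: "inj_on zpart B" using lz by (metis inj_onI)
  define B' where "B' = zpart ` B"
  have lin: "linear (zpart :: 'n heis \<Rightarrow> 'n hor)"
    using bounded_linear_zpart linear_conv_bounded_linear by blast
  have span': "span B' = {w. N \<bullet> w = 0}"
    unfolding B'_def span_linear_image[OF lin] span V by (force simp: zpart_simps)
  have unit: "norm e = 1" if "e \<in> B'" for e using on that by (auto simp: B'_def norm_eq_1)
  have po: "pairwise orthogonal B'"
    unfolding pairwise_def orthogonal_def B'_def using on by (auto split: if_splits)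
  have "0 \<notin> B'" using unit[of 0] by auto
  then have ind: "independent B'" using po by (rule pairwise_orthogonal_independent[rotated])
  have "card B' = dim {w. N \<bullet> w = 0}"
    using span' ind by (metis dim_span_eq_card_independent dim_span)
  also have "\<dots> = DIM('n hor) - 1" using N by (intro dim_hyperplane) auto
  finally show "card B = 2 * CARD('n) - 1" using inj by (simp add: B'_def card_image)
  have fin: "finite B'" using ind independent_imp_finite by blast
  have "\<eta> \<in> span B'" using span' \<eta> by simp
  then have "(\<Sum>e\<in>B'. (\<eta> \<bullet> e) *\<^sub>R e) = \<eta>"
    using orthonormal_basis_expand[OF po unit _ fin] by blast
  then have "\<eta> \<bullet> (\<Sum>e\<in>B'. (\<eta> \<bullet> e) *\<^sub>R e) = \<eta> \<bullet> \<eta>"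
    by simp
  then have "(\<Sum>e\<in>B'. (\<eta> \<bullet> e)\<^sup>2) = 1"
    using \<eta>(2) by (simp add: inner_sum_right power2_eq_square norm_eq_1)
  then show "(\<Sum>e\<in>B. (\<eta> \<bullet> zpart e)\<^sup>2) = 1"
    unfolding B'_def using inj by (simp add: sum.reindex)
  show "norm (zpart e) = 1" if "e \<in> B" for e using unit that by (simp add: B'_def)
qed

lemma orthonormal_basis_at_exists:
  fixes N :: "'n::finite hor"
  shows "\<exists>B. orthonormal_basis_at q (lift q ` {w. N \<bullet> w = 0}) B"
proof -
  have "subspace {w. N \<bullet> w = 0}" by (rule subspace_hyperplane)
  then obtain B where B: "B \<subseteq> {w. N \<bullet> w = 0}" "pairwise orthogonal B" "\<And>x. x \<in> B \<Longrightarrow> norm x = 1"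
    "span B = {w. N \<bullet> w = 0}"
    using orthonormal_basis_subspace by metis
  have lin: "linear (lift q)" by (intro linearI) (simp_all add: lift_simps)
  have "heis_metric q e f = (if e = f then 1 else 0)" if ef: "e \<in> lift q ` B" "f \<in> lift q ` B" for e f
  proof -
    obtain u v where uv: "e = lift q u" "f = lift q v" "u \<in> B" "v \<in> B"
      using ef by blast
    then have "e = f \<longleftrightarrow> u = v" by (metis zpart_simps(5))
    then show ?thesis
      using uv B(2,3) by (auto simp: heis_metric_lift zpart_simps pairwise_def orthogonal_def norm_eq_1)
  qed
  then have "orthonormal_basis_at q (lift q ` {w. N \<bullet> w = 0}) (lift q ` B)"
    unfolding orthonormal_basis_at_def span_linear_image[OF lin] using B by auto
  then show ?thesis by blast
qed

text \<open>Solving the definition of the shape operator for the derivative of the normal turns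
  umbilicity into a formula on the hyperplane orthogonal to N. In the trace the terms with J w and N
  drop out, and Parseval leaves (l - k) + (2 n - 1) k.\<close>

lemma umbilic_shape:
  fixes M :: "'n::finite heis set"
  assumes card: "CARD('n) \<ge> 2"
    and U: "open U" "q \<in> U" "G differentiable (at q)"
    and G: "\<And>q'. q' \<in> M \<inter> U \<Longrightarrow> hnormal \<nu> q' = G q'" "norm (G q) = 1"
    and q: "q \<in> M" "q \<notin> characteristic_set M"
    and tan: "\<And>w. lift q w \<in> tangent_space M q \<longleftrightarrow> G q \<bullet> w = 0"
    and umb: "umbilic M \<nu>"
    and \<alpha>: "\<alpha> = 2 * T_coeff q (\<nu> q) / norm (zpart (\<nu> q))"
  shows "\<exists>k l. (\<forall>w. w \<bullet> G q = 0 \<and> w \<bullet> hJ (G q) = 0 \<longrightarrow> hder G q w = k *\<^sub>R w + \<alpha> *\<^sub>R hJ w) \<and>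
      hder G q (- hJ (G q)) = l *\<^sub>R (- hJ (G q)) \<and>
      (2 * real CARD('n) - 2) * k + l = horizontal_mean_curvature M \<nu> q * (2 * real CARD('n) - 1)"
proof -
  define N \<eta> where "N = G q" and "\<eta> = - hJ N"
  have N: "hnormal \<nu> q = N" "norm N = 1" "N \<bullet> N = 1"
    using G q U by (simp_all add: N_def norm_eq_1)
  have \<eta>: "N \<bullet> \<eta> = 0" "norm \<eta> = 1" "\<eta> \<bullet> \<eta> = 1" "hJ \<eta> = N"
    using N by (simp_all add: \<eta>_def hJ_inner hJ_simps norm_hJ)
  have ht: "horizontal_space q \<inter> tangent_space M q = lift q ` {w. N \<bullet> w = 0}"
    using tan by (auto simp: horizontal_space_eq N_def)
  have cov: "zpart (covariant_derivative M (horizontal_normal \<nu>) q (lift q w)) = hder G q w" if "N \<bullet> w = 0" for w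
    using covariant_derivative_horizontal_normal[OF U G(1) q(1), of w] tan that by (simp add: N_def)
  obtain k l where kl: "\<And>Z. Z \<in> horizontal_space q \<inter> tangent_space M q \<Longrightarrow> horizontal_shape_operator M \<nu> q Z =
         ((l - k) * heis_metric q (eta_field \<nu> q) Z) *\<^sub>R eta_field \<nu> q + k *\<^sub>R Z"
    using umb q unfolding umbilic_def by (metis DiffI)
  have shape: "hder G q w = \<alpha> *\<^sub>R (hJ w - (\<eta> \<bullet> w) *\<^sub>R N) + ((l - k) * (\<eta> \<bullet> w)) *\<^sub>R \<eta> + k *\<^sub>R w"
    if w: "N \<bullet> w = 0" for w
  proof -
    have "lift q w \<in> horizontal_space q \<inter> tangent_space M q" using ht w by blast
    then have "zpart (horizontal_shape_operator M \<nu> q (lift q w)) =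
         zpart (((l - k) * heis_metric q (eta_field \<nu> q) (lift q w)) *\<^sub>R eta_field \<nu> q + k *\<^sub>R lift q w)"
      by (simp only: kl)
    then have "hder G q w - \<alpha> *\<^sub>R (hJ w - (\<eta> \<bullet> w) *\<^sub>R N) = ((l - k) * (\<eta> \<bullet> w)) *\<^sub>R \<eta> + k *\<^sub>R w"
      unfolding horizontal_shape_operator_def eta_field_eq horizontal_normal_eq horizontal_proj_eq
        heis_J_eq metric_frame_T heis_norm_lift \<eta>_def[symmetric] N(1) heis_metric_lift \<alpha>
      by (simp add: zpart_simps cov[OF w] horizontal_normal_eq[symmetric])
    then show ?thesis by (simp add: algebra_simps)
  qed
  have "horizontal_mean_curvature M \<nu> q = ((2 * real CARD('n) - 2) * k + l) / (2 * real CARD('n) - 1)"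
    unfolding horizontal_mean_curvature_def ht
  proof (rule the_equality)
    let ?tr = "\<lambda>B. 1 / (2 * real CARD('n) - 1) *
          (\<Sum>e\<in>B. heis_metric q (covariant_derivative M (horizontal_normal \<nu>) q e) e)"
    have tr: "?tr B = ((2 * real CARD('n) - 2) * k + l) / (2 * real CARD('n) - 1)"
      if B: "orthonormal_basis_at q (lift q ` {w. N \<bullet> w = 0}) B" for B
    proof -
      note on = orthonormal_basis_at_hyperplane[OF N(2) refl B \<eta>(1,2)]
      have "heis_metric q (covariant_derivative M (horizontal_normal \<nu>) q e) e
          = (l - k) * (\<eta> \<bullet> zpart e)\<^sup>2 + k" if "e \<in> B" for e
      proof -
        obtain w where w: "e = lift q w" "N \<bullet> w = 0"
          using B \<open>e \<in> B\<close> unfolding orthonormal_basis_at_def by blast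
        have "w \<bullet> w = 1" using on(3)[OF that] by (simp add: w(1) zpart_simps norm_eq_1)
        then show ?thesis
          unfolding w(1) heis_metric_lift cov[OF w(2)] shape[OF w(2)]
          by (simp add: inner_simps hJ_inner w(2) zpart_simps power2_eq_square)
      qed
      then have "(\<Sum>e\<in>B. heis_metric q (covariant_derivative M (horizontal_normal \<nu>) q e) e)
          = (l - k) * 1 + real (card B) * k"
        by (simp add: sum.distrib sum_distrib_left[symmetric] on(2))
      also have "\<dots> = (2 * real CARD('n) - 2) * k + l"
        using card by (simp add: on(1) of_nat_diff algebra_simps)
      finally show ?thesis by simp
    qed
    show "\<forall>B. orthonormal_basis_at q (lift q ` {w. N \<bullet> w = 0}) B \<longrightarrow>
        ((2 * real CARD('n) - 2) * k + l) / (2 * real CARD('n) - 1) = ?tr B"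
      by (intro allI impI) (rule tr[symmetric])
    \<comment> \<open>Uniqueness in the definite description rests on the existence of some
      orthonormal basis; without one every h would qualify.\<close>
    fix h assume h: "\<forall>B. orthonormal_basis_at q (lift q ` {w. N \<bullet> w = 0}) B \<longrightarrow> h = ?tr B"
    obtain B where B: "orthonormal_basis_at q (lift q ` {w. N \<bullet> w = 0}) B"
      using orthonormal_basis_at_exists by blast
    then have "h = ?tr B" using h by blast
    then show "h = ((2 * real CARD('n) - 2) * k + l) / (2 * real CARD('n) - 1)"
      by (simp only: tr[OF B])
  qed
  moreover have "2 * real CARD('n) - 1 \<noteq> 0" using card by linarith
  ultimately have H: "(2 * real CARD('n) - 2) * k + l = horizontal_mean_curvature M \<nu> q * (2 * real CARD('n) - 1)"
    by simp
  have "hder G q w = k *\<^sub>R w + \<alpha> *\<^sub>R hJ w" if "w \<bullet> N = 0" "w \<bullet> hJ N = 0" for w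
    using shape[of w] that by (simp add: \<eta>_def inner_commute)
  moreover have "hder G q \<eta> = l *\<^sub>R \<eta>"
    using shape[OF \<eta>(1)] by (simp add: \<eta> algebra_simps)
  ultimately show ?thesis using H unfolding N_def[symmetric] \<eta>_def[symmetric] by blast
qed

lemma hgrad_nonzero_open:
  assumes U: "open U" "p \<in> U" and F: "Cn (Suc k) U F" and nz: "hgrad F p \<noteq> 0"
  obtains W where "open W" "p \<in> W" "W \<subseteq> U" "\<And>q. q \<in> W \<Longrightarrow> hgrad F q \<noteq> 0"
proof -
  have "continuous_on U (hgrad F)"
    unfolding hgrad_def[abs_def] hder_def
    by (intro continuous_on_sum continuous_on_scaleR continuous_on_const
        Cn_continuous[OF Cn_directional[OF U(1) F smooth_Cn[OF smooth_lift[OF U(1) smooth_const[OF U(1)]]]]])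
  then have "open (U \<inter> hgrad F -` (- {0}))" using U by (intro continuous_open_preimage) auto
  then show thesis
    using that[of "U \<inter> hgrad F -` (- {0})"] U nz by auto
qed

lemma D_nonzero: "F differentiable (at q) \<Longrightarrow> hgrad F q \<noteq> 0 \<Longrightarrow> D F q \<noteq> (\<lambda>_. 0)"
  using hder_eq_hgrad[of F q "hgrad F q"] unfolding hder_def by auto

section \<open>Normalized local equations of an umbilic hypersurface\<close>

locale umbilic_hypersurface =
  fixes M :: "'n::finite heis set" and \<nu> :: "'n heis \<Rightarrow> 'n heis" and c :: real
  assumes card: "CARD('n) \<ge> 2"
    and smooth_M: "smooth_hypersurface M"
    and normal: "unit_normal_field M \<nu>"
    and umb: "umbilic M \<nu>"
    and c0: "c \<noteq> 0"
    and curvature: "\<And>x y t. (x, y, t) \<in> M - characteristic_set M \<Longrightarrow>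
           horizontal_mean_curvature M \<nu> (x, y, t) = c * sqrt ((norm x)\<^sup>2 + (norm y)\<^sup>2)"
begin

abbreviation S :: "'n heis set" where "S \<equiv> characteristic_set M"

lemma norm_zpart: "norm (zpart p) = sqrt ((norm (fst p))\<^sup>2 + (norm (fst (snd p)))\<^sup>2)"
  by (simp add: zpart_def norm_Pair)

lemma curvature': "p \<in> M - S \<Longrightarrow> horizontal_mean_curvature M \<nu> p = c * norm (zpart p)"
  using curvature[of "fst p" "fst (snd p)" "snd (snd p)"] by (simp add: norm_zpart)

lemma local_C2:
  assumes "p \<in> M"
  shows "\<exists>U F. open U \<and> p \<in> U \<and> Cn 2 U F \<and> M \<inter> U = {q\<in>U. F q = 0} \<and>
    (\<forall>q\<in>U. D F q \<noteq> (\<lambda>_. 0 :: real))"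
proof -
  have "hypersurface 2 M" using smooth_M by (simp add: smooth_hypersurface_def)
  then obtain U and F :: "'n heis \<Rightarrow> real" where
    F: "open U" "p \<in> U" "C_on 2 U F" "M \<inter> U = {q\<in>U. F q = 0}" "\<forall>q\<in>U. D F q \<noteq> (\<lambda>_. 0)"
    using assms unfolding hypersurface_def by blast
  have "Cn 2 U F" using F(3) by (simp add: C_on_def C_nat_on_iff_Cn numeral_eq_enat)
  with F show ?thesis
    by (intro exI[of _ U] exI[of _ F] conjI)
qed

text \<open>The smooth charts are charts of M - S only. A C^2 equation of M has a continuous
  horizontal gradient that is not 0 at p, so M has no characteristic points near p and there the
  smooth chart describes M itself.\<close>

lemma local_smooth:
  assumes p: "p \<in> M - S"
  obtains U F where "open U" "p \<in> U" "smooth U F" "M \<inter> U = {q\<in>U. F q = 0}"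
    "\<And>q. q \<in> U \<Longrightarrow> hgrad F q \<noteq> 0" "(M \<inter> U) \<inter> S = {}"
proof -
  have "hypersurface \<infinity> (M - S)" using smooth_M by (simp add: smooth_hypersurface_def)
  then obtain U0 F where F: "open U0" "p \<in> U0" "C_on \<infinity> U0 F"
    "(M - S) \<inter> U0 = {q\<in>U0. F q = 0}" "\<forall>q\<in>U0. D F q \<noteq> (\<lambda>_. 0)"
    using p unfolding hypersurface_def by blast
  have sF: "smooth U0 F" using F smooth_C_on by blast
  obtain U1 and F1 :: "'n heis \<Rightarrow> real" where F1: "open U1" "p \<in> U1" "Cn 2 U1 F1" "M \<inter> U1 = {q\<in>U1. F1 q = 0}"
    "\<forall>q\<in>U1. D F1 q \<noteq> (\<lambda>_. 0)"
    using local_C2[of p] p by blast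
  have C1: "Cn 1 U1 F1" by (rule Cn_le[OF F1(3)]) simp
  have char1: "q \<in> S \<longleftrightarrow> hgrad F1 q = 0" if "q \<in> M" "q \<in> U1" for q
    using characteristic_level_set[OF F1(1) that(2) C1 F1(4) that(1) bspec[OF F1(5) that(2)]] .
  obtain W1 where W1: "open W1" "p \<in> W1" "W1 \<subseteq> U1" "\<And>q. q \<in> W1 \<Longrightarrow> hgrad F1 q \<noteq> 0"
    using hgrad_nonzero_open[OF F1(1,2), of 0 F1] C1 char1[of p] p F1(2) by auto
  have nc: "(M \<inter> W1) \<inter> S = {}" using char1 W1 by blast
  define U2 where "U2 = U0 \<inter> W1"
  have U2: "open U2" "p \<in> U2" "smooth U2 F" "M \<inter> U2 = {q\<in>U2. F q = 0}"
    using F W1 nc smooth_subset[OF sF, of U2] by (auto simp: U2_def)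
  have "hgrad F p \<noteq> 0"
    using characteristic_level_set[OF U2(1,2) smooth_Cn[OF U2(3)] U2(4)] p F U2(2) by auto
  then obtain W where W: "open W" "p \<in> W" "W \<subseteq> U2" "\<And>q. q \<in> W \<Longrightarrow> hgrad F q \<noteq> 0"
    using hgrad_nonzero_open[OF U2(1,2) smooth_Cn[OF U2(3)]] by blast
  show thesis
  proof (rule that[of W F])
    show "M \<inter> W = {q \<in> W. F q = 0}" using U2(4) W(3) by blast
    show "M \<inter> W \<inter> S = {}" using nc W(3) by (auto simp: U2_def)
  qed (fact W smooth_subset[OF U2(3) W(3)])+
qed

definition patch :: "'n heis set \<Rightarrow> ('n heis \<Rightarrow> real) \<Rightarrow> bool" where
  "patch U F \<longleftrightarrow> umbilic_patch U F c \<and> M \<inter> U = {q\<in>U. F q = 0} \<and>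
    (\<forall>q\<in>M \<inter> U. hgrad F q = hnormal \<nu> q \<and> D F q vert = T_coeff q (\<nu> q) / norm (zpart (\<nu> q)))"

lemma local_patch:
  assumes p: "p \<in> M - S" and z: "zpart p \<noteq> 0" and V: "open V" "p \<in> V"
  obtains U F where "patch U F" "p \<in> U" "U \<subseteq> V"
proof -
  obtain U0 F0 where F0: "open U0" "p \<in> U0" "smooth U0 F0" "M \<inter> U0 = {q\<in>U0. F0 q = 0}"
    "\<And>q. q \<in> U0 \<Longrightarrow> hgrad F0 q \<noteq> 0" "(M \<inter> U0) \<inter> S = {}"
    by (rule local_smooth[OF p]) blast
  have nor: "\<exists>r. r \<noteq> 0 \<and> zpart (\<nu> q) = r *\<^sub>R hgrad F0 q \<and> T_coeff q (\<nu> q) = r * D F0 q vert"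
    if q: "q \<in> M \<inter> U0" for q
  proof -
    have "D F0 q \<noteq> (\<lambda>_. 0)" using q F0 D_nonzero smooth_differentiable by blast
    then show ?thesis
      using unit_normal_level_set[OF F0(1) _ smooth_Cn[OF F0(3)] F0(4) _ _ normal, of q] q by blast
  qed
  have cont: "continuous_on (M \<inter> U0) (\<lambda>q. zpart (\<nu> q) \<bullet> hgrad F0 q)"
  proof (intro continuous_on_inner)
    have "continuous_on M \<nu>" using normal by (simp add: unit_normal_field_def)
    then show "continuous_on (M \<inter> U0) (\<lambda>q. zpart (\<nu> q))"
      using bounded_linear.continuous_on[OF bounded_linear_zpart] continuous_on_subset by blast
    show "continuous_on (M \<inter> U0) (hgrad F0)"
      using Cn_continuous[OF smooth_Cn[OF smooth_hgrad[OF F0(1,3)]]] continuous_on_subset by blast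
  qed
  have pM: "p \<in> M \<inter> U0" using p F0 by blast
  obtain r0 where r0: "r0 \<noteq> 0" "zpart (\<nu> p) = r0 *\<^sub>R hgrad F0 p"
    using nor[OF pM] by blast
  \<comment> \<open>The gradient of a defining function may point to either side of M. The sign is
    fixed at p, and continuity of the normal keeps it right nearby.\<close>
  define \<sigma> where "\<sigma> = sgn r0"
  have \<sigma>: "\<sigma> \<noteq> 0" "\<bar>\<sigma>\<bar> = 1"
    using r0 by (simp_all add: \<sigma>_def sgn_if)
  have "0 < \<sigma> * (zpart (\<nu> p) \<bullet> hgrad F0 p)"
    using r0 F0(5)[OF F0(2)] by (simp add: \<sigma>_def mult.assoc[symmetric] zero_less_mult_iff sgn_if)
  moreover have "continuous_on (M \<inter> U0) (\<lambda>q. \<sigma> * (zpart (\<nu> q) \<bullet> hgrad F0 q))"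
    using cont by (rule continuous_on_mult_left)
  ultimately obtain A where A: "open A" "p \<in> A" "\<And>q. q \<in> M \<inter> U0 \<Longrightarrow> q \<in> A \<Longrightarrow> 0 < \<sigma> * (zpart (\<nu> q) \<bullet> hgrad F0 q)"
    using pM open_greaterThan[of "0 :: real"] unfolding continuous_on_topological
    by (metis greaterThan_iff)
  define U where "U = U0 \<inter> A \<inter> V \<inter> zpart -` (- {0})"
  have oU: "open U"
  proof -
    have "open (zpart -` (- {0 :: 'n hor}))"
      using bounded_linear_zpart linear_continuous_on by (intro open_vimage) (auto intro: linear_continuous_on)
    then show ?thesis using F0 A V by (auto simp: U_def)
  qed
  have U: "p \<in> U" "U \<subseteq> U0" "U \<subseteq> V" "\<And>q. q \<in> U \<Longrightarrow> zpart q \<noteq> 0"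
    using F0 A V z by (auto simp: U_def)
  define m where "m q = norm (hgrad F0 q)" for q
  \<comment> \<open>On M the derivative of \<open>\<sigma> / m\<close> is multiplied by
    \<open>F0 = 0\<close>, so there, and in general only there, the horizontal gradient becomes a
    unit vector.\<close>
  define F where "F q = \<sigma> * F0 q / m q" for q
  have m0: "m q > 0" if "q \<in> U" for q using F0(5)[OF subsetD[OF U(2) that]] by (simp add: m_def)
  have m1: "m q \<noteq> 0" if "q \<in> U" for q using m0[OF that] by simp
  have sF0: "smooth U F0"
    using smooth_subset[OF F0(3) U(2)] .
  have sm: "smooth U m"
  proof -
    have "smooth U (\<lambda>q. sqrt (hgrad F0 q \<bullet> hgrad F0 q))"
      using F0(5) U(2) by (intro smooth_sqrt smooth_inner smooth_hgrad oU sF0) auto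
    then show ?thesis by (simp add: m_def[abs_def] norm_eq_sqrt_inner)
  qed
  have sF: "smooth U F"
    unfolding F_def[abs_def] by (intro smooth_divide smooth_mult smooth_const oU sF0 sm m1)
  have MU: "M \<inter> U = {q\<in>U. F q = 0}"
  proof -
    have "F q = 0 \<longleftrightarrow> F0 q = 0" if "q \<in> U" for q
      using m0[OF that] \<sigma> by (simp add: F_def)
    then show ?thesis using F0(4) U(2) by blast
  qed
  have DF: "D F q v = \<sigma> / m q * D F0 q v" if q: "q \<in> M \<inter> U" for q v
  proof -
    have F0q: "F0 q = 0" using F0(4) U(2) q by blast
    have dd: "F0 differentiable (at q)" "(\<lambda>q. \<sigma> / m q) differentiable (at q)"
      using smooth_differentiable[OF sF0] smooth_differentiable[OF smooth_divide[OF oU smooth_const[OF oU] sm m1]] q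
      by simp_all
    have "F = (\<lambda>q. \<sigma> / m q * F0 q)" by (simp add: F_def fun_eq_iff)
    then have "(F has_derivative (\<lambda>v. \<sigma> / m q * D F0 q v + D (\<lambda>q. \<sigma> / m q) q v * F0 q)) (at q)"
      using has_derivative_mult[OF D_works[OF dd(2)] D_works[OF dd(1)]] by simp
    then show ?thesis by (simp add: D_eqI F0q)
  qed
  have G: "hgrad F q = (\<sigma> / m q) *\<^sub>R hgrad F0 q" if "q \<in> M \<inter> U" for q
    by (simp add: hgrad_def hder_def DF[OF that] scaleR_sum_right)
  have key: "hgrad F q = hnormal \<nu> q" "D F q vert = T_coeff q (\<nu> q) / norm (zpart (\<nu> q))" if q: "q \<in> M \<inter> U" for q
  proof -
    obtain r where r: "r \<noteq> 0" "zpart (\<nu> q) = r *\<^sub>R hgrad F0 q" "T_coeff q (\<nu> q) = r * D F0 q vert"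
      using nor q U(2) by blast
    have "0 < \<sigma> * (r * (hgrad F0 q \<bullet> hgrad F0 q))"
      using A(3)[of q] q U(2) r(2) by (auto simp: U_def)
    then have "0 < \<sigma> * r"
      using inner_ge_zero[of "hgrad F0 q"] by (simp add: mult.assoc[symmetric] zero_less_mult_iff)
    then have "r = \<sigma> * \<bar>r\<bar>"
      using \<sigma> by (auto simp: abs_if zero_less_mult_iff split: if_splits)
    moreover have mq: "norm (zpart (\<nu> q)) = \<bar>r\<bar> * m q" by (simp add: r m_def)
    ultimately have e: "r / norm (zpart (\<nu> q)) = \<sigma> / m q"
      using r(1) by (metis abs_zero mult.commute mult_divide_mult_cancel_right abs_eq_0_iff)
    then show "hgrad F q = hnormal \<nu> q"
      using arg_cong[OF r(2), of "\<lambda>x. (1 / norm (zpart (\<nu> q))) *\<^sub>R x"]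
      by (simp add: G[OF q] hnormal_def)
    show "D F q vert = T_coeff q (\<nu> q) / norm (zpart (\<nu> q))"
      unfolding DF[OF q] r(3) e[symmetric] by simp
  qed
  have unit: "norm (hgrad F q) = 1" if "q \<in> M \<inter> U" for q
    using m0[of q] that \<sigma> by (simp add: G[OF that]) (simp add: m_def)
  have "umbilic_patch U F c"
  proof
    show "2 \<le> CARD('n)" "c \<noteq> 0" "open U" "smooth U F" "\<And>q. q \<in> U \<Longrightarrow> zpart q \<noteq> 0"
      by (fact card c0 oU sF U(4))+
    fix q assume "q \<in> U" "F q = 0"
    then have q: "q \<in> M \<inter> U" using MU by blast
    show "norm (hgrad F q) = 1" by (rule unit[OF q])
    have dF: "F differentiable (at q)" "hgrad F differentiable (at q)"
      using smooth_differentiable sF smooth_hgrad[OF oU sF] q by blast+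
    have nz: "D F q \<noteq> (\<lambda>_. 0)"
      by (rule D_nonzero[OF dF(1)]) (use unit[OF q] in \<open>metis norm_zero zero_neq_one\<close>)
    have nc: "q \<in> M" "q \<notin> S" using q F0(6) U(2) by auto
    have tan: "lift q w \<in> tangent_space M q \<longleftrightarrow> hgrad F q \<bullet> w = 0" for w
      using tangent_space_level_set[OF oU _ smooth_Cn[OF sF] MU nc(1) nz] q D_hgrad[OF dF(1), of "lift q w"]
      by (simp add: zpart_simps T_coeff_simps)
    have \<alpha>: "2 * D F q vert = 2 * T_coeff q (\<nu> q) / norm (zpart (\<nu> q))"
      using key(2)[OF q] by simp
    have H: "horizontal_mean_curvature M \<nu> q * (2 * real CARD('n) - 1) = c * (2 * real CARD('n) - 1) * norm (zpart q)"
      using curvature'[of q] nc by simp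
    show "\<exists>k l. (\<forall>w. w \<bullet> hgrad F q = 0 \<and> w \<bullet> hJ (hgrad F q) = 0 \<longrightarrow>
        hder (hgrad F) q w = k *\<^sub>R w + (2 * D F q vert) *\<^sub>R hJ w) \<and>
      hder (hgrad F) q (- hJ (hgrad F q)) = l *\<^sub>R (- hJ (hgrad F q)) \<and>
      (2 * real CARD('n) - 2) * k + l = c * (2 * real CARD('n) - 1) * norm (zpart q)"
      using umbilic_shape[OF card oU _ dF(2) key(1)[symmetric] unit[OF q] nc tan umb \<alpha>] q H by simp
  qed
  then show thesis
    using that[of U F] U MU key unfolding patch_def by blast
qed

text \<open>
  If all points near p were characteristic, the horizontal derivatives of the local equation F
  would vanish on M near p, and their commutators would give T F = 0 at p.
\<close>

lemma noncharacteristic_dense: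
  assumes p: "p \<in> M" and V: "open V" "p \<in> V"
  shows "\<exists>q\<in>V. q \<in> M - S"
proof (rule ccontr)
  assume "\<not> ?thesis"
  then have all: "\<And>q. q \<in> V \<Longrightarrow> q \<in> M \<Longrightarrow> q \<in> S"
    by blast
  obtain U0 and F :: "'n heis \<Rightarrow> real" where F: "open U0" "p \<in> U0" "Cn 2 U0 F" "M \<inter> U0 = {q\<in>U0. F q = 0}"
    "\<forall>q\<in>U0. D F q \<noteq> (\<lambda>_. 0)"
    using local_C2[OF p] by blast
  define U where "U = U0 \<inter> V"
  have U: "open U" "p \<in> U" "Cn 2 U F" "M \<inter> U = {q\<in>U. F q = 0}" "\<And>q. q \<in> U \<Longrightarrow> D F q \<noteq> (\<lambda>_. 0)"
    using F V Cn_subset[OF F(3), of U] by (auto simp: U_def)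
  have C1: "Cn 1 U F" by (rule Cn_le[OF U(3)]) simp
  have dF: "F differentiable (at q)" if "q \<in> U" for q using C1 that by simp
  have g0: "hgrad F q = 0" if "q \<in> M \<inter> U" for q
    using characteristic_level_set[OF U(1) _ C1 U(4)] that U(5) all by (auto simp: U_def)
  have h0: "hder F q u = 0" if "q \<in> M \<inter> U" for q u
    using hder_eq_hgrad[OF dF, of q u] g0[OF that] that by simp
  have dh: "(\<lambda>q. hder F q u) differentiable (at p)" for u
    unfolding hder_def
    using Cn_directional[OF U(1), of 1 F "\<lambda>q. lift q u"] U(2,3)
      smooth_Cn[OF smooth_lift[OF U(1) smooth_const[OF U(1)]]]
    by (simp add: numeral_2_eq_2)
  have "hder (\<lambda>q. hder F q u) p v = 0" for u v
  proof -
    have pM: "p \<in> M \<inter> U" "F p = 0" using p U by blast+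
    have "D F p (lift p v) = 0" using h0[OF pM(1), of v] by (simp add: hder_def)
    then obtain g \<epsilon> where g: "\<epsilon> > 0" "g 0 = p" "\<And>s. \<bar>s\<bar> < \<epsilon> \<Longrightarrow> g s \<in> U \<and> F (g s) = 0"
      "(g has_vector_derivative lift p v) (at (0::real))"
      using level_set_curve[OF U(1) C1 U(2) pM(2) U(5)[OF U(2)]] by metis
    have "D (\<lambda>q. hder F q u) (g 0) (lift p v) = D (\<lambda>q. 0 :: real) (g 0) (lift p v)"
    proof (rule tangent_derivative_eq[OF g(4,1)])
      fix s assume "\<bar>s\<bar> < \<epsilon>"
      then show "hder F (g s) u = 0" using g(3) U(4) h0 by blast
    qed (use g(2) dh in auto)
    then show ?thesis using g(2) by (simp add: hder_def)
  qed
  then have "(4 * (hJ u \<bullet> v)) * D F p vert = 0" for u v :: "'n hor"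
    using horizontal_commutator[OF U(1,3,2), of "\<lambda>_. u" "\<lambda>_. v"] hder_simps(5)[OF dF[OF U(2)]]
    by (simp add: hder_const)
  moreover obtain u :: "'n hor" where "u \<in> Basis"
    using nonempty_Basis by blast
  ultimately have "(4 * (hJ u \<bullet> hJ u)) * D F p vert = 0" "u \<noteq> 0"
    using nonzero_Basis by blast+
  then have "D F p vert = 0" by (simp add: hJ_inner(1))
  then have "D F p v = 0" for v using D_hgrad[OF dF[OF U(2)], of v] g0[of p] p U(2) by simp
  then show False
    using U(5)[OF U(2)] by blast
qed

end

section \<open>Global structure\<close>

lemma openin_locally:
  assumes "T \<subseteq> M" "\<And>x. x \<in> T \<Longrightarrow> \<exists>W. open W \<and> x \<in> W \<and> M \<inter> W \<subseteq> T"
  shows "openin (top_of_set M) T"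
  unfolding openin_subopen[of _ T]
proof
  fix x assume "x \<in> T"
  then obtain W where "open W" "x \<in> W" "M \<inter> W \<subseteq> T"
    using assms by blast
  then show "\<exists>V. openin (top_of_set M) V \<and> x \<in> V \<and> V \<subseteq> T"
    using \<open>x \<in> T\<close> assms(1) by (intro exI[of _ "M \<inter> W"]) auto
qed

lemma connected_locally_clopen:
  assumes M: "connected M" and T: "T \<subseteq> M" "T \<noteq> {}"
    and 1: "\<And>x. x \<in> T \<Longrightarrow> \<exists>W. open W \<and> x \<in> W \<and> M \<inter> W \<subseteq> T"
    and 2: "\<And>x. x \<in> M - T \<Longrightarrow> \<exists>W. open W \<and> x \<in> W \<and> M \<inter> W \<subseteq> M - T"
  shows "T = M"
proof -
  have "openin (top_of_set M) T" "openin (top_of_set M) (M - T)"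
    using 1 2 T by (auto intro!: openin_locally)
  then have "closedin (top_of_set M) T" using T by (auto simp: closedin_def)
  then show ?thesis
    using M T \<open>openin (top_of_set M) T\<close> unfolding connected_clopen by blast
qed

context umbilic_hypersurface
begin

abbreviation N :: "'n heis \<Rightarrow> 'n hor" where "N \<equiv> hnormal \<nu>"
text \<open>\<open>sz\<close>, \<open>az\<close>, \<open>bz\<close>, \<open>tz\<close>,
  \<open>Cz\<close> and \<open>Kz\<close> are the patch quantities expressed through the normal, so
  that they do not depend on a local equation F.\<close>

definition sz :: "'n heis \<Rightarrow> real" where "sz q = norm (zpart q)"
definition az :: "'n heis \<Rightarrow> real" where "az q = zpart q \<bullet> N q"
definition bz :: "'n heis \<Rightarrow> real" where "bz q = zpart q \<bullet> hJ (N q)"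
definition tz :: "'n heis \<Rightarrow> real" where "tz q = snd (snd q)"
definition Cz :: real where "Cz = c * (2 * real CARD('n) - 1) / (2 * real CARD('n) + 1)"
definition Kz :: "'n heis \<Rightarrow> real" where "Kz q = (az q - Cz * (sz q)^3) * (sz q)^(2 * CARD('n) - 2)"

lemma Cz_nonzero: "Cz \<noteq> 0"
  using c0 card by (simp add: Cz_def)

lemma patchD:
  assumes "patch U F"
  shows "umbilic_patch U F c" "\<And>q. q \<in> U \<Longrightarrow> F q = 0 \<longleftrightarrow> q \<in> M"
    "\<And>q. q \<in> M \<inter> U \<Longrightarrow> hgrad F q = N q"
    "\<And>q. q \<in> M \<inter> U \<Longrightarrow> D F q vert = T_coeff q (\<nu> q) / norm (zpart (\<nu> q))"
  using assms unfolding patch_def by blast+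

lemma patch_eqs:
  assumes F: "patch U F"
  shows "umbilic_patch.s = sz" "umbilic_patch.t = tz" "umbilic_patch.C TYPE('n) c = Cz"
    "\<And>q. q \<in> M \<inter> U \<Longrightarrow> umbilic_patch.a F q = az q"
    "\<And>q. q \<in> M \<inter> U \<Longrightarrow> umbilic_patch.b F q = bz q"
    "\<And>q. q \<in> M \<inter> U \<Longrightarrow> umbilic_patch.K F c q = Kz q"
proof -
  interpret umbilic_patch U F c
    by (rule patchD(1)[OF F])
  show "s = sz" "t = tz" "C = Cz"
    "\<And>q. q \<in> M \<inter> U \<Longrightarrow> a q = az q" "\<And>q. q \<in> M \<inter> U \<Longrightarrow> b q = bz q" "\<And>q. q \<in> M \<inter> U \<Longrightarrow> K q = Kz q"
    using patchD(3)[OF F]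
    by (auto simp: s_def t_def C_def a_def b_def K_def sz_def tz_def Cz_def az_def bz_def Kz_def fun_eq_iff)
qed

section \<open>Characteristic points and the axis\<close>

lemma normal_zpart_nonzero:
  assumes p: "p \<in> M - S"
  shows "zpart (\<nu> p) \<noteq> 0"
proof -
  obtain U F where F: "open U" "p \<in> U" "smooth U F" "M \<inter> U = {q\<in>U. F q = 0}"
    "\<And>q. q \<in> U \<Longrightarrow> hgrad F q \<noteq> 0" "(M \<inter> U) \<inter> S = {}"
    by (rule local_smooth[OF p]) blast
  have "D F p \<noteq> (\<lambda>_. 0)" using F D_nonzero smooth_differentiable by blast
  then obtain r where "r \<noteq> 0" "zpart (\<nu> p) = r *\<^sub>R hgrad F p"
    using unit_normal_level_set[OF F(1,2) smooth_Cn[OF F(3)] F(4) _ _ normal] p by blast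
  then show ?thesis using F by simp
qed

lemma continuous_nu: "continuous_on M \<nu>"
  using normal by (simp add: unit_normal_field_def)

lemma continuous_zpart_nu: "continuous_on M (\<lambda>q. zpart (\<nu> q))"
  using bounded_linear.continuous_on[OF bounded_linear_zpart continuous_nu] .

lemma continuous_N: "continuous_on (M - S) N"
  unfolding hnormal_def[abs_def]
  using normal_zpart_nonzero continuous_on_subset[OF continuous_zpart_nu, of "M - S"]
  by (intro continuous_intros) auto

lemma z_decomposition:
  assumes p: "p \<in> M - S" "zpart p \<noteq> 0"
  shows "zpart p = az p *\<^sub>R N p + bz p *\<^sub>R hJ (N p)"
    "(az p)\<^sup>2 + (bz p)\<^sup>2 = (sz p)\<^sup>2"
    "bz p = - (sz p)\<^sup>2 * (2 * T_coeff p (\<nu> p) / norm (zpart (\<nu> p)))"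
proof -
  obtain U F where F: "patch U F" "p \<in> U"
    using local_patch[OF p open_UNIV UNIV_I] by metis
  note e = patchD[OF F(1)] patch_eqs[OF F(1)]
  interpret umbilic_patch U F c
    by (rule e(1))
  have pM: "p \<in> M \<inter> U" and F0: "F p = 0" using p F e(2) by auto
  show "zpart p = az p *\<^sub>R N p + bz p *\<^sub>R hJ (N p)"
    using z_eq[OF F(2) F0] by (simp add: e(8,9,3)[OF pM])
  show "(az p)\<^sup>2 + (bz p)\<^sup>2 = (sz p)\<^sup>2"
    using a_b_square[OF F(2) F0] by (simp add: e(5) e(8,9)[OF pM])
  show "bz p = - (sz p)\<^sup>2 * (2 * T_coeff p (\<nu> p) / norm (zpart (\<nu> p)))"
    using \<alpha>_eq[OF F(2) F0] by (simp add: e(5) e(9,4)[OF pM] \<alpha>_def)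
qed

text \<open>
  If M had a noncharacteristic point p on the axis, points of M near p in the direction of a
  horizontal tangent vector w orthogonal to N and J N would violate the decomposition of z.
\<close>

lemma zpart_nonzero:
  assumes p: "p \<in> M - S"
  shows "zpart p \<noteq> 0"
proof
  assume z0: "zpart p = 0"
  obtain U F where F: "open U" "p \<in> U" "smooth U F" "M \<inter> U = {q\<in>U. F q = 0}"
    "\<And>q. q \<in> U \<Longrightarrow> hgrad F q \<noteq> 0" "(M \<inter> U) \<inter> S = {}"
    by (rule local_smooth[OF p]) blast
  have dF: "F differentiable (at p)" using F smooth_differentiable by blast
  have nz: "D F p \<noteq> (\<lambda>_. 0)" using F D_nonzero[OF dF] by blast
  obtain r where r: "r \<noteq> 0" "zpart (\<nu> p) = r *\<^sub>R hgrad F p"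
    using unit_normal_level_set[OF F(1,2) smooth_Cn[OF F(3)] F(4) _ nz normal] p by blast
  obtain w where w: "w \<noteq> 0" "w \<bullet> N p = 0" "w \<bullet> hJ (N p) = 0"
    by (rule orthogonal_vector_exists[OF card])
  have "hgrad F p \<bullet> w = 0"
    using w(2) r normal_zpart_nonzero[OF p] by (simp add: hnormal_def inner_commute)
  then have "D F p (lift p w) = 0"
    using D_hgrad[OF dF, of "lift p w"] by (simp add: zpart_simps T_coeff_simps)
  then obtain g \<epsilon> where g: "\<epsilon> > 0" "g 0 = p" "\<And>s. \<bar>s\<bar> < \<epsilon> \<Longrightarrow> g s \<in> U \<and> F (g s) = 0"
    "(g has_vector_derivative lift p w) (at (0::real))"
    using level_set_curve[OF F(1) smooth_Cn[OF F(3)] F(2) _ nz] p F(2,4) by blast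
  have gM: "g s \<in> M - S" if "\<bar>s\<bar> < \<epsilon>" for s
    using g(3)[OF that] F(4,6) by blast
  have ev: "\<forall>\<^sub>F s in at 0. \<bar>s\<bar> < \<epsilon> \<and> s \<noteq> 0"
    using g(1) by (auto simp: eventually_at intro!: exI[of _ \<epsilon>])
  \<comment> \<open>Difference quotients of z along the curve; they tend to w because z is 0 at
    p.\<close>
  define y where "y s = (1 / s) *\<^sub>R zpart (g s)" for s
  have y: "(y \<longlongrightarrow> w) (at 0)"
  proof -
    have "((\<lambda>s. zpart (g s)) has_vector_derivative zpart (lift p w)) (at 0)"
      by (rule bounded_linear.has_vector_derivative[OF bounded_linear_zpart g(4)])
    then have "((\<lambda>s. norm (zpart (g s) - s *\<^sub>R w) / norm s) \<longlongrightarrow> 0) (at 0)"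
      by (simp add: has_vector_derivative_def has_derivative_at zpart_simps g(2) z0)
    moreover have "\<forall>\<^sub>F s in at 0. norm (zpart (g s) - s *\<^sub>R w) / norm s = norm (y s - w)"
      using ev
    proof eventually_elim
      case (elim s)
      then have "y s - w = (1 / s) *\<^sub>R (zpart (g s) - s *\<^sub>R w)"
        by (simp add: y_def scaleR_diff_right)
      then show ?case by simp
    qed
    ultimately have "((\<lambda>s. norm (y s - w)) \<longlongrightarrow> 0) (at 0)"
      by (rule Lim_transform_eventually)
    then show ?thesis by (rule LIM_zero_cancel[OF tendsto_norm_zero_cancel])
  qed
  have "(g \<longlongrightarrow> p) (at 0)"
    using has_vector_derivative_continuous[OF g(4)] g(2) by (simp add: continuous_at)
  moreover have "\<forall>\<^sub>F s in at 0. g s \<in> M - S"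
    using ev by eventually_elim (use gM in blast)
  ultimately have N: "((\<lambda>s. N (g s)) \<longlongrightarrow> N p) (at 0)"
    by (rule continuous_on_tendsto_compose[OF continuous_N _ p])
  \<comment> \<open>The component of \<open>y s\<close> orthogonal to N and J N tends to that of w,
    which is w itself. For small s other than 0 it is 0, by the decomposition of z, or trivially
    where z is 0.\<close>
  have "((\<lambda>s. y s - (y s \<bullet> N (g s)) *\<^sub>R N (g s) - (y s \<bullet> hJ (N (g s))) *\<^sub>R hJ (N (g s))) \<longlongrightarrow>
      w - (w \<bullet> N p) *\<^sub>R N p - (w \<bullet> hJ (N p)) *\<^sub>R hJ (N p)) (at 0)"
    by (intro tendsto_intros y N bounded_linear.tendsto[OF bounded_linear_hJ])
  then have "((\<lambda>s. y s - (y s \<bullet> N (g s)) *\<^sub>R N (g s) - (y s \<bullet> hJ (N (g s))) *\<^sub>R hJ (N (g s))) \<longlongrightarrow> w) (at 0)"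
    using w by simp
  moreover have "\<forall>\<^sub>F s in at 0. y s - (y s \<bullet> N (g s)) *\<^sub>R N (g s) - (y s \<bullet> hJ (N (g s))) *\<^sub>R hJ (N (g s)) = 0"
    using ev
  proof eventually_elim
    case (elim s)
    have "zpart (g s) - (zpart (g s) \<bullet> N (g s)) *\<^sub>R N (g s) - (zpart (g s) \<bullet> hJ (N (g s))) *\<^sub>R hJ (N (g s)) = 0"
    proof (cases "zpart (g s) = 0")
      case False
      then show ?thesis
        using z_decomposition(1)[OF gM[of s]] elim by (simp add: az_def bz_def algebra_simps)
    qed simp
    then have "(1 / s) *\<^sub>R (zpart (g s) - (zpart (g s) \<bullet> N (g s)) *\<^sub>R N (g s) - (zpart (g s) \<bullet> hJ (N (g s))) *\<^sub>R hJ (N (g s))) = 0"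
      by simp
    then show ?case by (simp add: y_def scaleR_diff_right)
  qed
  ultimately have "((\<lambda>s. 0) \<longlongrightarrow> w) (at (0::real))"
    by (rule Lim_transform_eventually)
  then show False
    using w(1) tendsto_unique[OF trivial_limit_at _ tendsto_const] by blast
qed

lemma continuous_T_coeff: "continuous_on M (\<lambda>q. T_coeff q (\<nu> q))"
proof -
  have "(\<lambda>q. T_coeff q (\<nu> q)) = (\<lambda>q. snd (snd (\<nu> q)) + 2 * (fst (snd q) \<bullet> fst (\<nu> q) - fst q \<bullet> fst (snd (\<nu> q))))"
    by (auto simp: T_coeff_def fun_eq_iff split: prod.splits)
  then show ?thesis using continuous_nu by (simp only:) (intro continuous_intros)
qed

text \<open>At noncharacteristic points b = - s^2 \<open>\<alpha>\<close> and |b| <= s give s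
  |\<open>\<alpha>\<close>| <= 1, which says that the continuous function f of the proof is
  nonnegative. At a characteristic point off the axis the normal has horizontal part 0 and T
  coefficient 1 or -1, so f is negative nearby, against the density of noncharacteristic points. The
  converse is \<open>zpart_nonzero\<close>.\<close>

lemma noncharacteristic_iff: "p \<in> M - S \<longleftrightarrow> p \<in> M \<and> zpart p \<noteq> 0"
proof
  assume p: "p \<in> M \<and> zpart p \<noteq> 0"
  show "p \<in> M - S"
  proof (rule ccontr)
    assume "p \<notin> M - S"
    then have pS: "p \<in> M" "p \<in> S" using p by auto
    obtain U and F :: "'n heis \<Rightarrow> real" where F: "open U" "p \<in> U" "Cn 2 U F" "M \<inter> U = {q\<in>U. F q = 0}"
      "\<forall>q\<in>U. D F q \<noteq> (\<lambda>_. 0)"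
      using local_C2[OF pS(1)] by blast
    have C1: "Cn 1 U F" by (rule Cn_le[OF F(3)]) simp
    have nz: "D F p \<noteq> (\<lambda>_. 0)" using F by blast
    have "hgrad F p = 0" using characteristic_level_set[OF F(1,2) C1 F(4) pS(1) nz] pS by simp
    then have z\<nu>: "zpart (\<nu> p) = 0"
      using unit_normal_level_set[OF F(1,2) C1 F(4) pS(1) nz normal] by (metis scaleR_zero_right)
    have "heis_norm p (\<nu> p) = 1" using normal pS by (simp add: unit_normal_field_def)
    then have "(T_coeff p (\<nu> p))\<^sup>2 = 1"
      using heis_norm_square[of p "\<nu> p"] z\<nu> by simp
    then have T1: "\<bar>T_coeff p (\<nu> p)\<bar> = 1" by (auto simp: power2_eq_1_iff)
    define f where "f q = norm (zpart (\<nu> q)) - 2 * \<bar>T_coeff q (\<nu> q)\<bar> * norm (zpart q)" for q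
    have cf: "continuous_on M f"
      unfolding f_def[abs_def]
      by (intro continuous_intros continuous_zpart_nu continuous_T_coeff
          linear_continuous_on bounded_linear_zpart)
    have f0: "f q \<ge> 0" if q: "q \<in> M - S" for q
    proof -
      note d = z_decomposition[OF q zpart_nonzero[OF q]]
      define \<alpha> where "\<alpha> = 2 * T_coeff q (\<nu> q) / norm (zpart (\<nu> q))"
      have s: "sz q > 0" using zpart_nonzero[OF q] by (simp add: sz_def)
      have "(bz q)\<^sup>2 \<le> (sz q)\<^sup>2" using d(2) zero_le_power2[of "az q"] by linarith
      then have "\<bar>bz q\<bar> \<le> sz q" using s by (simp add: abs_le_square_iff[symmetric])
      then have "(sz q * \<bar>\<alpha>\<bar>) * sz q \<le> 1 * sz q"
        unfolding d(3) \<alpha>_def[symmetric] by (simp add: abs_mult power2_eq_square mult_ac)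
      then have "sz q * \<bar>\<alpha>\<bar> \<le> 1"
        using s by (simp only: mult_le_cancel_right_pos)
      then show ?thesis
        using normal_zpart_nonzero[OF q] by (simp add: f_def \<alpha>_def sz_def abs_mult field_simps)
    qed
    have "f p < 0" using p T1 z\<nu> by (simp add: f_def)
    then obtain A where A: "open A" "p \<in> A" "\<And>q. q \<in> M \<Longrightarrow> q \<in> A \<Longrightarrow> f q < 0"
      using cf pS(1) open_lessThan[of "0 :: real"] unfolding continuous_on_topological
      by (metis lessThan_iff)
    obtain q where "q \<in> A" "q \<in> M - S"
      using noncharacteristic_dense[OF pS(1) A(1,2)] by blast
    then show False
      using A(3)[of q] f0[of q] by auto
  qed
qed (use zpart_nonzero in auto)

lemma Kz_locally_constant:
  assumes p: "p \<in> M" "zpart p \<noteq> 0"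
  shows "\<exists>W. open W \<and> p \<in> W \<and> (\<forall>q\<in>M \<inter> W. zpart q \<noteq> 0 \<and> Kz q = Kz p)"
proof -
  have pM: "p \<in> M - S" using p noncharacteristic_iff by blast
  obtain U F where F: "patch U F" "p \<in> U"
    using local_patch[OF pM p(2) open_UNIV UNIV_I] by metis
  note e = patchD[OF F(1)] patch_eqs[OF F(1)]
  interpret umbilic_patch U F c
    by (rule e(1))
  have pU: "p \<in> M \<inter> U" and F0: "F p = 0" using p F e(2) by auto
  obtain W where W: "open W" "p \<in> W" "W \<subseteq> U" "\<And>q. q \<in> W \<Longrightarrow> F q = 0 \<Longrightarrow> K q = K p"
    using K_locally_constant[OF F(2) F0] by metis
  have "zpart q \<noteq> 0 \<and> Kz q = Kz p" if "q \<in> M \<inter> W" for q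
  proof -
    have q: "q \<in> M \<inter> U" "F q = 0" using that W(3) e(2)[of q] by auto
    then show ?thesis
      using W(4)[of q] that z_nonzero[of q] by (simp add: e(10)[OF q(1)] e(10)[OF pU])
  qed
  then show ?thesis using W by blast
qed

end

section \<open>Compactness and the vanishing of K\<close>

locale compact_umbilic_hypersurface = umbilic_hypersurface +
  assumes compact_M: "compact M" and connected_M: "connected M" and nonempty_M: "M \<noteq> {}"
begin

text \<open>Because |a| <= s, K tends to 0 at the axis; points with a fixed nonzero value of K keep
  a positive distance from it.\<close>

lemma Kz_bound:
  assumes p: "p \<in> M" "zpart p \<noteq> 0" "sz p \<le> 1"
  shows "\<bar>Kz p\<bar> \<le> sz p * (1 + \<bar>Cz\<bar>)"
proof -
  have s: "sz p > 0" using p by (simp add: sz_def)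
  have "(az p)\<^sup>2 + (bz p)\<^sup>2 = (sz p)\<^sup>2"
    using z_decomposition(2)[of p] p noncharacteristic_iff by blast
  then have "(az p)\<^sup>2 \<le> (sz p)\<^sup>2" using zero_le_power2[of "bz p"] by linarith
  then have a: "\<bar>az p\<bar> \<le> sz p" using s by (simp add: abs_le_square_iff[symmetric])
  have pow: "(sz p)^m \<le> 1" for m using s p(3) by (simp add: power_le_one)
  have "\<bar>az p - Cz * (sz p)^3\<bar> \<le> \<bar>az p\<bar> + \<bar>Cz\<bar> * (sz p)^3"
    using s by (simp add: abs_triangle_ineq4[THEN order_trans] abs_mult)
  also have "\<bar>Cz\<bar> * (sz p)^3 \<le> \<bar>Cz\<bar> * (sz p * 1)"
    using pow[of 2] s by (intro mult_left_mono) (simp_all add: power3_eq_cube power2_eq_square)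
  finally have "\<bar>az p - Cz * (sz p)^3\<bar> \<le> sz p * (1 + \<bar>Cz\<bar>)"
    using a by (simp add: algebra_simps)
  then have "\<bar>az p - Cz * (sz p)^3\<bar> * \<bar>(sz p)^(2 * CARD('a) - 2)\<bar> \<le> (sz p * (1 + \<bar>Cz\<bar>)) * 1"
    using pow s by (intro mult_mono) auto
  then show ?thesis by (simp add: Kz_def abs_mult)
qed

lemma continuous_sz: "continuous_on A sz"
  unfolding sz_def[abs_def] by (intro continuous_intros linear_continuous_on bounded_linear_zpart)

text \<open>For a value \<open>\<kappa>\<close> other than 0 the set where K =
  \<open>\<kappa>\<close> is open and closed in M, hence all of M. Then M misses the axis, the
  height function is continuous on all of M, and by compactness it attains the maximum that
  \<open>no_height_maximum\<close> excludes.\<close>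

lemma Kz_eq_0:
  assumes p0: "p0 \<in> M" "zpart p0 \<noteq> 0"
  shows "Kz p0 = 0"
proof (rule ccontr)
  assume nz: "Kz p0 \<noteq> 0"
  define \<kappa> where "\<kappa> = Kz p0"
  define T where "T = {q\<in>M. zpart q \<noteq> 0 \<and> Kz q = \<kappa>}"
  have T: "T = M"
  proof (rule connected_locally_clopen[OF connected_M])
    show "T \<subseteq> M" "T \<noteq> {}" using p0 unfolding T_def \<kappa>_def by blast+
    show "\<exists>W. open W \<and> x \<in> W \<and> M \<inter> W \<subseteq> T" if x: "x \<in> T" for x
    proof -
      have "x \<in> M" "zpart x \<noteq> 0" "Kz x = \<kappa>" using x by (auto simp: T_def)
      then obtain W where "open W" "x \<in> W" "\<forall>q\<in>M \<inter> W. zpart q \<noteq> 0 \<and> Kz q = \<kappa>"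
        using Kz_locally_constant[of x] by metis
      then show ?thesis by (intro exI[of _ W]) (auto simp: T_def)
    qed
    show "\<exists>W. open W \<and> x \<in> W \<and> M \<inter> W \<subseteq> M - T" if x: "x \<in> M - T" for x
    proof (cases "zpart x = 0")
      case True
      \<comment> \<open>At distance less than \<open>\<delta>\<close> from the axis
        \<open>Kz_bound\<close> forces |K| < |\<open>\<kappa>\<close>|; the 1 is the range of that
        bound.\<close>
      define \<delta> where "\<delta> = min 1 (\<bar>\<kappa>\<bar> / (1 + \<bar>Cz\<bar>))"
      have \<delta>: "\<delta> > 0" using nz by (simp add: \<delta>_def \<kappa>_def)
      have "open {q :: 'a heis. sz q < \<delta>}"
        using continuous_sz by (intro open_Collect_less) auto
      moreover have "x \<in> {q. sz q < \<delta>}" using True \<delta> by (simp add: sz_def)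
      moreover have "q \<notin> T" if "sz q < \<delta>" for q
      proof
        assume q: "q \<in> T"
        then have "\<bar>\<kappa>\<bar> \<le> sz q * (1 + \<bar>Cz\<bar>)"
          using Kz_bound[of q] that by (auto simp: T_def \<delta>_def)
        also have "\<dots> < \<bar>\<kappa>\<bar>"
          using that by (simp add: \<delta>_def pos_less_divide_eq add_pos_nonneg)
        finally show False
          by simp
      qed
      ultimately show ?thesis by blast
    next
      case False
      then obtain W where W: "open W" "x \<in> W" "\<forall>q\<in>M \<inter> W. zpart q \<noteq> 0 \<and> Kz q = Kz x"
        using Kz_locally_constant[of x] x by blast
      moreover have "Kz x \<noteq> \<kappa>" using False x by (auto simp: T_def)
      ultimately show ?thesis by (intro exI[of _ W]) (auto simp: T_def)
    qed
  qed
  have all: "zpart q \<noteq> 0" "Kz q = \<kappa>" "q \<in> M - S" if "q \<in> M" for q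
    using that T noncharacteristic_iff[of q] by (auto simp: T_def)
  have spos: "sz q > 0" if "q \<in> M" for q using all(1)[OF that] by (simp add: sz_def)
  have cN: "continuous_on M N" by (rule continuous_on_subset[OF continuous_N]) (use all in blast)
  have cb: "continuous_on M bz"
    unfolding bz_def[abs_def]
    by (intro continuous_intros linear_continuous_on bounded_linear_zpart
        bounded_linear.continuous_on[OF bounded_linear_hJ cN])
  obtain p\<^sub>0 p\<^sub>1 where ext: "p\<^sub>0 \<in> M" "\<And>q. q \<in> M \<Longrightarrow> sz p\<^sub>0 \<le> sz q" "\<And>q. q \<in> M \<Longrightarrow> sz q \<le> sz p\<^sub>1"
    using continuous_attains_inf[OF compact_M nonempty_M continuous_sz]
      continuous_attains_sup[OF compact_M nonempty_M continuous_sz] by metis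
  \<comment> \<open>The constants of \<open>no_height_maximum\<close>, with the extreme values of s
    on M as its bounds. \<open>hh\<close> is the height written without a local equation, so that
    its maximum over M can be taken before a patch is chosen.\<close>
  define \<mu> where "\<mu> = 2 * (2 * real CARD('a) - 1) / ((2 * real CARD('a) + 1) * \<bar>Cz\<bar>) / (sz p\<^sub>1)^3"
  define L where "L = 1 + \<bar>c\<bar> * (2 * real CARD('a) - 1) * sz p\<^sub>1 + (2 * real CARD('a) - 2) / sz p\<^sub>0"
  define hh where "hh q = tz q + 2 / ((2 * real CARD('a) + 1) * Cz) * (bz q / sz q) + sgn Cz * (\<mu> / L\<^sup>2) * bz q" for q
  have "continuous_on M hh"
    unfolding hh_def[abs_def] tz_def[abs_def] using spos
    by (intro continuous_intros cb continuous_sz) force+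
  then obtain p where p: "p \<in> M" "\<And>q. q \<in> M \<Longrightarrow> hh q \<le> hh p"
    using continuous_attains_sup[OF compact_M nonempty_M] by blast
  obtain U F where F: "patch U F" "p \<in> U"
    using local_patch[OF all(3)[OF p(1)] all(1)[OF p(1)] open_UNIV UNIV_I] by metis
  note e = patchD[OF F(1)] patch_eqs[OF F(1)]
  interpret patch: umbilic_patch U F c
    by (rule e(1))
  have h: "patch.height (\<mu> / L\<^sup>2) q = hh q" if "q \<in> M \<inter> U" for q
    unfolding patch.height_def e(5-7) e(9)[OF that] hh_def ..
  show False
  proof (rule patch.no_height_maximum)
    show "p \<in> U" "F p = 0" using F p e(2) by auto
    show "0 < sz p\<^sub>0" "sz p\<^sub>0 \<le> patch.s p" "patch.s p \<le> sz p\<^sub>1"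
      using spos ext p(1) unfolding e(5) by blast+
    show "patch.height (\<mu> / L\<^sup>2) q \<le> patch.height (\<mu> / L\<^sup>2) p" if "q \<in> U" "F q = 0" for q
      using h[of q] h[of p] p F(2) e(2)[of p] e(2)[of q] that by simp
  qed (simp_all only: \<mu>_def L_def e(7))
qed

section \<open>The gauge sphere\<close>

definition R :: real where "R = 1 / \<bar>Cz\<bar>"

lemma R: "R > 0" "R\<^sup>2 = 1 / Cz\<^sup>2"
  using Cz_nonzero by (simp_all add: R_def power_divide)

definition center :: "'a heis \<Rightarrow> real" where "center q = tz q + inverse Cz * (bz q / sz q)"

text \<open>A polynomial equation of the gauge sphere with centre (0, 0, \<open>\<tau>\<close>). The
  constant \<open>1 / Cz\<^sup>2\<close> is the fourth power of its radius, so \<open>R\<close> is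
  the square of the radius.\<close>

definition sphere_eq :: "real \<Rightarrow> 'a heis \<Rightarrow> real" where
  "sphere_eq \<tau> q = (zpart q \<bullet> zpart q)\<^sup>2 + (tz q - \<tau>)\<^sup>2 - 1 / Cz\<^sup>2"

lemma az_eq:
  assumes "p \<in> M" "zpart p \<noteq> 0"
  shows "az p = Cz * (sz p)^3"
  using Kz_eq_0[OF assms] assms(2) by (simp add: Kz_def sz_def)

text \<open>With a = C s^3 the relation a^2 + b^2 = s^2 becomes (b / (C s))^2 = 1 / C^2 - s^4, and b
  / (C s) is the difference of centre and t.\<close>

lemma sphere_eq_center:
  assumes p: "p \<in> M" "zpart p \<noteq> 0"
  shows "sphere_eq (center p) p = 0"
proof -
  have s: "sz p > 0" using p by (simp add: sz_def)
  have zz: "zpart p \<bullet> zpart p = (sz p)\<^sup>2" by (simp add: sz_def power2_norm_eq_inner)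
  have "(az p)\<^sup>2 + (bz p)\<^sup>2 = (sz p)\<^sup>2"
    using z_decomposition(2)[of p] p noncharacteristic_iff by blast
  then have b: "(bz p)\<^sup>2 = (sz p)\<^sup>2 - (Cz * (sz p)^3)\<^sup>2"
    by (simp add: az_eq[OF p])
  have "(tz p - center p)\<^sup>2 = (bz p)\<^sup>2 / (Cz\<^sup>2 * (sz p)\<^sup>2)"
    by (simp add: center_def power_divide power_mult_distrib field_simps)
  also have "\<dots> = 1 / Cz\<^sup>2 - ((sz p)\<^sup>2)\<^sup>2"
    unfolding b using s Cz_nonzero by (simp add: field_simps power2_eq_square power3_eq_cube)
  finally show ?thesis by (simp add: sphere_eq_def zz)
qed

lemma center_locally_constant:
  assumes p: "p \<in> M" "zpart p \<noteq> 0"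
  shows "\<exists>W. open W \<and> p \<in> W \<and> (\<forall>q\<in>M \<inter> W. zpart q \<noteq> 0 \<and> center q = center p)"
proof -
  have pM: "p \<in> M - S" using p noncharacteristic_iff by blast
  obtain U F where F: "patch U F" "p \<in> U"
    using local_patch[OF pM p(2) open_UNIV UNIV_I] by metis
  note e = patchD[OF F(1)] patch_eqs[OF F(1)]
  interpret patch: umbilic_patch U F c
    by (rule e(1))
  have pU: "p \<in> M \<inter> U" and F0: "F p = 0" using p F e(2) by auto
  have K0: "patch.K q = 0" if "q \<in> U" "F q = 0" for q
    using e(2)[of q] e(10)[of q] Kz_eq_0[of q] patch.z_nonzero[of q] that by simp
  obtain W where W: "open W" "p \<in> W" "W \<subseteq> U"
    "\<And>q. q \<in> W \<Longrightarrow> F q = 0 \<Longrightarrow> patch.t q + inverse patch.C * (patch.b q / patch.s q)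
      = patch.t p + inverse patch.C * (patch.b p / patch.s p)"
    using patch.center_locally_constant[OF K0 F(2) F0] by metis
  have "zpart q \<noteq> 0 \<and> center q = center p" if "q \<in> M \<inter> W" for q
  proof -
    have q: "q \<in> M \<inter> U" "F q = 0" using that W(3) e(2)[of q] by auto
    show ?thesis
      using W(4)[of q] that q patch.z_nonzero[of q] unfolding e(5-7) e(9)[OF q(1)] e(9)[OF pU] center_def by simp
  qed
  then show ?thesis using W by blast
qed

lemma bounded_linear_tz: "bounded_linear tz"
  unfolding tz_def[abs_def] by (intro bounded_linear_snd_comp bounded_linear_snd)

lemma sphere_eq_has_derivative:
  "(sphere_eq \<tau> has_derivative
    (\<lambda>v. 4 * (zpart q \<bullet> zpart q) * (zpart q \<bullet> zpart v) + 2 * (tz q - \<tau>) * tz v)) (at q)"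
proof -
  note [derivative_intros] = bounded_linear.has_derivative[OF bounded_linear_zpart]
    bounded_linear.has_derivative[OF bounded_linear_tz]
  show ?thesis
    unfolding sphere_eq_def[abs_def]
    by (auto intro!: derivative_eq_intros simp: fun_eq_iff inner_commute algebra_simps)
qed

lemma smooth_sphere_eq: "open U \<Longrightarrow> smooth U (sphere_eq \<tau>)"
  unfolding sphere_eq_def[abs_def]
  by (intro smooth_diff smooth_add smooth_power smooth_inner smooth_const smooth_linear
      bounded_linear_zpart bounded_linear_tz)

lemma D_sphere_eq_nonzero:
  assumes "sphere_eq \<tau> q = 0"
  shows "D (sphere_eq \<tau>) q \<noteq> (\<lambda>_. 0)"
proof
  assume D0: "D (sphere_eq \<tau>) q = (\<lambda>_. 0)"
  have D: "4 * (zpart q \<bullet> zpart q) * (zpart q \<bullet> zpart v) + 2 * (tz q - \<tau>) * tz v = 0" for v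
    using D_eqI[OF sphere_eq_has_derivative, of \<tau> q] D0 by (metis (no_types, lifting))
  have "zpart (fst q, fst (snd q), 0) = zpart q" "tz (fst q, fst (snd q), 0) = 0" "tz vert = 1"
    by (simp_all add: zpart_def tz_def vert_def)
  then have "zpart q = 0" "tz q = \<tau>"
    using D[of "(fst q, fst (snd q), 0)"] D[of vert] by (simp_all add: zpart_simps)
  then show False
    using assms Cz_nonzero by (simp add: sphere_eq_def)
qed

lemma continuous_sphere_eq: "continuous_on A (sphere_eq \<tau>)"
  using Cn_continuous[OF smooth_Cn[OF smooth_sphere_eq[OF open_UNIV]]] continuous_on_subset by blast

text \<open>The set is a continuous image of the unit sphere of R^(2 n), which gives the direction
  of z, times the open interval of heights t - \<open>\<tau>\<close>.\<close>

lemma connected_punctured_sphere: "connected {q. sphere_eq \<tau> q = 0 \<and> zpart q \<noteq> 0}"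
proof -
  define f :: "'a hor \<times> real \<Rightarrow> 'a heis" where
    "f = (\<lambda>(u, h). (sqrt (sqrt (R\<^sup>2 - h\<^sup>2)) *\<^sub>R fst u, sqrt (sqrt (R\<^sup>2 - h\<^sup>2)) *\<^sub>R snd u, \<tau> + h))"
  have zf: "zpart (f (u, h)) = sqrt (sqrt (R\<^sup>2 - h\<^sup>2)) *\<^sub>R u" and tf: "tz (f (u, h)) = \<tau> + h" for u h
    by (simp_all add: f_def zpart_def tz_def prod_eq_iff)
  have "connected (sphere (0 :: 'a hor) 1 \<times> {-R<..<R})"
    using card by (intro connected_Times connected_sphere) auto
  moreover have "continuous_on (sphere (0 :: 'a hor) 1 \<times> {-R<..<R}) f"
    unfolding f_def case_prod_beta by (intro continuous_intros)
  ultimately have "connected (f ` (sphere 0 1 \<times> {-R<..<R}))"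
    by (rule connected_continuous_image[rotated])
  moreover have "f ` (sphere 0 1 \<times> {-R<..<R}) = {q. sphere_eq \<tau> q = 0 \<and> zpart q \<noteq> 0}"
  proof (intro equalityI subsetI)
    fix q assume "q \<in> f ` (sphere 0 1 \<times> {-R<..<R})"
    then obtain u h where q: "q = f (u, h)" "norm u = 1" "- R < h" "h < R"
      by auto
    have h: "h\<^sup>2 < R\<^sup>2"
      using q(3,4) by (intro power2_strict_mono[of h R, unfolded abs_of_pos[OF R(1)]]) (simp add: abs_less_iff)
    have "u \<bullet> u = 1" using q(2) by (simp add: norm_eq_1)
    then have "zpart q \<bullet> zpart q = sqrt (R\<^sup>2 - h\<^sup>2)"
      using h unfolding q(1) zf by simp
    moreover have "(tz q - \<tau>)\<^sup>2 = h\<^sup>2" by (simp add: q(1) tf)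
    ultimately have "sphere_eq \<tau> q = 0" using h by (simp add: sphere_eq_def R(2))
    moreover have "zpart q \<noteq> 0" using h q(2) unfolding q(1) zf by auto
    ultimately show "q \<in> {q. sphere_eq \<tau> q = 0 \<and> zpart q \<noteq> 0}" by simp
  next
    fix q assume "q \<in> {q. sphere_eq \<tau> q = 0 \<and> zpart q \<noteq> 0}"
    then have q: "(zpart q \<bullet> zpart q)\<^sup>2 = R\<^sup>2 - (tz q - \<tau>)\<^sup>2" "zpart q \<noteq> 0"
      by (auto simp: sphere_eq_def R(2))
    define h where "h = tz q - \<tau>"
    define u where "u = (1 / norm (zpart q)) *\<^sub>R zpart q"
    have "(zpart q \<bullet> zpart q)\<^sup>2 > 0" using q(2) by simp
    then have "h\<^sup>2 < R\<^sup>2" using q(1) by (simp add: h_def)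
    then have "\<bar>h\<bar> < R"
      using R(1) by (metis abs_of_pos power2_less_imp_less power2_abs less_imp_le)
    then have "(u, h) \<in> sphere 0 1 \<times> {-R<..<R}" using q(2) by (auto simp: u_def)
    moreover have "f (u, h) = q"
    proof -
      have "sqrt (R\<^sup>2 - h\<^sup>2) = zpart q \<bullet> zpart q"
        using q(1) by (simp add: h_def[symmetric]) (metis inner_ge_zero real_sqrt_abs abs_of_nonneg)
      then have "sqrt (sqrt (R\<^sup>2 - h\<^sup>2)) = norm (zpart q)"
        by (simp add: norm_eq_sqrt_inner)
      then have "zpart (f (u, h)) = zpart q" using q(2) by (simp add: zf u_def)
      moreover have "tz (f (u, h)) = tz q" by (simp add: tf h_def)
      ultimately show ?thesis by (auto simp: zpart_def tz_def prod_eq_iff)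
    qed
    ultimately show "q \<in> f ` (sphere 0 1 \<times> {-R<..<R})" by (metis imageI)
  qed
  ultimately show ?thesis by simp
qed

text \<open>Points of M with centre \<open>\<tau>\<close> form an open subset of the punctured
  sphere, since M lies locally in the sphere and nested regular level sets agree locally. They form
  a closed subset, since M is closed and \<open>center\<close> is locally constant on it.\<close>

lemma punctured_sphere_subset:
  assumes p0: "p0 \<in> M" "zpart p0 \<noteq> 0" and q: "sphere_eq (center p0) q = 0" "zpart q \<noteq> 0"
  shows "q \<in> M" "center q = center p0"
proof -
  define \<tau> where "\<tau> = center p0"
  define P where "P = {q\<in>M. zpart q \<noteq> 0 \<and> center q = \<tau>}"
  define Q where "Q = {q. sphere_eq \<tau> q = 0 \<and> zpart q \<noteq> 0}"
  have PQ: "P \<subseteq> Q" using sphere_eq_center by (auto simp: P_def Q_def)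
  have "P = Q"
  proof (rule connected_locally_clopen)
    show "connected Q"
      unfolding Q_def by (rule connected_punctured_sphere)
    show "P \<subseteq> Q" by (rule PQ)
    show "P \<noteq> {}" using p0 unfolding P_def \<tau>_def by blast
  next
    fix x assume x: "x \<in> P"
    then have xM: "x \<in> M" "zpart x \<noteq> 0" "center x = \<tau>" "x \<in> M - S"
      using noncharacteristic_iff[of x] by (auto simp: P_def)
    obtain W where W: "open W" "x \<in> W" "\<forall>q\<in>M \<inter> W. zpart q \<noteq> 0 \<and> center q = center x"
      using center_locally_constant[OF xM(1,2)] by blast
    obtain U F where F: "patch U F" "x \<in> U" "U \<subseteq> W"
      using local_patch[OF xM(4,2) W(1,2)] by metis
    note e = patchD[OF F(1)] patch_eqs[OF F(1)]
    interpret patch: umbilic_patch U F c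
      by (rule e(1))
    have Fx: "F x = 0" using e(2)[OF F(2)] xM by simp
    have inP: "q \<in> P" if "q \<in> U" "F q = 0" for q
      using that F(3) e(2)[of q] W(3) xM(3) by (auto simp: P_def)
    have sx: "sphere_eq \<tau> x = 0" using x PQ by (auto simp: Q_def)
    obtain V where "open V" "x \<in> V" "V \<subseteq> U" "\<And>q. q \<in> V \<Longrightarrow> sphere_eq \<tau> q = 0 \<Longrightarrow> F q = 0"
    proof (rule level_set_eq_locally[OF patch.open_U F(2) smooth_Cn[OF patch.smooth_F]
          smooth_Cn[OF smooth_sphere_eq[OF patch.open_U]] Fx patch.D_F_nonzero[OF F(2) Fx] D_sphere_eq_nonzero[OF sx]])
      show "sphere_eq \<tau> q = 0" if "q \<in> U" "F q = 0" for q
        using inP[OF that] PQ by (auto simp: Q_def)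
    qed blast
    then show "\<exists>W. open W \<and> x \<in> W \<and> Q \<inter> W \<subseteq> P"
      using inP by (intro exI[of _ V]) (auto simp: Q_def)
  next
    fix x assume x: "x \<in> Q - P"
    show "\<exists>W. open W \<and> x \<in> W \<and> Q \<inter> W \<subseteq> Q - P"
    proof (cases "x \<in> M")
      case True
      then obtain W where "open W" "x \<in> W" "\<forall>q\<in>M \<inter> W. zpart q \<noteq> 0 \<and> center q = center x"
        using center_locally_constant[of x] x by (auto simp: Q_def)
      moreover have "center x \<noteq> \<tau>" using x True by (auto simp: P_def Q_def)
      ultimately show ?thesis by (intro exI[of _ W]) (auto simp: P_def)
    next
      case False
      then show ?thesis
        using compact_imp_closed[OF compact_M] by (intro exI[of _ "- M"]) (auto simp: P_def open_Compl)
    qed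
  qed
  then have "q \<in> P" using q by (simp add: Q_def \<tau>_def)
  then show "q \<in> M" "center q = center p0" by (auto simp: P_def \<tau>_def)
qed

lemma sphere_subset:
  assumes p0: "p0 \<in> M" "zpart p0 \<noteq> 0" and q: "sphere_eq (center p0) q = 0"
  shows "q \<in> M"
proof (cases "zpart q = 0")
  case False
  then show ?thesis using punctured_sphere_subset[OF p0 q] by blast
next
  case True
  define \<tau> where "\<tau> = center p0"
  define h where "h = tz q - \<tau>"
  have h: "h\<^sup>2 = 1 / Cz\<^sup>2" using q True by (simp add: sphere_eq_def h_def \<tau>_def)
  then have h0: "h \<noteq> 0" using Cz_nonzero by auto
  obtain u :: "'a hor" where u: "u \<in> Basis"
    using nonempty_Basis by blast
  \<comment> \<open>A curve on the sphere at distance r from the axis that ends at the pole q: with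
    h^2 = 1 / C^2 one has r^4 + h^2 (1 - C^2 r^4) = 1 / C^2. As M is closed, it contains the
    limit.\<close>
  define f :: "real \<Rightarrow> 'a heis" where
    "f r = (r *\<^sub>R fst u, r *\<^sub>R snd u, \<tau> + h * sqrt (1 - Cz\<^sup>2 * r^4))" for r
  have zf: "zpart (f r) = r *\<^sub>R u" "tz (f r) = \<tau> + h * sqrt (1 - Cz\<^sup>2 * r^4)" for r
    by (simp_all add: f_def zpart_def tz_def prod_eq_iff)
  have "continuous_on UNIV f"
    unfolding f_def[abs_def] by (intro continuous_intros)
  then have "(f \<longlongrightarrow> f 0) (at_right 0)"
    by (auto simp: continuous_on_def intro: tendsto_within_subset)
  moreover have "f 0 = q" using True by (simp add: f_def h_def tz_def zpart_def prod_eq_iff)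
  moreover have "\<forall>\<^sub>F r in at_right 0. f r \<in> M"
  proof -
    have "((\<lambda>r. Cz\<^sup>2 * r^4) \<longlongrightarrow> Cz\<^sup>2 * 0^4) (at_right (0::real))"
      by (intro tendsto_intros)
    then have "\<forall>\<^sub>F r in at_right (0::real). Cz\<^sup>2 * r^4 < 1"
      by (rule order_tendstoD) simp
    moreover have "\<forall>\<^sub>F r in at_right (0::real). r > 0"
      by (rule eventually_at_right_less)
    ultimately show ?thesis
    proof eventually_elim
      case (elim r)
      have "u \<bullet> u = 1" using u by simp
      then have "zpart (f r) \<bullet> zpart (f r) = r\<^sup>2" by (simp add: zf power2_eq_square)
      moreover have "(tz (f r) - \<tau>)\<^sup>2 = 1 / Cz\<^sup>2 * (1 - Cz\<^sup>2 * r^4)"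
        using elim h by (simp add: zf power_mult_distrib)
      ultimately have "sphere_eq \<tau> (f r) = 0"
        using Cz_nonzero by (simp add: sphere_eq_def field_simps)
      moreover have "zpart (f r) \<noteq> 0" using elim u nonzero_Basis by (auto simp: zf)
      ultimately show ?case using punctured_sphere_subset(1)[OF p0] by (simp add: \<tau>_def)
    qed
  qed
  ultimately show ?thesis
    using Lim_in_closed_set[OF compact_imp_closed[OF compact_M], of f "at_right 0" "f 0"] by simp
qed

text \<open>It remains to see that the sphere, closed and contained in M, is open in M. Off the axis
  \<open>center\<close> is locally constant. At a pole a C^2 equation of M suffices to compare the
  level sets, now with the sphere as the smaller one.\<close>

lemma M_eq_sphere:
  assumes p0: "p0 \<in> M" "zpart p0 \<noteq> 0"
  shows "M = {q. sphere_eq (center p0) q = 0}"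
proof -
  define \<tau> where "\<tau> = center p0"
  define Q where "Q = {q. sphere_eq \<tau> q = 0}"
  have QM: "Q \<subseteq> M" using sphere_subset[OF p0] by (auto simp: Q_def \<tau>_def)
  have "Q = M"
  proof (rule connected_locally_clopen[OF connected_M QM])
    show "Q \<noteq> {}" using sphere_eq_center[OF p0] unfolding Q_def \<tau>_def by blast
  next
    fix x assume x: "x \<in> Q"
    show "\<exists>W. open W \<and> x \<in> W \<and> M \<inter> W \<subseteq> Q"
    proof (cases "zpart x = 0")
      case False
      then have c: "center x = \<tau>"
        using punctured_sphere_subset(2)[OF p0] x by (auto simp: Q_def \<tau>_def)
      obtain W where "open W" "x \<in> W" "\<forall>q\<in>M \<inter> W. zpart q \<noteq> 0 \<and> center q = center x"
        using center_locally_constant[of x] x QM False by blast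
      then show ?thesis using sphere_eq_center c by (intro exI[of _ W]) (fastforce simp: Q_def)
    next
      case True
      have xM: "x \<in> M" using x QM by blast
      obtain U and F :: "'a heis \<Rightarrow> real" where F: "open U" "x \<in> U" "Cn 2 U F" "M \<inter> U = {q\<in>U. F q = 0}"
        "\<forall>q\<in>U. D F q \<noteq> (\<lambda>_. 0)"
        using local_C2[OF xM] by blast
      have C1: "Cn 1 U F" by (rule Cn_le[OF F(3)]) simp
      have sx: "sphere_eq \<tau> x = 0" using x by (simp add: Q_def)
      obtain V where "open V" "x \<in> V" "V \<subseteq> U" "\<And>q. q \<in> V \<Longrightarrow> F q = 0 \<Longrightarrow> sphere_eq \<tau> q = 0"
      proof (rule level_set_eq_locally[OF F(1,2) smooth_Cn[OF smooth_sphere_eq[OF F(1)]] C1 sx D_sphere_eq_nonzero[OF sx]])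
        show "D F x \<noteq> (\<lambda>_. 0)" using F by blast
        show "F q = 0" if "q \<in> U" "sphere_eq \<tau> q = 0" for q
          using that QM F(4) by (auto simp: Q_def)
      qed blast
      moreover from this have "M \<inter> V \<subseteq> Q"
        using F(4) unfolding Q_def by blast
      ultimately show ?thesis by blast
    qed
  next
    fix x assume x: "x \<in> M - Q"
    have "open (- Q)"
      using closed_Collect_eq[of "sphere_eq \<tau>" "\<lambda>_. 0"] continuous_sphere_eq
      by (simp add: Q_def open_Compl)
    then show "\<exists>W. open W \<and> x \<in> W \<and> M \<inter> W \<subseteq> M - Q"
      using x by (intro exI[of _ "- Q"]) auto
  qed
  then show ?thesis by (simp add: Q_def \<tau>_def)
qed

end

context compact_umbilic_hypersurface
begin

lemma heis_gauge_translate: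
  "heis_gauge (heis_mult (heis_inverse (0, 0, \<tau>)) q) = root 4 (sphere_eq \<tau> q + 1 / Cz\<^sup>2)"
  by (cases q) (simp add: heis_gauge_def heis_mult_def heis_inverse_def sphere_eq_def zpart_def tz_def
      inner_prod_def power2_norm_eq_inner)

lemma gauge_ball_eq:
  assumes "r > 0" "r^4 = 1 / Cz\<^sup>2"
  shows "gauge_ball (0, 0, \<tau>) r = {q. sphere_eq \<tau> q < 0}"
proof -
  have "r = root 4 (r^4)" using assms(1) by (simp add: real_root_power_cancel)
  then have "root 4 x < r \<longleftrightarrow> x < r^4" for x
    by (metis real_root_less_iff zero_less_numeral)
  then show ?thesis by (auto simp: gauge_ball_def heis_gauge_translate assms(2))
qed

text \<open>Contracting a point of the sphere affinely towards the centre makes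
  \<open>sphere_eq\<close> negative, so every point of the sphere is a limit of interior
  points.\<close>

lemma frontier_sphere_interior: "frontier {q. sphere_eq \<tau> q < 0} = {q. sphere_eq \<tau> q = 0}"
proof -
  have op: "open {q. sphere_eq \<tau> q < 0}"
    using continuous_sphere_eq by (intro open_Collect_less) auto
  have "closure {q. sphere_eq \<tau> q < 0} \<subseteq> {q. sphere_eq \<tau> q \<le> 0}"
    using continuous_sphere_eq by (intro closure_minimal closed_Collect_le) auto
  moreover have "q \<in> closure {q. sphere_eq \<tau> q < 0}" if q: "sphere_eq \<tau> q = 0" for q
  proof -
    define f :: "real \<Rightarrow> 'a heis" where
      "f r = (r *\<^sub>R fst q, r *\<^sub>R fst (snd q), \<tau> + r * (tz q - \<tau>))" for r
    have zf: "zpart (f r) = r *\<^sub>R zpart q" "tz (f r) = \<tau> + r * (tz q - \<tau>)" for r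
      by (simp_all add: f_def zpart_def tz_def)
    have "continuous_on UNIV f"
      unfolding f_def[abs_def] by (intro continuous_intros)
    then have "(f \<longlongrightarrow> f 1) (at_left 1)"
      by (auto simp: continuous_on_def intro: tendsto_within_subset)
    moreover have "f 1 = q" by (simp add: f_def tz_def prod_eq_iff)
    moreover have "\<forall>\<^sub>F r in at_left (1::real). f r \<in> closure {q. sphere_eq \<tau> q < 0}"
    proof -
      have "\<forall>\<^sub>F r in at_left (1::real). r \<in> {0<..<1}"
        by (rule eventually_at_leftI[of 0]) auto
      then show ?thesis
      proof eventually_elim
        case (elim r)
        have r2: "r\<^sup>2 < 1" "r\<^sup>2 \<ge> 0" using elim by (auto simp: power_less_one_iff)
        have "sphere_eq \<tau> (f r) = r\<^sup>2 * r\<^sup>2 * (zpart q \<bullet> zpart q)\<^sup>2 + r\<^sup>2 * (tz q - \<tau>)\<^sup>2 - 1 / Cz\<^sup>2"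
          by (simp add: sphere_eq_def zf power_mult_distrib power2_eq_square mult_ac)
        also have "\<dots> \<le> 1 * r\<^sup>2 * (zpart q \<bullet> zpart q)\<^sup>2 + r\<^sup>2 * (tz q - \<tau>)\<^sup>2 - 1 / Cz\<^sup>2"
          using r2 by (intro diff_right_mono add_right_mono mult_right_mono) auto
        also have "\<dots> = r\<^sup>2 * ((zpart q \<bullet> zpart q)\<^sup>2 + (tz q - \<tau>)\<^sup>2) - 1 / Cz\<^sup>2"
          by (simp add: algebra_simps)
        also have "(zpart q \<bullet> zpart q)\<^sup>2 + (tz q - \<tau>)\<^sup>2 = 1 / Cz\<^sup>2"
          using q by (simp add: sphere_eq_def)
        also have "r\<^sup>2 * (1 / Cz\<^sup>2) - 1 / Cz\<^sup>2 < 0"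
          using r2(1) Cz_nonzero by (simp add: divide_strict_right_mono)
        finally show ?case using closure_subset by fastforce
      qed
    qed
    ultimately show ?thesis
      using Lim_in_closed_set[OF closed_closure, of f "{q. sphere_eq \<tau> q < 0}" "at_left 1" "f 1"] by simp
  qed
  ultimately show ?thesis
    unfolding frontier_def interior_open[OF op] by fastforce
qed

text \<open>The component of q in the complement of M is connected and misses the sphere, so it
  stays where \<open>sphere_eq\<close> is negative. This set is bounded, whereas
  \<open>outside\<close> consists of points in unbounded components.\<close>

lemma sphere_interior_not_outside:
  assumes M: "M = {q. sphere_eq \<tau> q = 0}" and q: "sphere_eq \<tau> q < 0"
  shows "q \<notin> outside M"
proof
  assume "q \<in> outside M"
  then have unb: "\<not> bounded (connected_component_set (- M) q)" by (simp add: outside_def)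
  let ?K = "connected_component_set (- M) q"
  have "?K \<subseteq> - M" by (rule connected_component_subset)
  then have cover: "?K \<subseteq> {q. sphere_eq \<tau> q < 0} \<union> {q. sphere_eq \<tau> q > 0}"
    using M by auto
  have "open {q. sphere_eq \<tau> q < 0}" "open {q. sphere_eq \<tau> q > 0}"
    using continuous_sphere_eq by (auto intro!: open_Collect_less)
  moreover have "q \<in> ?K" using q M by (simp add: connected_component_refl_eq)
  ultimately have K: "?K \<subseteq> {q. sphere_eq \<tau> q < 0}"
    using connectedD[OF connected_connected_component, of "{q. sphere_eq \<tau> q < 0}" "{q. sphere_eq \<tau> q > 0}" "- M" q]
      cover q by fastforce
  have "bounded {q. sphere_eq \<tau> q < 0}"
  proof (rule boundedI)
    fix x assume "x \<in> {q. sphere_eq \<tau> q < 0}"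
    then have x: "(zpart x \<bullet> zpart x)\<^sup>2 + (tz x - \<tau>)\<^sup>2 < R\<^sup>2"
      by (simp add: sphere_eq_def R)
    then have "(zpart x \<bullet> zpart x)\<^sup>2 < R\<^sup>2" "(tz x - \<tau>)\<^sup>2 < R\<^sup>2"
      using zero_le_power2[of "zpart x \<bullet> zpart x"] zero_le_power2[of "tz x - \<tau>"] by linarith+
    then have z: "zpart x \<bullet> zpart x < R" and t: "\<bar>tz x - \<tau>\<bar> < R"
      using R(1) power2_less_imp_less[of "\<bar>tz x - \<tau>\<bar>" R] by (auto intro: power2_less_imp_less)
    have "norm (zpart x) \<le> sqrt R" using z by (simp add: norm_eq_sqrt_inner)
    moreover have "norm (fst x) \<le> norm (zpart x)" "norm (fst (snd x)) \<le> norm (zpart x)"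
      using norm_fst_le[of "fst x" "fst (snd x)"] norm_snd_le[of "fst (snd x)" "fst x"] by (simp_all add: zpart_def)
    moreover have "norm x \<le> norm (fst x) + (norm (fst (snd x)) + norm (snd (snd x)))"
      using norm_Pair_le[of "fst x" "snd x"] norm_Pair_le[of "fst (snd x)" "snd (snd x)"] by simp
    moreover have "norm (snd (snd x)) \<le> \<bar>\<tau>\<bar> + R" using t by (simp add: tz_def)
    ultimately show "norm x \<le> 2 * sqrt R + (\<bar>\<tau>\<bar> + R)" by linarith
  qed
  then show False
    using unb K bounded_subset by blast
qed

text \<open>The sign is seen at an equatorial point q, where t = \<open>\<tau>\<close> and hence b =
  0: there the normal is horizontal and z = C s^3 N. For C < 0 it would point towards the axis and
  so into the ball.\<close>

lemma Cz_pos: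
  assumes M: "M = {q. sphere_eq \<tau> q = 0}" and p0: "p0 \<in> M" "zpart p0 \<noteq> 0" and \<tau>: "center p0 = \<tau>"
    and out: "\<And>p. p \<in> M \<Longrightarrow> \<forall>\<^sub>F s in at_right 0. p + s *\<^sub>R \<nu> p \<in> outside M"
  shows "Cz > 0"
proof (rule ccontr)
  assume "\<not> Cz > 0"
  then have neg: "Cz < 0" using Cz_nonzero by simp
  obtain u :: "'a hor" where u: "u \<in> Basis"
    using nonempty_Basis by blast
  define q :: "'a heis" where "q = (sqrt R *\<^sub>R fst u, sqrt R *\<^sub>R snd u, \<tau>)"
  have zq: "zpart q = sqrt R *\<^sub>R u" "tz q = \<tau>"
    by (simp_all add: q_def zpart_def tz_def prod_eq_iff)
  have "u \<bullet> u = 1" using u by simp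
  then have zz: "zpart q \<bullet> zpart q = R" using R by (simp add: zq)
  then have sq: "sphere_eq \<tau> q = 0" by (simp add: sphere_eq_def zq(2) R(2))
  have z0: "zpart q \<noteq> 0" using zz R by auto
  have qM: "q \<in> M" "center q = \<tau>"
    using punctured_sphere_subset[OF p0, of q] sq z0 \<tau> by auto
  have qS: "q \<in> M - S" using noncharacteristic_iff qM z0 by blast
  have s: "sz q > 0" using z0 by (simp add: sz_def)
  have b0: "bz q = 0" using qM(2) zq(2) s Cz_nonzero by (simp add: center_def)
  note d = z_decomposition[OF qS z0]
  have T0: "T_coeff q (\<nu> q) = 0" using d(3) b0 s normal_zpart_nonzero[OF qS] by simp
  \<comment> \<open>The factor for which m z is the horizontal part of the normal; it has the sign
    of C.\<close>
  define m where "m = norm (zpart (\<nu> q)) / (Cz * (sz q)^3)"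
  have m: "m < 0"
    using neg s normal_zpart_nonzero[OF qS] by (simp add: m_def divide_pos_neg mult_neg_pos)
  have "zpart q = (Cz * (sz q)^3) *\<^sub>R N q" using d(1) b0 az_eq[OF qM(1) z0] by simp
  then have "m *\<^sub>R zpart q = zpart (\<nu> q)"
    using arg_cong[of "zpart q" _ "\<lambda>x. m *\<^sub>R x"] s Cz_nonzero normal_zpart_nonzero[OF qS]
    by (simp add: m_def hnormal_def)
  then have \<nu>q: "\<nu> q = lift q (m *\<^sub>R zpart q)"
    using lift_decomposition[of "\<nu> q" q] T0 by simp
  have line: "zpart (q + r *\<^sub>R \<nu> q) = (1 + r * m) *\<^sub>R zpart q" "tz (q + r *\<^sub>R \<nu> q) = \<tau>" for r
    by (simp_all add: \<nu>q zpart_simps scaleR_left_distrib)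
       (simp add: lift_def tz_def hJ_simps hJ_inner zq(2)[unfolded tz_def])
  have "\<forall>\<^sub>F r in at_right (0::real). r \<in> {0<..<1 / - m}"
    using m by (intro eventually_at_rightI[of 0]) auto
  then have "\<forall>\<^sub>F r in at_right 0. q + r *\<^sub>R \<nu> q \<notin> outside M"
  proof eventually_elim
    case (elim r)
    then have "0 < 1 + r * m" "1 + r * m < 1" using m by (auto simp: field_simps mult_neg_pos)
    then have "(1 + r * m)^4 < 1" by (simp add: power_less_one_iff)
    moreover have "sphere_eq \<tau> (q + r *\<^sub>R \<nu> q) = ((1 + r * m)^4 - 1) * R\<^sup>2"
      unfolding sphere_eq_def line R(2)[symmetric] inner_scaleR_left inner_scaleR_right zz
      by (simp add: power2_eq_square power4_eq_xxxx algebra_simps)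
    ultimately have "sphere_eq \<tau> (q + r *\<^sub>R \<nu> q) < 0"
      using R(1) by (simp add: mult_neg_pos)
    then show ?case by (rule sphere_interior_not_outside[OF M])
  qed
  with out[OF qM(1)] have "\<forall>\<^sub>F r in at_right (0::real). False"
    by eventually_elim blast
  then show False
    by simp
qed

end

theorem theorem1p2:
  fixes M :: "'n::finite heis set"
    and \<nu> :: "'n heis \<Rightarrow> 'n heis"
    and c :: real
  assumes "CARD('n) \<ge> 2"
    and "smooth_hypersurface M" and "M \<noteq> {}"
    and "connected M" and "orientable_hypersurface M" and "compact M"
    and "outward_unit_normal M \<nu>"
    and "umbilic M \<nu>"
    and "c \<noteq> 0"
    and "\<And>x y t. (x, y, t) \<in> M - characteristic_set M \<Longrightarrow>
           horizontal_mean_curvature M \<nu> (x, y, t) = c * sqrt ((norm x)\<^sup>2 + (norm y)\<^sup>2)"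
  shows "c > 0 \<and>
    (\<exists>t\<^sub>0. M = frontier (gauge_ball (0, 0, t\<^sub>0)
        (sqrt (1 / c * ((2 * real CARD('n) + 1) / (2 * real CARD('n) - 1))))))"
proof -
  interpret compact_umbilic_hypersurface M \<nu> c
    using assms by unfold_locales (auto simp: outward_unit_normal_def)
  obtain x where "x \<in> M"
    using assms(3) by blast
  \<comment> \<open>Density of the noncharacteristic points, applied to the whole space, provides
    one; off the axis it determines the centre.\<close>
  then obtain p0 where "p0 \<in> M - characteristic_set M"
    using noncharacteristic_dense[of x UNIV] by auto
  then have p0: "p0 \<in> M" "zpart p0 \<noteq> 0" using noncharacteristic_iff by blast+
  define \<tau> where "\<tau> = center p0"
  have M: "M = {q. sphere_eq \<tau> q = 0}" using M_eq_sphere[OF p0] by (simp add: \<tau>_def)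
  have C: "Cz > 0"
    using Cz_pos[OF M p0 \<tau>_def[symmetric]] assms(7) by (simp add: outward_unit_normal_def)
  define r where "r = sqrt (1 / c * ((2 * real CARD('n) + 1) / (2 * real CARD('n) - 1)))"
  have "1 / c * ((2 * real CARD('n) + 1) / (2 * real CARD('n) - 1)) = 1 / Cz" by (simp add: Cz_def)
  then have r: "r = sqrt (1 / Cz)" by (simp add: r_def)
  have "r > 0" using C by (simp add: r)
  moreover have "r^4 = 1 / Cz\<^sup>2"
  proof -
    have "r^4 = (r\<^sup>2)\<^sup>2" by simp
    also have "r\<^sup>2 = 1 / Cz" using C by (simp add: r)
    finally show ?thesis by (simp add: power_divide)
  qed
  ultimately have "M = frontier (gauge_ball (0, 0, \<tau>) r)"
    by (simp add: gauge_ball_eq frontier_sphere_interior M)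
  moreover have "c > 0"
    using C assms(1) by (simp add: Cz_def zero_less_divide_iff zero_less_mult_iff)
  ultimately show ?thesis
    unfolding r_def by blast
qed

end
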